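(* For every $\lambda,\mu\in\mathbb{C}\setminus\mathbb{Z}$, the vector space $F(\tfrac{\lambda}{z},\tfrac{\mu}{z})\otimes F_{-1}\cong F\otimes F_{-1}$ carries a $\hat{\mathfrak g}$-module structure uniquely determined by $$e(m)=\sum_{i\in\mathbb{Z}}(\lambda-i)\Psi^{+}(i-\tfrac12)\otimes e^{\beta}_{m-i-1},\qquad f(m)=\sum_{i\in\mathbb{Z}}(\mu-i)\Psi^{-}(i-\tfrac12)\otimes e^{-\beta}_{m-i-1},$$ $$h(m)=-2\beta(m)+(\lambda-\mu)\delta_{m,0},\qquad c=-2\qquad(m\in\mathbb{Z}).$$ Moreover, $F(\tfrac{\lambda}{z},\tfrac{\mu}{z})\otimes F_{-1}$ is a completely reducible $\hat{\mathfrak g}$-module and $$F(\tfrac{\lambda}{z},\tfrac{\mu}{z})\otimes F_{-1}\cong\bigoplus_{s\in\mathbb{Z}}\pi_s(E_{\lambda,\mu}).$$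
   Context: $\mathfrak g=sl_2(\mathbb{C})$ with basis $e,f,h$, $[h,e]=2e$, $[h,f]=-2f$, $[e,f]=h$; $\hat{\mathfrak g}=\mathfrak g\otimes\mathbb{C}[t,t^{-1}]\oplus\mathbb{C}c$ is the affine Lie algebra (form normalized by $(e,f)=1,(h,h)=2$), $x(n)=x\otimes t^n$. For a $\hat{\mathfrak g}$-module $M$ of level $k$ and $s\in\mathbb{Z}$, $\pi_s(M)$ is the same vector space with $e(n),f(n),h(n)$ acting as $e(n-s)$, $f(n+s)$, $h(n)-sk\delta_{n,0}$ act on $M$, and $c$ acting as $k$. $F$ is the irreducible module, generated by $\mathbf 1$ with $\Psi^\pm(r)\mathbf 1=0$ for $r>0$, of the Clifford algebra with generators $\Psi^{\pm}(r)$, $r\in\frac12+\mathbb{Z}$, and relations $\{\Psi^{\pm}(r),\Psi^{\mp}(s)\}=\delta_{r+s,0}$, $\{\Psi^{\pm}(r),\Psi^{\pm}(s)\}=0$. $F(\frac{\lambda}{z},\frac{\mu}{z})$ is, as a vector space, $F$. $F_{-1}=V_{\mathbb{Z}\beta}$, $\langle\beta,\beta\rangle=-1$, is the lattice vertex superalgebra with trivial cocycle ($Y(e^{m\beta},z)e^{n\beta}=z^{-mn}(e^{(m+n)\beta}+O(z))$), $Y(e^{\pm\beta},z)=\sum_n e^{\pm\beta}_nz^{-n-1}$; tensor products of operators act by $(A\otimes B)(x\otimes y)=Ax\otimes By$. Let $J^f(0)$ be the charge operator on $F$ ($J^f(0)\mathbf 1=0$, $[J^f(0),\Psi^\pm(r)]=\pm\Psi^\pm(r)$)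 and $H(0)=J^f(0)\otimes1+1\otimes\beta(0)$. Then $E_{\lambda,\mu}:=\mathcal{L}_0(F(\frac{\lambda}{z},\frac{\mu}{z}))=\{v\in F(\frac{\lambda}{z},\frac{\mu}{z})\otimes F_{-1}\mid H(0)v=0\}$ with the restricted $\hat{\mathfrak g}$-action; it is an irreducible $\hat{\mathfrak g}$-module. *)

theory Defs
  imports Complex_Main "HOL-Library.Poly_Mapping" "HOL-Library.Groups_Big_Fun" "HOL-Library.FSet"
begin

text \<open>
  All vector spaces are over \<open>complex\<close>. An abstract one is a type of class \<open>ab_group_add\<close>
  with a scalar multiplication satisfying the locale \<^locale>\<open>vector_space\<close>; a vector space with a
  given basis \<open>'b\<close> is the type \<open>'b \<Rightarrow>\<^sub>0 complex\<close> of finitely supported functions.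
\<close>

definition pscale :: "('c \<Rightarrow> 'v \<Rightarrow> 'v::zero) \<Rightarrow> 'c \<Rightarrow> ('b \<Rightarrow>\<^sub>0 'v) \<Rightarrow> ('b \<Rightarrow>\<^sub>0 'v)" where
  "pscale scale c = Poly_Mapping.map (scale c)"

abbreviation cscale :: "complex \<Rightarrow> ('b \<Rightarrow>\<^sub>0 complex) \<Rightarrow> ('b \<Rightarrow>\<^sub>0 complex)" where
  "cscale \<equiv> pscale (*)"

abbreviation bvec :: "'b \<Rightarrow> ('b \<Rightarrow>\<^sub>0 complex)" where
  "bvec b \<equiv> Poly_Mapping.single b 1"

text \<open>The linear extension of a map given on basis vectors.\<close>

definition lin_ext ::
  "(complex \<Rightarrow> 'v \<Rightarrow> 'v) \<Rightarrow> ('b \<Rightarrow> 'v::ab_group_add) \<Rightarrow> ('b \<Rightarrow>\<^sub>0 complex) \<Rightarrow> 'v" where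
  "lin_ext scale g p = (\<Sum>b\<in>Poly_Mapping.keys p. scale (Poly_Mapping.lookup p b) (g b))"


section \<open>The affine Lie algebra of sl2\<close>

datatype sl2_basis = sl2_e | sl2_f | sl2_h

fun sl2_bracket :: "sl2_basis \<Rightarrow> sl2_basis \<Rightarrow> (sl2_basis \<Rightarrow>\<^sub>0 complex)" where
  "sl2_bracket sl2_h sl2_e = Poly_Mapping.single sl2_e 2"
| "sl2_bracket sl2_e sl2_h = Poly_Mapping.single sl2_e (- 2)"
| "sl2_bracket sl2_h sl2_f = Poly_Mapping.single sl2_f (- 2)"
| "sl2_bracket sl2_f sl2_h = Poly_Mapping.single sl2_f 2"
| "sl2_bracket sl2_e sl2_f = Poly_Mapping.single sl2_h 1"
| "sl2_bracket sl2_f sl2_e = Poly_Mapping.single sl2_h (- 1)"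
| "sl2_bracket _ _ = 0"

fun sl2_form :: "sl2_basis \<Rightarrow> sl2_basis \<Rightarrow> complex" where
  "sl2_form sl2_e sl2_f = 1"
| "sl2_form sl2_f sl2_e = 1"
| "sl2_form sl2_h sl2_h = 2"
| "sl2_form _ _ = 0"

text \<open>\<open>Loop x n\<close> stands for \<open>x(n) = x \<otimes> t\<^sup>n\<close> and \<open>Central\<close> for \<open>c\<close>.\<close>

datatype affine_basis = Loop sl2_basis int | Central

type_synonym affine_sl2 = "affine_basis \<Rightarrow>\<^sub>0 complex"

fun affine_bracket_basis :: "affine_basis \<Rightarrow> affine_basis \<Rightarrow> affine_sl2" where
  "affine_bracket_basis (Loop x m) (Loop y n) =
     lin_ext cscale (\<lambda>z. bvec (Loop z (m + n))) (sl2_bracket x y)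
     + Poly_Mapping.single Central (if m + n = 0 then of_int m * sl2_form x y else 0)"
| "affine_bracket_basis _ _ = 0"

definition affine_bracket :: "affine_sl2 \<Rightarrow> affine_sl2 \<Rightarrow> affine_sl2" where
  "affine_bracket x y = lin_ext cscale (\<lambda>a. lin_ext cscale (affine_bracket_basis a) y) x"


section \<open>Modules over the affine Lie algebra\<close>

text \<open>A module is a subspace \<open>W\<close> of an ambient vector space with an action \<open>\<rho>\<close>; values of
  \<open>\<rho> x\<close> outside \<open>W\<close> are irrelevant.\<close>

locale affine_module = vector_space scale
  for scale :: "complex \<Rightarrow> 'v::ab_group_add \<Rightarrow> 'v" +
  fixes W :: "'v set" and \<rho> :: "affine_sl2 \<Rightarrow> 'v \<Rightarrow> 'v"
  assumes carrier_subspace: "subspace W"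
    and action_closed: "v \<in> W \<Longrightarrow> \<rho> x v \<in> W"
    and action_add: "v \<in> W \<Longrightarrow> w \<in> W \<Longrightarrow> \<rho> x (v + w) = \<rho> x v + \<rho> x w"
    and action_scale: "v \<in> W \<Longrightarrow> \<rho> x (scale c v) = scale c (\<rho> x v)"
    and add_action: "v \<in> W \<Longrightarrow> \<rho> (x + y) v = \<rho> x v + \<rho> y v"
    and scale_action: "v \<in> W \<Longrightarrow> \<rho> (cscale c x) v = scale c (\<rho> x v)"
    and action_bracket:
      "v \<in> W \<Longrightarrow> \<rho> (affine_bracket x y) v = \<rho> x (\<rho> y v) - \<rho> y (\<rho> x v)"

definition affine_irreducible ::
  "(complex \<Rightarrow> 'v::ab_group_add \<Rightarrow> 'v) \<Rightarrow> 'v set \<Rightarrow> (affine_sl2 \<Rightarrow> 'v \<Rightarrow> 'v) \<Rightarrow> bool" where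
  "affine_irreducible scale W \<rho> \<longleftrightarrow>
     affine_module scale W \<rho> \<and> W \<noteq> {0} \<and>
     (\<forall>U. U \<subseteq> W \<longrightarrow> affine_module scale U \<rho> \<longrightarrow> U = {0} \<or> U = W)"

text \<open>Completely reducible: the internal direct sum of a family of irreducible submodules.\<close>

definition affine_completely_reducible ::
  "(complex \<Rightarrow> 'v::ab_group_add \<Rightarrow> 'v) \<Rightarrow> 'v set \<Rightarrow> (affine_sl2 \<Rightarrow> 'v \<Rightarrow> 'v) \<Rightarrow> bool" where
  "affine_completely_reducible scale W \<rho> \<longleftrightarrow>
     affine_module scale W \<rho> \<and>
     (\<exists>\<U>. (\<forall>U\<in>\<U>. U \<subseteq> W \<and> affine_irreducible scale U \<rho>) \<and>
          (\<forall>w\<in>W. \<exists>!g :: 'v set \<Rightarrow>\<^sub>0 'v.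
              Poly_Mapping.keys g \<subseteq> \<U> \<and> (\<forall>U\<in>\<U>. Poly_Mapping.lookup g U \<in> U) \<and>
              w = (\<Sum>U\<in>Poly_Mapping.keys g. Poly_Mapping.lookup g U)))"

definition affine_isomorphic ::
  "(complex \<Rightarrow> 'v::ab_group_add \<Rightarrow> 'v) \<Rightarrow> 'v set \<Rightarrow> (affine_sl2 \<Rightarrow> 'v \<Rightarrow> 'v) \<Rightarrow>
   (complex \<Rightarrow> 'w::ab_group_add \<Rightarrow> 'w) \<Rightarrow> 'w set \<Rightarrow> (affine_sl2 \<Rightarrow> 'w \<Rightarrow> 'w) \<Rightarrow> bool" where
  "affine_isomorphic scale W \<rho> scale' W' \<rho>' \<longleftrightarrow>
     affine_module scale W \<rho> \<and> affine_module scale' W' \<rho>' \<and>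
     (\<exists>\<phi>. bij_betw \<phi> W W' \<and>
          (\<forall>v\<in>W. \<forall>w\<in>W. \<phi> (v + w) = \<phi> v + \<phi> w) \<and>
          (\<forall>c. \<forall>v\<in>W. \<phi> (scale c v) = scale' c (\<phi> v)) \<and>
          (\<forall>x. \<forall>v\<in>W. \<phi> (\<rho> x v) = \<rho>' x (\<phi> v)))"

text \<open>The action of the spectral flow \<open>\<pi>\<^sub>s(M)\<close> on the vector space of a module \<open>M\<close> of
  level \<open>k\<close> with action \<open>\<rho>\<close>.\<close>

fun spectral_flow_basis ::
  "(complex \<Rightarrow> 'v::ab_group_add \<Rightarrow> 'v) \<Rightarrow> complex \<Rightarrow> int \<Rightarrow> (affine_sl2 \<Rightarrow> 'v \<Rightarrow> 'v)
   \<Rightarrow> affine_basis \<Rightarrow> 'v \<Rightarrow> 'v" where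
  "spectral_flow_basis scale k s \<rho> (Loop sl2_e n) v = \<rho> (bvec (Loop sl2_e (n - s))) v"
| "spectral_flow_basis scale k s \<rho> (Loop sl2_f n) v = \<rho> (bvec (Loop sl2_f (n + s))) v"
| "spectral_flow_basis scale k s \<rho> (Loop sl2_h n) v =
     \<rho> (bvec (Loop sl2_h n)) v - (if n = 0 then scale (of_int s * k) v else 0)"
| "spectral_flow_basis scale k s \<rho> Central v = scale k v"

definition spectral_flow ::
  "(complex \<Rightarrow> 'v::ab_group_add \<Rightarrow> 'v) \<Rightarrow> complex \<Rightarrow> int \<Rightarrow> (affine_sl2 \<Rightarrow> 'v \<Rightarrow> 'v)
   \<Rightarrow> affine_sl2 \<Rightarrow> 'v \<Rightarrow> 'v" where
  "spectral_flow scale k s \<rho> x v = lin_ext scale (\<lambda>b. spectral_flow_basis scale k s \<rho> b v) x"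

text \<open>The external direct sum of modules \<open>(W i, \<rho> i)\<close>, all contained in the same ambient space;
  its scalar multiplication is \<open>pscale scale\<close>.\<close>

definition dsum_carrier :: "('i \<Rightarrow> 'v set) \<Rightarrow> ('i \<Rightarrow>\<^sub>0 'v::zero) set" where
  "dsum_carrier W = {p. \<forall>i. Poly_Mapping.lookup p i \<in> W i}"

definition dsum_action ::
  "('i \<Rightarrow> affine_sl2 \<Rightarrow> 'v \<Rightarrow> 'v) \<Rightarrow> affine_sl2 \<Rightarrow> ('i \<Rightarrow>\<^sub>0 'v) \<Rightarrow> ('i \<Rightarrow>\<^sub>0 'v::zero)" where
  "dsum_action \<rho> x p = Poly_Mapping.mapp (\<lambda>i. \<rho> i x) p"


section \<open>The Clifford algebra module \<open>F\<close>\<close>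

definition half_odd :: "rat set" where
  "half_odd = {r. r - 1/2 \<in> \<int>}"

text \<open>\<open>\<Psi>\<^sub>p r\<close> and \<open>\<Psi>\<^sub>m r\<close> are the operators \<open>\<Psi>\<^sup>+(r)\<close> and \<open>\<Psi>\<^sup>-(r)\<close>; only the values for
  \<open>r \<in> half_odd\<close> matter.\<close>

locale clifford_module = vector_space scale
  for scale :: "complex \<Rightarrow> 'f::ab_group_add \<Rightarrow> 'f" +
  fixes \<Psi>\<^sub>p \<Psi>\<^sub>m :: "rat \<Rightarrow> 'f \<Rightarrow> 'f"
  assumes linear_p: "r \<in> half_odd \<Longrightarrow> Vector_Spaces.linear scale scale (\<Psi>\<^sub>p r)"
    and linear_m: "r \<in> half_odd \<Longrightarrow> Vector_Spaces.linear scale scale (\<Psi>\<^sub>m r)"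
    and anticommute_pm: "r \<in> half_odd \<Longrightarrow> s \<in> half_odd \<Longrightarrow>
      \<Psi>\<^sub>p r (\<Psi>\<^sub>m s v) + \<Psi>\<^sub>m s (\<Psi>\<^sub>p r v) = (if r + s = 0 then v else 0)"
    and anticommute_pp: "r \<in> half_odd \<Longrightarrow> s \<in> half_odd \<Longrightarrow>
      \<Psi>\<^sub>p r (\<Psi>\<^sub>p s v) + \<Psi>\<^sub>p s (\<Psi>\<^sub>p r v) = 0"
    and anticommute_mm: "r \<in> half_odd \<Longrightarrow> s \<in> half_odd \<Longrightarrow>
      \<Psi>\<^sub>m r (\<Psi>\<^sub>m s v) + \<Psi>\<^sub>m s (\<Psi>\<^sub>m r v) = 0"
begin

definition clifford_submodule :: "'f set \<Rightarrow> bool" where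
  "clifford_submodule U \<longleftrightarrow> subspace U \<and>
     (\<forall>r\<in>half_odd. \<forall>v\<in>U. \<Psi>\<^sub>p r v \<in> U \<and> \<Psi>\<^sub>m r v \<in> U)"

end

locale fermionic_fock_space = clifford_module scale \<Psi>\<^sub>p \<Psi>\<^sub>m
  for scale :: "complex \<Rightarrow> 'f::ab_group_add \<Rightarrow> 'f" and \<Psi>\<^sub>p \<Psi>\<^sub>m :: "rat \<Rightarrow> 'f \<Rightarrow> 'f" +
  fixes vac :: 'f
  assumes nontrivial: "(UNIV :: 'f set) \<noteq> {0}"
    and irreducible: "clifford_submodule U \<Longrightarrow> U = {0} \<or> U = UNIV"
    and generated: "clifford_submodule U \<Longrightarrow> vac \<in> U \<Longrightarrow> U = UNIV"
    and annihilate_p: "r \<in> half_odd \<Longrightarrow> r > 0 \<Longrightarrow> \<Psi>\<^sub>p r vac = 0"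
    and annihilate_m: "r \<in> half_odd \<Longrightarrow> r > 0 \<Longrightarrow> \<Psi>\<^sub>m r vac = 0"

locale charged_fock_space = fermionic_fock_space scale \<Psi>\<^sub>p \<Psi>\<^sub>m vac
  for scale :: "complex \<Rightarrow> 'f::ab_group_add \<Rightarrow> 'f" and \<Psi>\<^sub>p \<Psi>\<^sub>m :: "rat \<Rightarrow> 'f \<Rightarrow> 'f" and vac :: 'f +
  fixes J :: "'f \<Rightarrow> 'f"
  assumes charge_linear: "Vector_Spaces.linear scale scale J"
    and charge_vac: "J vac = 0"
    and charge_p: "r \<in> half_odd \<Longrightarrow> J (\<Psi>\<^sub>p r v) - \<Psi>\<^sub>p r (J v) = \<Psi>\<^sub>p r v"
    and charge_m: "r \<in> half_odd \<Longrightarrow> J (\<Psi>\<^sub>m r v) - \<Psi>\<^sub>m r (J v) = - \<Psi>\<^sub>m r v"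


section \<open>The lattice vertex superalgebra \<open>F\<^sub>-\<^sub>1\<close>\<close>

text \<open>\<open>F\<^sub>-\<^sub>1 = \<complex>[\<beta>(-1), \<beta>(-2), \<dots>] \<otimes> \<complex>[\<int>\<beta>]\<close>. The index \<open>(r, a)\<close> stands for the basis vector
  \<open>\<beta>(-1)\<^bsup>a 0\<^esup> \<beta>(-2)\<^bsup>a 1\<^esup> \<dots> e\<^bsup>r\<beta>\<^esup>\<close>; note the shift: \<open>a i\<close> is the exponent of \<open>\<beta>(-(i+1))\<close>.\<close>

type_synonym lattice_basis = "int \<times> (nat \<Rightarrow>\<^sub>0 nat)"
type_synonym lattice_space = "lattice_basis \<Rightarrow>\<^sub>0 complex"

text \<open>The Heisenberg operators, \<open>[\<beta>(m), \<beta>(n)] = m \<langle>\<beta>,\<beta>\<rangle> \<delta>\<^bsub>m+n,0\<^esub>\<close> and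
  \<open>\<beta>(0) e\<^bsup>r\<beta>\<^esup> = \<langle>\<beta>,r\<beta>\<rangle> e\<^bsup>r\<beta>\<^esup>\<close> with \<open>\<langle>\<beta>,\<beta>\<rangle> = -1\<close>: for \<open>n > 0\<close>, \<open>\<beta>(-n)\<close> is multiplication by a
  variable and \<open>\<beta>(n)\<close> is \<open>-n\<close> times the derivative with respect to it.\<close>

definition beta_basis :: "int \<Rightarrow> lattice_basis \<Rightarrow> lattice_space" where
  "beta_basis n = (\<lambda>(r, a).
     if n < 0 then bvec (r, a + Poly_Mapping.single (nat (- n) - 1) 1)
     else if n = 0 then Poly_Mapping.single (r, a) (- of_int r)
     else Poly_Mapping.single (r, a - Poly_Mapping.single (nat n - 1) 1)
            (- of_int n * of_nat (Poly_Mapping.lookup a (nat n - 1))))"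

definition beta :: "int \<Rightarrow> lattice_space \<Rightarrow> lattice_space" where
  "beta n = lin_ext cscale (beta_basis n)"

text \<open>The coefficient of \<open>z\<^sup>k\<close> in \<open>exp (\<Sum>i\<ge>1. A i z\<^sup>i)\<close>, applied to \<open>v\<close>: the \<open>j\<close>-th power
  of the exponent contributes the compositions of \<open>k\<close> into \<open>j\<close> positive parts.\<close>

definition exp_coeff ::
  "(nat \<Rightarrow> lattice_space \<Rightarrow> lattice_space) \<Rightarrow> nat \<Rightarrow> lattice_space \<Rightarrow> lattice_space" where
  "exp_coeff A k v =
     (\<Sum>ns\<in>{ns. sum_list ns = k \<and> 0 \<notin> set ns}. cscale (1 / fact (length ns)) (foldr A ns v))"

text \<open>The operator \<open>(e\<^bsup>m\<beta>\<^esup>)\<^sub>n\<close>, i.e. the coefficient of \<open>z\<^bsup>-n-1\<^esup>\<close> in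
  \<open>Y(e\<^bsup>m\<beta>\<^esup>, z) = exp (\<Sum>i\<ge>1. m\<beta>(-i)/i z\<^sup>i) exp (-\<Sum>i\<ge>1. m\<beta>(i)/i z\<^bsup>-i\<^esup>) e\<^bsub>m\<beta>\<^esub> z\<^bsup>m\<beta>(0)\<^esup>\<close>,
  where \<open>e\<^bsub>m\<beta>\<^esub>\<close> is multiplication by \<open>e\<^bsup>m\<beta>\<^esup>\<close> (trivial cocycle) and \<open>z\<^bsup>m\<beta>(0)\<^esup>\<close> acts on
  \<open>(r, a)\<close> as \<open>z\<^bsup>-mr\<^esup>\<close>. Only finitely many \<open>k\<close> contribute to the sum.\<close>

definition vertex_op_basis :: "int \<Rightarrow> int \<Rightarrow> lattice_basis \<Rightarrow> lattice_space" where
  "vertex_op_basis m n = (\<lambda>(r, a).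
     Sum_any (\<lambda>k :: nat.
       let j = int k + m * r - n - 1 in
       if j < 0 then 0
       else exp_coeff (\<lambda>i v. cscale (of_int m / of_nat i) (beta (- int i) v)) (nat j)
              (exp_coeff (\<lambda>i v. cscale (- of_int m / of_nat i) (beta (int i) v)) k
                 (bvec (r + m, a)))))"

definition vertex_op :: "int \<Rightarrow> int \<Rightarrow> lattice_space \<Rightarrow> lattice_space" where
  "vertex_op m n = lin_ext cscale (vertex_op_basis m n)"


section \<open>The tensor product \<open>F \<otimes> F\<^sub>-\<^sub>1\<close> and its operators\<close>

text \<open>Since \<open>F\<^sub>-\<^sub>1\<close> has the basis \<open>lattice_basis\<close>, \<open>F \<otimes> F\<^sub>-\<^sub>1\<close> is the space of finitely supported
  functions from \<open>lattice_basis\<close> to \<open>F\<close>, with scalar multiplication \<open>pscale scale\<close>.\<close>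

type_synonym 'f tensor_space = "lattice_basis \<Rightarrow>\<^sub>0 'f"

definition tensor ::
  "(complex \<Rightarrow> 'f::ab_group_add \<Rightarrow> 'f) \<Rightarrow> 'f \<Rightarrow> lattice_space \<Rightarrow> 'f tensor_space" where
  "tensor scale x y = Poly_Mapping.map (\<lambda>c. scale c x) y"

definition tensor_op ::
  "(complex \<Rightarrow> 'f::ab_group_add \<Rightarrow> 'f) \<Rightarrow> ('f \<Rightarrow> 'f) \<Rightarrow> (lattice_space \<Rightarrow> lattice_space)
   \<Rightarrow> 'f tensor_space \<Rightarrow> 'f tensor_space" where
  "tensor_op scale A B p =
     (\<Sum>b\<in>Poly_Mapping.keys p. tensor scale (A (Poly_Mapping.lookup p b)) (B (bvec b)))"

text \<open>The summands of \<open>e(m)\<close> (for \<open>\<epsilon> = 1\<close>, \<open>\<Psi> = \<Psi>\<^sup>+\<close>, \<open>a = \<lambda>\<close>) and of \<open>f(m)\<close>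
  (for \<open>\<epsilon> = -1\<close>, \<open>\<Psi> = \<Psi>\<^sup>-\<close>, \<open>a = \<mu>\<close>).\<close>

definition current_term ::
  "(complex \<Rightarrow> 'f::ab_group_add \<Rightarrow> 'f) \<Rightarrow> (rat \<Rightarrow> 'f \<Rightarrow> 'f) \<Rightarrow> int \<Rightarrow> complex \<Rightarrow> int
   \<Rightarrow> 'f tensor_space \<Rightarrow> int \<Rightarrow> 'f tensor_space" where
  "current_term scale \<Psi> \<epsilon> a m v i =
     pscale scale (a - of_int i)
       (tensor_op scale (\<Psi> (of_int i - 1/2)) (vertex_op \<epsilon> (m - i - 1)) v)"

text \<open>\<^const>\<open>Sum_any\<close> is \<open>0\<close> unless only finitely many summands are nonzero, so this is the
  intended sum only where that holds.\<close>

definition current ::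
  "(complex \<Rightarrow> 'f::ab_group_add \<Rightarrow> 'f) \<Rightarrow> (rat \<Rightarrow> 'f \<Rightarrow> 'f) \<Rightarrow> int \<Rightarrow> complex \<Rightarrow> int
   \<Rightarrow> 'f tensor_space \<Rightarrow> 'f tensor_space" where
  "current scale \<Psi> \<epsilon> a m v = Sum_any (current_term scale \<Psi> \<epsilon> a m v)"

definition h_current ::
  "(complex \<Rightarrow> 'f::ab_group_add \<Rightarrow> 'f) \<Rightarrow> complex \<Rightarrow> complex \<Rightarrow> int
   \<Rightarrow> 'f tensor_space \<Rightarrow> 'f tensor_space" where
  "h_current scale lam mu m v =
     pscale scale (- 2) (tensor_op scale id (beta m) v)
     + (if m = 0 then pscale scale (lam - mu) v else 0)"

text \<open>The action \<open>\<rho>\<close> is a module structure on \<open>F \<otimes> F\<^sub>-\<^sub>1\<close> with the prescribed generators.\<close>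

definition is_realization ::
  "(complex \<Rightarrow> 'f::ab_group_add \<Rightarrow> 'f) \<Rightarrow> (rat \<Rightarrow> 'f \<Rightarrow> 'f) \<Rightarrow> (rat \<Rightarrow> 'f \<Rightarrow> 'f)
   \<Rightarrow> complex \<Rightarrow> complex \<Rightarrow> (affine_sl2 \<Rightarrow> 'f tensor_space \<Rightarrow> 'f tensor_space) \<Rightarrow> bool" where
  "is_realization scale \<Psi>\<^sub>p \<Psi>\<^sub>m lam mu \<rho> \<longleftrightarrow>
     affine_module (pscale scale) UNIV \<rho> \<and>
     (\<forall>m. \<rho> (bvec (Loop sl2_e m)) = current scale \<Psi>\<^sub>p 1 lam m) \<and>
     (\<forall>m. \<rho> (bvec (Loop sl2_f m)) = current scale \<Psi>\<^sub>m (- 1) mu m) \<and>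
     (\<forall>m. \<rho> (bvec (Loop sl2_h m)) = h_current scale lam mu m) \<and>
     \<rho> (bvec Central) = pscale scale (- 2)"

text \<open>The kernel of \<open>H(0) = J\<^sup>f(0) \<otimes> 1 + 1 \<otimes> \<beta>(0)\<close>.\<close>

definition H0_kernel ::
  "(complex \<Rightarrow> 'f::ab_group_add \<Rightarrow> 'f) \<Rightarrow> ('f \<Rightarrow> 'f) \<Rightarrow> 'f tensor_space set" where
  "H0_kernel scale J = {v. tensor_op scale J id v + tensor_op scale id (beta 0) v = 0}"


section \<open>Consistency of the encodings\<close>

lemma lookup_cscale [simp]: "Poly_Mapping.lookup (cscale c p) b = c * Poly_Mapping.lookup p b"
  by (auto simp: pscale_def map.rep_eq when_def)

lemma vector_space_cscale: "vector_space (cscale :: complex \<Rightarrow> ('b \<Rightarrow>\<^sub>0 complex) \<Rightarrow> _)"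
  by unfold_locales (auto intro!: poly_mapping_eqI simp: lookup_add algebra_simps)

context
  fixes scale :: "complex \<Rightarrow> 'v::ab_group_add \<Rightarrow> 'v"
  assumes vs: "vector_space scale"
begin

interpretation vector_space scale by (fact vs)

lemma lin_ext_superset:
  assumes "finite S" "Poly_Mapping.keys p \<subseteq> S"
  shows "lin_ext scale g p = (\<Sum>b\<in>S. scale (Poly_Mapping.lookup p b) (g b))"
  unfolding lin_ext_def using assms
  by (intro sum.mono_neutral_left) (auto simp: in_keys_iff)

lemma lin_ext_single [simp]: "lin_ext scale g (Poly_Mapping.single b c) = scale c (g b)"
  by (simp add: lin_ext_def)

lemma linear_lin_ext: "Vector_Spaces.linear cscale scale (lin_ext scale g)"
proof -
  interpret cs: vector_space "cscale :: complex \<Rightarrow> ('b \<Rightarrow>\<^sub>0 complex) \<Rightarrow> _"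
    by (rule vector_space_cscale)
  have "lin_ext scale g (p + q) = lin_ext scale g p + lin_ext scale g q" for p q
  proof -
    let ?S = "Poly_Mapping.keys p \<union> Poly_Mapping.keys q"
    show ?thesis
      using keys_add[of p q]
      by (simp add: lin_ext_superset[where S = ?S] lookup_add scale_left_distrib sum.distrib)
  qed
  moreover have "lin_ext scale g (cscale c p) = scale c (lin_ext scale g p)" for c p
  proof -
    have "Poly_Mapping.keys (cscale c p) \<subseteq> Poly_Mapping.keys p"
      by (auto simp: in_keys_iff)
    thus ?thesis
      by (simp add: lin_ext_superset[where S = "Poly_Mapping.keys p"] scale_sum_right)
  qed
  ultimately show ?thesis
    by unfold_locales auto
qed

end

lemma tensor_op_tensor:
  assumes "Vector_Spaces.linear scale scale A" "Vector_Spaces.linear cscale cscale B"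
  shows "tensor_op scale A B (tensor scale x y) = tensor scale (A x) (B y)"
proof -
  interpret A: Vector_Spaces.linear scale scale A by fact
  interpret B: Vector_Spaces.linear cscale cscale B by fact
  have lt [simp]: "Poly_Mapping.lookup (tensor scale u w) b = scale (Poly_Mapping.lookup w b) u" for u w b
    by (auto simp: tensor_def map.rep_eq when_def)
  have y: "y = (\<Sum>b\<in>Poly_Mapping.keys y. cscale (Poly_Mapping.lookup y b) (bvec b))"
    by (rule poly_mapping_eqI)
       (auto simp: lookup_sum lookup_single when_def in_keys_iff if_distrib sum.delta cong: if_cong)
  have sub: "Poly_Mapping.keys (tensor scale x y) \<subseteq> Poly_Mapping.keys y"
    by (auto simp: in_keys_iff)
  have "tensor_op scale A B (tensor scale x y) =
        (\<Sum>b\<in>Poly_Mapping.keys y. tensor scale (A (scale (Poly_Mapping.lookup y b) x)) (B (bvec b)))"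
    unfolding tensor_op_def lt using sub
    by (intro sum.mono_neutral_left) (auto intro!: poly_mapping_eqI simp: in_keys_iff)
  also have "\<dots> = tensor scale (A x) (B y)"
  proof (rule poly_mapping_eqI)
    fix b
    have "Poly_Mapping.lookup (B y) b = (\<Sum>c\<in>Poly_Mapping.keys y.
            Poly_Mapping.lookup y c * Poly_Mapping.lookup (B (bvec c)) b)"
      by (subst (1) y) (simp add: B.sum B.scale lookup_sum)
    thus "Poly_Mapping.lookup (\<Sum>b\<in>Poly_Mapping.keys y.
              tensor scale (A (scale (Poly_Mapping.lookup y b) x)) (B (bvec b))) b
          = Poly_Mapping.lookup (tensor scale (A x) (B y)) b"
      by (simp add: lookup_sum A.scale A.vs1.scale_sum_left mult.commute)
  qed
  finally show ?thesis .
qed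

context
begin

interpretation cs: vector_space "cscale :: complex \<Rightarrow> ('b \<Rightarrow>\<^sub>0 complex) \<Rightarrow> _"
  by (rule vector_space_cscale)

lemma linear_beta: "Vector_Spaces.linear cscale cscale (beta n)"
  unfolding beta_def by (rule linear_lin_ext[OF vector_space_cscale])

lemma beta_single: "beta n (Poly_Mapping.single b c) = cscale c (beta_basis n b)"
  by (simp add: beta_def lin_ext_single[OF vector_space_cscale])

lemma cscale_single: "cscale c (Poly_Mapping.single b d) = Poly_Mapping.single b (c * d)"
  by (auto intro!: poly_mapping_eqI simp: lookup_single when_def)

lemma linear_eq_on_bvec:
  fixes A B :: "('b \<Rightarrow>\<^sub>0 complex) \<Rightarrow> 'v::ab_group_add"
  assumes "Vector_Spaces.linear cscale scale A" "Vector_Spaces.linear cscale scale B"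
    and "\<And>b. A (bvec b) = B (bvec b)"
  shows "A = B"
proof
  fix p :: "'b \<Rightarrow>\<^sub>0 complex"
  interpret A: Vector_Spaces.linear cscale scale A by fact
  interpret B: Vector_Spaces.linear cscale scale B by fact
  have p: "p = (\<Sum>b\<in>Poly_Mapping.keys p. cscale (Poly_Mapping.lookup p b) (bvec b))"
    by (rule poly_mapping_eqI)
       (auto simp: lookup_sum lookup_single when_def in_keys_iff if_distrib sum.delta cong: if_cong)
  show "A p = B p"
    by (subst (1 2) p) (simp add: A.sum A.scale B.sum B.scale assms(3))
qed

lemma int_sign_cases:
  obtains "m = 0" | i where "m = int (Suc i)" | i where "m = - int (Suc i)"
  by (metis int_cases3 gr0_implies_Suc)

lemma beta_pos: "beta (int (Suc i)) (Poly_Mapping.single (r, a) c) =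
    Poly_Mapping.single (r, a - Poly_Mapping.single i 1) (- c * (of_nat (Suc i) * of_nat (Poly_Mapping.lookup a i)))"
  by (simp add: beta_single beta_basis_def cscale_single algebra_simps nat_add_distrib)

lemma beta_neg: "beta (- int (Suc i)) (Poly_Mapping.single (r, a) c) =
    Poly_Mapping.single (r, a + Poly_Mapping.single i 1) c"
  by (simp add: beta_single beta_basis_def cscale_single nat_add_distrib)

lemma beta_zero: "beta 0 (Poly_Mapping.single (r, a) c) = Poly_Mapping.single (r, a) (- c * of_int r)"
  by (simp add: beta_single beta_basis_def cscale_single)

lemma beta_0_vec: "beta n 0 = 0"
  by (simp add: beta_def lin_ext_def)

lemma beta_pos_neg:
  "beta (int (Suc i)) (beta (- int (Suc j)) (bvec (r, a))) - beta (- int (Suc j)) (beta (int (Suc i)) (bvec (r, a)))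
   = cscale (if int (Suc i) + - int (Suc j) = 0 then - of_int (int (Suc i)) else 0) (bvec (r, a))"
proof (cases "Poly_Mapping.lookup a i = 0")
  case True
  thus ?thesis
    by (auto simp: beta_pos beta_neg lookup_add lookup_single when_def cscale_single beta_0_vec simp del: of_nat_Suc)
       (simp add: algebra_simps)
next
  case False
  hence "a + Poly_Mapping.single j 1 - Poly_Mapping.single i 1 = a - Poly_Mapping.single i 1 + Poly_Mapping.single j (1::nat)"
    by (auto intro!: poly_mapping_eqI simp: lookup_add lookup_minus lookup_single when_def)
  thus ?thesis
    by (auto simp: beta_pos beta_neg lookup_add lookup_single when_def cscale_single single_diff[symmetric] simp del: of_nat_Suc)
       (simp add: algebra_simps)
qed

lemma beta_commutator:
  "beta m (beta n v) - beta n (beta m v) = cscale (if m + n = 0 then - of_int m else 0) v"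
proof -
  interpret bm: Vector_Spaces.linear cscale cscale "beta m" by (rule linear_beta)
  interpret bn: Vector_Spaces.linear cscale cscale "beta n" by (rule linear_beta)
  have "(\<lambda>v. beta m (beta n v) - beta n (beta m v)) =
        (\<lambda>v. cscale (if m + n = 0 then - of_int m else 0) v)"
  proof (rule linear_eq_on_bvec)
    show "Vector_Spaces.linear cscale cscale (\<lambda>v. beta m (beta n v) - beta n (beta m v))"
      by unfold_locales (simp_all add: bm.add bn.add bm.scale bn.scale cs.scale_right_diff_distrib)
    show "Vector_Spaces.linear cscale cscale (cscale (if m + n = 0 then - of_int m else 0))"
      by unfold_locales (simp_all add: cs.scale_right_distrib mult.commute)
    fix b :: lattice_basis
    obtain r a where b: "b = (r, a)" by force
    show "beta m (beta n (bvec b)) - beta n (beta m (bvec b)) =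
          cscale (if m + n = 0 then - of_int m else 0) (bvec b)"
      unfolding b
    proof (cases rule: int_sign_cases[of m]; cases rule: int_sign_cases[of n])
      fix i j assume mn: "m = int (Suc i)" "n = int (Suc j)"
      show "beta m (beta n (bvec (r, a))) - beta n (beta m (bvec (r, a))) =
          cscale (if m + n = 0 then - of_int m else 0) (bvec (r, a))"
      proof (cases "i = j")
        case False
        hence "Poly_Mapping.lookup (a - Poly_Mapping.single i 1) j = Poly_Mapping.lookup a j"
              "Poly_Mapping.lookup (a - Poly_Mapping.single j 1) i = Poly_Mapping.lookup a i"
          by (simp_all add: lookup_minus lookup_single)
        moreover have "a - Poly_Mapping.single i 1 - Poly_Mapping.single j 1
            = a - Poly_Mapping.single j 1 - Poly_Mapping.single i (1::nat)"
          by (rule diff_right_commute)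
        moreover have "m + n \<noteq> 0" using mn by simp
        ultimately show ?thesis
          unfolding mn beta_pos by (simp only: mult.commute mult.left_commute mult_minus_left mult_minus_right
             minus_minus if_False cs.scale_zero_left diff_self)
      qed (simp add: mn)
    next
      fix i j assume mn: "m = int (Suc i)" "n = - int (Suc j)"
      show "beta m (beta n (bvec (r, a))) - beta n (beta m (bvec (r, a))) =
          cscale (if m + n = 0 then - of_int m else 0) (bvec (r, a))"
        unfolding mn by (rule beta_pos_neg)
    next
      fix i j assume mn: "m = - int (Suc j)" "n = int (Suc i)"
      have "beta n (beta m (bvec (r, a))) - beta m (beta n (bvec (r, a))) =
          cscale (if n + m = 0 then - of_int n else 0) (bvec (r, a))"
        unfolding mn by (rule beta_pos_neg)
      hence "- (beta n (beta m (bvec (r, a))) - beta m (beta n (bvec (r, a)))) =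
          - cscale (if n + m = 0 then - of_int n else 0) (bvec (r, a))" by (rule arg_cong)
      also have "- cscale (if n + m = 0 then - of_int n else 0) (bvec (r, a)) =
          cscale (if m + n = 0 then - of_int m else 0) (bvec (r, a))"
        by (auto simp: mn cscale_single single_uminus[symmetric])
      finally show "beta m (beta n (bvec (r, a))) - beta n (beta m (bvec (r, a))) =
          cscale (if m + n = 0 then - of_int m else 0) (bvec (r, a))" by simp
    next
      fix i j assume mn: "m = - int (Suc i)" "n = - int (Suc j)"
      have "a + Poly_Mapping.single j 1 + Poly_Mapping.single i 1
          = a + Poly_Mapping.single i 1 + Poly_Mapping.single j (1::nat)"
        by (simp only: ac_simps)
      moreover have "m + n \<noteq> 0" using mn by simp
      ultimately show "beta m (beta n (bvec (r, a))) - beta n (beta m (bvec (r, a))) =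
          cscale (if m + n = 0 then - of_int m else 0) (bvec (r, a))"
        unfolding mn beta_neg by (simp only: if_False cs.scale_zero_left diff_self)
    qed (simp_all add: beta_zero beta_pos beta_neg mult_ac del: of_nat_Suc)
  qed
  thus ?thesis by (rule fun_cong)
qed

lemma exp_coeff_vacuum:
  assumes "\<And>i. i > 0 \<Longrightarrow> A i v = 0" "\<And>i. A i 0 = 0"
  shows "exp_coeff A k v = (if k = 0 then v else 0)"
proof -
  have f: "foldr A ns v = 0" if "ns \<noteq> []" "0 \<notin> set ns" for ns
    using that
  proof (induction ns)
    case (Cons i ns) thus ?case using assms by (cases "ns = []") auto
  qed simp
  show ?thesis
  proof (cases "k = 0")
    case True
    have "{ns::nat list. sum_list ns = 0 \<and> 0 \<notin> set ns} = {[]}"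
      by (auto simp: neq_Nil_conv) (metis list.set_intros(1) neq_Nil_conv)
    thus ?thesis by (simp add: exp_coeff_def True)
  next
    case False
    hence "ns \<noteq> []" if "sum_list ns = k" for ns using that by auto
    thus ?thesis using f False unfolding exp_coeff_def
      by (intro trans[OF sum.neutral]) auto
  qed
qed

lemma exp_coeff_0: "exp_coeff A 0 v = v"
proof -
  have "{ns::nat list. sum_list ns = 0 \<and> 0 \<notin> set ns} = {[]}"
    by (auto simp: neq_Nil_conv) (metis list.set_intros(1) neq_Nil_conv)
  thus ?thesis by (simp add: exp_coeff_def)
qed

text \<open>\<open>Y(e\<^bsup>m\<beta>\<^esup>, z) e\<^bsup>r\<beta>\<^esup> = z\<^bsup>-mr\<^esup> (e\<^bsup>(m+r)\<beta>\<^esup> + O(z))\<close>\<close>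

lemma vertex_op_leading:
  "vertex_op m n (bvec (r, 0)) = (if - n - 1 < - m * r then 0
     else exp_coeff (\<lambda>i v. cscale (of_int m / of_nat i) (beta (- int i) v))
            (nat (m * r - n - 1)) (bvec (m + r, 0)))"
  "- n - 1 = - m * r \<Longrightarrow> vertex_op m n (bvec (r, 0)) = bvec (m + r, 0)"
proof -
  have 1: "exp_coeff (\<lambda>i v. cscale (- of_int m / of_nat i) (beta (int i) v)) k (bvec (r + m, 0))
         = (if k = 0 then bvec (r + m, 0) else 0)" for k
    using linear_beta[THEN module_hom.zero[OF Vector_Spaces.linear.axioms(3)]]
    by (intro exp_coeff_vacuum) (auto simp: beta_single beta_basis_def)
  have z: "exp_coeff (\<lambda>i v. cscale (of_int m / of_nat i) (beta (- int i) v)) k 0 = 0" for k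
  proof -
    have "foldr (\<lambda>i v. cscale (of_int m / of_nat i) (beta (- int i) v)) ns 0 = 0" for ns
      using linear_beta[THEN module_hom.zero[OF Vector_Spaces.linear.axioms(3)]]
      by (induction ns) auto
    thus ?thesis by (simp add: exp_coeff_def)
  qed
  show A: "vertex_op m n (bvec (r, 0)) = (if - n - 1 < - m * r then 0
     else exp_coeff (\<lambda>i v. cscale (of_int m / of_nat i) (beta (- int i) v))
            (nat (m * r - n - 1)) (bvec (m + r, 0)))"
    unfolding vertex_op_def lin_ext_single[OF vector_space_cscale] vertex_op_basis_def prod.case cs.scale_one 1
    by (subst Sum_any.expand_superset[where A = "{0}"])
       (auto simp: z add.commute Let_def split: if_splits)
  show "vertex_op m n (bvec (r, 0)) = bvec (m + r, 0)" if "- n - 1 = - m * r"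
    using that by (simp add: A exp_coeff_0)
qed

section \<open>Existence of the Clifford module \<open>F\<close>\<close>

text \<open>The assumptions of \<^locale>\<open>charged_fock_space\<close> are satisfied by the exterior algebra
  with one generator \<open>k\<close> for each integer: \<open>\<Psi>\<^sup>+(k - 1/2)\<close> for \<open>k \<le> 0\<close> and \<open>\<Psi>\<^sup>-(1/2 - k)\<close> for
  \<open>k > 0\<close>.\<close>

definition fsgn :: "int \<Rightarrow> int fset \<Rightarrow> complex" where
  "fsgn k D = (- 1) ^ card {d \<in> fset D. d < k}"

lemma fsgn_finsert: "l |\<notin>| D \<Longrightarrow> fsgn k (finsert l D) = (if l < k then - fsgn k D else fsgn k D)"
proof -
  assume l: "l |\<notin>| D"
  have "{d \<in> fset (finsert l D). d < k} =
      (if l < k then insert l {d \<in> fset D. d < k} else {d \<in> fset D. d < k})" by auto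
  thus ?thesis using l by (auto simp: fsgn_def)
qed

lemma fsgn_fminus: "l |\<in>| D \<Longrightarrow> fsgn k (D |-| {|l|}) = (if l < k then - fsgn k D else fsgn k D)"
  using fsgn_finsert[of l "D |-| {|l|}" k] by (auto simp: finsert_absorb split: if_splits)

lemma fsgn_square [simp]: "fsgn k D * fsgn k D = 1"
  by (simp add: fsgn_def power_mult_distrib[symmetric])

lemma fsgn_nonzero [simp]: "fsgn k D \<noteq> 0"
  by (simp add: fsgn_def)

type_synonym fock = "int fset \<Rightarrow>\<^sub>0 complex"

definition cre :: "int \<Rightarrow> fock \<Rightarrow> fock" where
  "cre k = lin_ext cscale (\<lambda>D. if k |\<in>| D then 0 else Poly_Mapping.single (finsert k D) (fsgn k D))"
definition ann :: "int \<Rightarrow> fock \<Rightarrow> fock" where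
  "ann k = lin_ext cscale (\<lambda>D. if k |\<in>| D then Poly_Mapping.single (D |-| {|k|}) (fsgn k D) else 0)"

lemma linear_cre: "Vector_Spaces.linear cscale cscale (cre n)"
  unfolding cre_def by (rule linear_lin_ext[OF vector_space_cscale])
lemma linear_ann: "Vector_Spaces.linear cscale cscale (ann n)"
  unfolding ann_def by (rule linear_lin_ext[OF vector_space_cscale])

lemma cre_single: "cre k (Poly_Mapping.single D c) =
    (if k |\<in>| D then 0 else Poly_Mapping.single (finsert k D) (c * fsgn k D))"
  by (simp add: cre_def lin_ext_single[OF vector_space_cscale] cscale_single)
lemma ann_single: "ann k (Poly_Mapping.single D c) =
    (if k |\<in>| D then Poly_Mapping.single (D |-| {|k|}) (c * fsgn k D) else 0)"
  by (simp add: ann_def lin_ext_single[OF vector_space_cscale] cscale_single)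

lemma anticomm_from_bvec:
  assumes "Vector_Spaces.linear cscale cscale A" "Vector_Spaces.linear cscale cscale B"
    and "\<And>b. A (B (bvec b)) + B (A (bvec b)) = cscale c (bvec b)"
  shows "A (B v) + B (A v) = cscale c (v :: 'b \<Rightarrow>\<^sub>0 complex)"
proof -
  interpret A: Vector_Spaces.linear cscale cscale A by fact
  interpret B: Vector_Spaces.linear cscale cscale B by fact
  have "(\<lambda>v. A (B v) + B (A v)) = (\<lambda>v. cscale c v)"
  proof (rule linear_eq_on_bvec)
    show "Vector_Spaces.linear cscale cscale (\<lambda>v. A (B v) + B (A v))"
      by unfold_locales (simp_all add: A.add B.add A.scale B.scale cs.scale_right_distrib)
    show "Vector_Spaces.linear cscale cscale (cscale c :: ('b \<Rightarrow>\<^sub>0 complex) \<Rightarrow> _)"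
      by unfold_locales (simp_all add: cs.scale_right_distrib mult.commute)
  qed (fact assms)
  thus ?thesis by (rule fun_cong)
qed

lemma cre_cre: "cre k (cre l v) + cre l (cre k v) = 0"
proof -
  have "cre k (cre l v) + cre l (cre k v) = cscale 0 v"
    by (rule anticomm_from_bvec[OF linear_cre linear_cre])
       (auto simp: cre_single fsgn_finsert finsert_commute single_add[symmetric] linear_cre[THEN module_hom.zero[OF Vector_Spaces.linear.axioms(3)]])
  thus ?thesis by simp
qed

lemma ann_ann: "ann k (ann l v) + ann l (ann k v) = 0"
proof -
  have e: "D |-| {|k|} |-| {|l|} = D |-| {|l|} |-| {|k|}" for D :: "int fset"
    by auto
  have "ann k (ann l v) + ann l (ann k v) = cscale 0 v"
    by (rule anticomm_from_bvec[OF linear_ann linear_ann])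
       (auto simp: ann_single fsgn_fminus e single_add[symmetric] linear_ann[THEN module_hom.zero[OF Vector_Spaces.linear.axioms(3)]])
  thus ?thesis by simp
qed

lemma cre_ann: "cre k (ann l v) + ann l (cre k v) = (if k = l then v else 0)"
proof -
  have e: "finsert k (D |-| {|l|}) = finsert k D |-| {|l|}" if "k \<noteq> l" for D :: "int fset"
    using that by auto
  have "cre k (ann l v) + ann l (cre k v) = cscale (if k = l then 1 else 0) v"
    by (rule anticomm_from_bvec[OF linear_cre linear_ann])
       (auto simp: cre_single ann_single fsgn_finsert fsgn_fminus e single_add[symmetric] finsert_absorb
            linear_ann[THEN module_hom.zero[OF Vector_Spaces.linear.axioms(3)]] 
            linear_cre[THEN module_hom.zero[OF Vector_Spaces.linear.axioms(3)]])
  thus ?thesis by (auto split: if_splits)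
qed


definition mode :: "rat \<Rightarrow> int" where "mode r = \<lfloor>r + 1/2\<rfloor>"
definition psip :: "rat \<Rightarrow> fock \<Rightarrow> fock" where
  "psip r = (if mode r \<le> 0 then cre (mode r) else ann (mode r))"
definition psim :: "rat \<Rightarrow> fock \<Rightarrow> fock" where
  "psim r = (if mode r \<le> 0 then cre (1 - mode r) else ann (1 - mode r))"
definition charge :: "fock \<Rightarrow> fock" where
  "charge = lin_ext cscale (\<lambda>D. Poly_Mapping.single D (\<Sum>d\<in>fset D. if d \<le> 0 then 1 else - 1))"

lemma half_odd_cases:
  assumes "r \<in> half_odd"
  obtains i where "r = of_int i - 1/2" "mode r = i"
proof -
  from assms obtain j where "r - 1/2 = of_int j" unfolding half_odd_def by (auto elim: Ints_cases)
  hence "r = of_int (j + 1) - 1/2" by simp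
  moreover from this have "mode r = j + 1" by (simp add: mode_def)
  ultimately show ?thesis using that by blast
qed

lemma mode_shift: "mode (of_int i - 1/2) = i"
  by (simp add: mode_def)

lemma mode_shift': "mode (1/2 - of_int i) = 1 - i"
  using mode_shift[of "1 - i"] by simp

lemma half_odd_shift: "of_int i - 1/2 \<in> half_odd"
proof -
  have "(of_int i - 1/2 :: rat) - 1/2 = of_int (i - 1)" by simp
  thus ?thesis unfolding half_odd_def using Ints_of_int by (metis mem_Collect_eq)
qed

lemma clifford_module_fock: "clifford_module cscale psip psim"
proof unfold_locales
  fix r s :: rat and v :: fock
  assume "r \<in> half_odd" "s \<in> half_odd"
  then obtain i j where r: "r = of_int i - 1/2" "mode r = i" and s: "s = of_int j - 1/2" "mode s = j"
    by (metis half_odd_cases)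
  have "(r + s = 0) = (of_int (i + j) = (of_int 1 :: rat))"
    by (auto simp: r s)
  hence "(r + s = 0) = (i + j = 1)" by (simp only: of_int_eq_iff)
  thus "psip r (psim s v) + psim s (psip r v) = (if r + s = 0 then v else 0)"
    using cre_cre[of i "1-j" v] cre_ann[of i "1-j" v] cre_ann[of "1-j" i v] ann_ann[of i "1-j" v]
    by (auto simp: psip_def psim_def r s mode_shift add.commute split: if_splits)
  show "psip r (psip s v) + psip s (psip r v) = 0"
    using cre_cre[of i j v] cre_ann[of i j v] cre_ann[of j i v] ann_ann[of i j v]
    by (auto simp: psip_def r s mode_shift add.commute split: if_splits)
  show "psim r (psim s v) + psim s (psim r v) = 0"
    using cre_cre[of "1-i" "1-j" v] cre_ann[of "1-i" "1-j" v] cre_ann[of "1-j" "1-i" v] ann_ann[of "1-i" "1-j" v]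
    by (auto simp: psim_def r s mode_shift add.commute split: if_splits)
qed (use linear_cre linear_ann in \<open>auto simp: psip_def psim_def Vector_Spaces.linear_def module_hom_def module_hom_axioms_def\<close>)

interpretation fk: clifford_module cscale psip psim
  by (rule clifford_module_fock)

lemma submodule_cre_ann:
  assumes "fk.clifford_submodule U" "v \<in> U"
  shows "cre k v \<in> U" "ann k v \<in> U"
proof -
  have *: "psip (of_int i - 1/2) v \<in> U" "psim (of_int i - 1/2) v \<in> U" for i
    using assms half_odd_shift unfolding fk.clifford_submodule_def by blast+
  show "cre k v \<in> U" using *[of k] *[of "1 - k"]
    by (auto simp: psip_def psim_def mode_shift mode_shift' split: if_splits)
  show "ann k v \<in> U" using *[of k] *[of "1 - k"]
    by (auto simp: psip_def psim_def mode_shift mode_shift' split: if_splits)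
qed

lemma fock_generated:
  assumes U: "fk.clifford_submodule U" and "bvec {||} \<in> U"
  shows "U = UNIV"
proof -
  have sub: "cs.subspace U" using U by (simp add: fk.clifford_submodule_def)
  have b: "Poly_Mapping.single D c \<in> U" for D c
  proof (induction D arbitrary: c)
    case empty
    have "cscale c (bvec {||}) \<in> U" using sub assms(2) by (rule cs.subspace_scale)
    thus ?case by (simp add: cscale_single)
  next
    case (insert k D)
    have "cre k (Poly_Mapping.single D (c / fsgn k D)) \<in> U"
      using U insert.IH by (rule submodule_cre_ann)
    thus ?case using insert.hyps by (simp add: cre_single)
  qed
  have "p \<in> U" for p
  proof -
    have "p = (\<Sum>b\<in>Poly_Mapping.keys p. Poly_Mapping.single b (Poly_Mapping.lookup p b))"
      by (rule poly_mapping_eqI)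
         (auto simp: lookup_sum lookup_single when_def in_keys_iff if_distrib sum.delta cong: if_cong)
    also have "\<dots> \<in> U" using sub b by (intro cs.subspace_sum)
    finally show ?thesis .
  qed
  thus ?thesis by auto
qed

lemma lookup_ann: "Poly_Mapping.lookup (ann k v) D =
   (if k |\<in>| D then 0 else fsgn k D * Poly_Mapping.lookup v (finsert k D))"
proof -
  have e: "E = finsert k D" if "k |\<in>| E" "E |-| {|k|} = D" for E
    using that by auto
  have t: "Poly_Mapping.lookup (if k |\<in>| E then Poly_Mapping.single (E |-| {|k|}) (fsgn k E) else 0) D
     = (if k |\<notin>| D \<and> E = finsert k D then fsgn k D else 0)" for E
    by (cases "k |\<in>| D") (auto simp: lookup_single when_def fsgn_finsert dest: e)
  show ?thesis
    unfolding ann_def lin_ext_def lookup_sum lookup_cscale t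
    by (simp add: if_distrib[where f = "\<lambda>x. _ * x"] sum.delta in_keys_iff cong: if_cong)
qed

lemma fock_irreducible:
  assumes U: "fk.clifford_submodule U"
  shows "U = {0} \<or> U = UNIV"
proof -
  have sub: "cs.subspace U" using U by (simp add: fk.clifford_submodule_def)
  have main: "v \<in> U \<Longrightarrow> v \<noteq> 0 \<Longrightarrow> (\<And>D. D \<in> Poly_Mapping.keys v \<Longrightarrow> fcard D \<le> n) \<Longrightarrow> bvec {||} \<in> U"
    for n v
  proof (induction n arbitrary: v)
    case 0
    have k: "Poly_Mapping.keys v \<subseteq> {{||}}" using 0(3) by auto
    define c where "c = Poly_Mapping.lookup v {||}"
    have v: "v = Poly_Mapping.single {||} c"
      using k by (auto intro!: poly_mapping_eqI simp: lookup_single when_def c_def in_keys_iff)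
    hence "c \<noteq> 0" using 0(2) by auto
    moreover have "cscale (1 / c) v \<in> U" using sub 0(1) by (rule cs.subspace_scale)
    ultimately show ?case by (simp add: v cscale_single)
  next
    case (Suc n)
    show ?case
    proof (cases "\<forall>D\<in>Poly_Mapping.keys v. fcard D \<le> n")
      case True thus ?thesis using Suc by blast
    next
      case False
      then obtain D where D: "D \<in> Poly_Mapping.keys v" "fcard D = Suc n"
        using Suc.prems(3) by (metis le_SucE)
      then obtain k where k: "k |\<in>| D" by (metis fcard_fempty nat.distinct(1) ex_fin_conv all_not_fin_conv)
      have "ann k v \<in> U" using U Suc.prems(1) by (rule submodule_cre_ann)
      moreover have "Poly_Mapping.lookup (ann k v) (D |-| {|k|}) \<noteq> 0"
        using D k by (simp add: lookup_ann finsert_absorb in_keys_iff)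
      hence "ann k v \<noteq> 0" by auto
      moreover have "fcard E \<le> n" if "E \<in> Poly_Mapping.keys (ann k v)" for E
      proof -
        have "k |\<notin>| E" "finsert k E \<in> Poly_Mapping.keys v"
          using that by (auto simp: in_keys_iff lookup_ann split: if_splits)
        thus ?thesis using Suc.prems(3)[of "finsert k E"] by (simp add: fcard_finsert_disjoint)
      qed
      ultimately show ?thesis by (rule Suc.IH)
    qed
  qed
  show ?thesis
  proof (cases "U = {0}")
    case False
    then obtain v where v: "v \<in> U" "v \<noteq> 0" using cs.subspace_0[OF sub] by auto
    have "bvec {||} \<in> U"
      by (rule main[OF v, of "Max (insert 0 (fcard ` Poly_Mapping.keys v))"]) (auto intro!: Max_ge)
    thus ?thesis using fock_generated[OF U] by blast
  qed auto
qed

lemma linear_charge: "Vector_Spaces.linear cscale cscale charge"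
  unfolding charge_def by (rule linear_lin_ext[OF vector_space_cscale])

lemma charge_single: "charge (Poly_Mapping.single D c) =
    Poly_Mapping.single D (c * (\<Sum>d\<in>fset D. if d \<le> 0 then 1 else - 1))"
  by (simp add: charge_def lin_ext_single[OF vector_space_cscale] cscale_single)

lemma charge_commutator:
  assumes "Vector_Spaces.linear cscale cscale A"
    and "\<And>b. charge (A (bvec b)) - A (charge (bvec b)) = cscale c (A (bvec b))"
  shows "charge (A v) - A (charge v) = cscale c (A v)"
proof -
  interpret A: Vector_Spaces.linear cscale cscale A by fact
  interpret B: Vector_Spaces.linear cscale cscale charge by (rule linear_charge)
  have "(\<lambda>v. charge (A v) - A (charge v)) = (\<lambda>v. cscale c (A v))"
    by (rule linear_eq_on_bvec)
       (unfold_locales, simp_all add: A.add B.add A.scale B.scale cs.scale_right_distrib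
          cs.scale_right_diff_distrib mult.commute assms(2))
  thus ?thesis by (rule fun_cong)
qed

lemma charge_zero: "charge 0 = 0"
  by (simp add: charge_def lin_ext_def)

lemma charge_cre: "charge (cre k v) - cre k (charge v) = cscale (if k \<le> 0 then 1 else - 1) (cre k v)"
  by (rule charge_commutator[OF linear_cre])
     (auto simp: charge_single cre_single cscale_single charge_zero simp flip: single_diff,
      auto simp: algebra_simps)

lemma charge_ann: "charge (ann k v) - ann k (charge v) = cscale (if k \<le> 0 then - 1 else 1) (ann k v)"
  by (rule charge_commutator[OF linear_ann])
     (auto simp: charge_single ann_single cscale_single charge_zero sum_diff1 simp flip: single_diff,
      auto simp: algebra_simps)

lemma charged_fock_space_fock: "charged_fock_space cscale psip psim (bvec {||}) charge"
proof unfold_locales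
  have "Poly_Mapping.lookup (bvec {||} :: fock) {||} \<noteq> Poly_Mapping.lookup 0 {||}" by simp
  hence "bvec {||} \<noteq> (0 :: fock)" by metis
  thus "(UNIV :: fock set) \<noteq> {0}" by blast
  show "U = {0} \<or> U = UNIV" if "fk.clifford_submodule U" for U
    using that by (rule fock_irreducible)
  show "U = UNIV" if "fk.clifford_submodule U" "bvec {||} \<in> U" for U
    using that by (rule fock_generated)
  show "charge (bvec {||}) = 0" by (simp add: charge_single)
  show "charge (x + y) = charge x + charge y" "charge (cscale c x) = cscale c (charge x)" for x y c
    using linear_charge by (auto simp: Vector_Spaces.linear_def module_hom_def module_hom_axioms_def)
  fix r :: rat assume r: "r \<in> half_odd"
  then obtain i where i: "r = of_int i - 1/2" "mode r = i" by (rule half_odd_cases)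
  show "charge (psip r v) - psip r (charge v) = psip r v"
       "charge (psim r v) - psim r (charge v) = - psim r v" for v
    using i by (auto simp: psip_def psim_def charge_cre charge_ann)
  assume "r > 0"
  hence "i > 0" using i by (simp add: field_simps)
  thus "psip r (bvec {||}) = 0" "psim r (bvec {||}) = 0"
    by (auto simp: psip_def psim_def i mode_shift ann_single)
qed

end

end

theory Submission
  imports Defs
begin

text \<open>
  Write \<open>Y\<^sup>\<plusminus>(z) = Y(e\<^bsup>\<plusminus>\<beta>\<^esup>, z)\<close>. The generating functions of \<open>e(m)\<close> and \<open>f(m)\<close> are
  \<open>(\<partial> + \<lambda>/z) \<Psi>\<^sup>+(z) \<otimes> Y\<^sup>+(z)\<close> and \<open>(\<partial> + \<mu>/z) \<Psi>\<^sup>-(z) \<otimes> Y\<^sup>-(z)\<close>.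

  \<^bold>\<open>The brackets.\<close> The exponentials of the Heisenberg operators satisfy
  \<open>Y\<^sup>+(z) Y\<^sup>-(w) = (z - w) :Y\<^sup>+(z) Y\<^sup>-(w):\<close> and \<open>(z - w) Y\<^sup>\<plusminus>(z) Y\<^sup>\<plusminus>(w) = :Y\<^sup>\<plusminus>(z) Y\<^sup>\<plusminus>(w):\<close>. By the
  second identity the anticommutator of the modes \<open>p\<close> and \<open>q\<close> of \<open>Y\<^sup>\<plusminus>\<close> depends only on \<open>p + q\<close>;
  paired with the antisymmetric products of two \<open>\<Psi>\<^sup>\<plusminus>\<close> it cancels, so the \<open>e(m)\<close> commute, and so do the
  \<open>f(m)\<close>. By the first identity \<open>Y\<^sup>+\<close> and \<open>Y\<^sup>-\<close> anticommute; in \<open>[e(m), f(n)]\<close> only the contractions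
  of \<open>\<Psi>\<^sup>+\<close> with \<open>\<Psi>\<^sup>-\<close> survive and leave the sum over \<open>i\<close> of \<open>(\<lambda> - i)(\<mu> - 1 + i)\<close> times a product of
  modes of \<open>Y\<^sup>+\<close> and \<open>Y\<^sup>-\<close>. The factor \<open>z - w\<close> lowers the degree of the weight by one, and the
  first two moments of the normally ordered product are \<open>1\<close> and the Heisenberg field
  (\<open>vertex_op_weighted_sum\<close>). The action is determined by its values on the basis because it is linear
  in the Lie algebra element (\<open>is_realization_iff\<close>).

  \<^bold>\<open>Irreducibility.\<close> All operators commute with \<open>H(0)\<close>. Let \<open>U\<close> be a nonzero submodule of an eigenspace
  of \<open>H(0)\<close>. It is invariant under \<open>\<beta>(n)\<close>, hence under the diagonal operators \<open>\<beta>(0)\<close> and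
  \<open>\<beta>(-n) \<beta>(n)\<close>, which separate the basis of \<open>F\<^sub>-\<^sub>1\<close>; so \<open>U\<close> is spanned by vectors \<open>x \<otimes> b\<close> with \<open>b\<close> a
  basis vector, and \<open>b\<close> may be replaced by \<open>e\<^bsup>r\<beta>\<^esup>\<close> and back. The coefficient of \<open>e\<^bsup>(r+1)\<beta>\<^esup>\<close> in
  \<open>e(i + r) (x \<otimes> e\<^bsup>r\<beta>\<^esup>)\<close> is \<open>(\<lambda> - i) \<Psi>\<^sup>+(i - 1/2) x\<close>, and \<open>\<lambda> - i \<noteq> 0\<close> since \<open>\<lambda>\<close> is not an integer;
  similarly for \<open>f\<close> and \<open>\<mu>\<close>. So the vectors \<open>x\<close> span a Clifford submodule of \<open>F\<close>, which is all of \<open>F\<close>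
  (\<open>charge_space_minimal\<close>).

  \<^bold>\<open>The decomposition.\<close> The charge operator of \<open>F\<close> is diagonalizable with integer eigenvalues, because
  the span of its eigenvectors is a Clifford submodule containing the vacuum. Hence \<open>F \<otimes> F\<^sub>-\<^sub>1\<close> is the
  direct sum of the eigenspaces of \<open>H(0)\<close>. Multiplication by \<open>e\<^bsup>s\<beta>\<^esup>\<close> is an isomorphism from the spectral
  flow \<open>\<pi>\<^sub>s\<close> of the kernel of \<open>H(0)\<close> to the eigenspace for \<open>-s\<close> (\<open>flow_shift_spectral_flow\<close>).
\<close>

lemma linear_rules:
  assumes "Vector_Spaces.linear s1 s2 A"
  shows linear_rule_add: "A (x + y) = A x + A y"
    and linear_rule_scale: "A (s1 c x) = s2 c (A x)"
    and linear_rule_zero: "A 0 = 0"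
    and linear_rule_diff: "A (x - y) = A x - A y"
    and linear_rule_sum: "A (sum g S) = (\<Sum>i\<in>S. A (g i))"
proof -
  interpret Vector_Spaces.linear s1 s2 A by fact
  show "A (x + y) = A x + A y" "A (s1 c x) = s2 c (A x)" "A 0 = 0" "A (x - y) = A x - A y"
    "A (sum g S) = (\<Sum>i\<in>S. A (g i))"
    by (simp_all add: add scale diff sum)
qed

interpretation cs: vector_space "cscale :: complex \<Rightarrow> ('b \<Rightarrow>\<^sub>0 complex) \<Rightarrow> _"
  by (rule vector_space_cscale)

abbreviation clinear :: "(lattice_space \<Rightarrow> lattice_space) \<Rightarrow> bool" where
  "clinear \<equiv> Vector_Spaces.linear cscale cscale"

lemma clinearI:
  assumes "\<And>x y. A (x + y) = A x + A y" "\<And>c x. A (cscale c x) = cscale c (A x)"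
  shows "clinear A"
  using assms by unfold_locales

section \<open>Coefficients of exponentials of commuting operators\<close>

definition compositions :: "nat \<Rightarrow> nat \<Rightarrow> nat list set" where
  "compositions l k = {ns. length ns = l \<and> sum_list ns = k \<and> 0 \<notin> set ns}"

text \<open>The coefficient of \<open>z\<^sup>k\<close> in \<open>(\<Sum>i\<ge>1. A i z\<^sup>i)\<^sup>l\<close>.\<close>

definition power_coeff ::
  "(nat \<Rightarrow> lattice_space \<Rightarrow> lattice_space) \<Rightarrow> nat \<Rightarrow> nat \<Rightarrow> lattice_space \<Rightarrow> lattice_space" where
  "power_coeff A l k v = (\<Sum>ns\<in>compositions l k. foldr A ns v)"

lemma compositions_Suc:
  "compositions (Suc l) k = (\<Union>i\<in>{1..k}. (#) i ` compositions l (k - i))"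
proof (intro equalityI subsetI)
  fix ns assume ns: "ns \<in> compositions (Suc l) k"
  then obtain i ms where ims: "ns = i # ms" by (cases ns) (auto simp: compositions_def)
  with ns have "ms \<in> compositions l (k - i)" "i \<in> {1..k}"
    by (auto simp: compositions_def)
  thus "ns \<in> (\<Union>i\<in>{1..k}. (#) i ` compositions l (k - i))" using ims by blast
qed (auto simp: compositions_def)

lemma finite_compositions: "finite (compositions l k)"
proof (induction l arbitrary: k)
  case 0
  have "compositions 0 k \<subseteq> {[]}" by (auto simp: compositions_def)
  thus ?case by (rule finite_subset) simp
qed (simp add: compositions_Suc)

lemma length_composition: "ns \<in> compositions l k \<Longrightarrow> l \<le> k"
proof (induction l arbitrary: k ns)
  case (Suc l)
  then obtain i ms where "i \<in> {1..k}" "ms \<in> compositions l (k - i)"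
    by (auto simp: compositions_Suc)
  with Suc.IH show ?case by fastforce
qed simp

lemma power_coeff_0: "power_coeff A 0 k v = (if k = 0 then v else 0)"
proof -
  have "compositions 0 k = (if k = 0 then {[]} else {})" by (auto simp: compositions_def)
  thus ?thesis by (simp add: power_coeff_def)
qed

lemma power_coeff_Suc:
  assumes "\<And>i. clinear (A i)"
  shows "power_coeff A (Suc l) k v = (\<Sum>i\<in>{1..k}. A i (power_coeff A l (k - i) v))"
  unfolding power_coeff_def compositions_Suc
  by (subst sum.UNION_disjoint)
     (auto simp: finite_compositions sum.reindex linear_rule_sum[OF assms])

lemma exp_coeff_power_coeff:
  assumes "k \<le> n"
  shows "exp_coeff A k v = (\<Sum>l\<le>n. cscale (1 / fact l) (power_coeff A l k v))"
proof -
  have "{ns. sum_list ns = k \<and> 0 \<notin> set ns} = (\<Union>l\<in>{..n}. compositions l k)"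
    using assms length_composition[of _ _ k] by (fastforce simp: compositions_def)
  hence "exp_coeff A k v =
     (\<Sum>l\<le>n. \<Sum>ns\<in>compositions l k. cscale (1 / fact (length ns)) (foldr A ns v))"
    unfolding exp_coeff_def
    by (simp only:) (subst sum.UNION_disjoint, auto simp: finite_compositions, auto simp: compositions_def)
  also have "\<dots> = (\<Sum>l\<le>n. cscale (1 / fact l) (power_coeff A l k v))"
    unfolding power_coeff_def cs.scale_sum_right
    by (intro sum.cong refl) (auto simp: compositions_def)
  finally show ?thesis .
qed

text \<open>This is Leibniz' rule \<open>(X\<^bsup>l+1\<^esup>)' = (l + 1) X' X\<^bsup>l\<^esup>\<close> for \<open>X = \<Sum>i\<ge>1. A i z\<^sup>i\<close>, which needs the
  coefficients of \<open>X\<close> to commute.\<close>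

lemma power_coeff_derivative:
  assumes lin: "\<And>i. clinear (A i)" and comm: "\<And>i j v. A i (A j v) = A j (A i v)"
  shows "cscale (of_nat k) (power_coeff A (Suc l) k v) =
         cscale (of_nat (Suc l)) (\<Sum>i\<in>{1..k}. cscale (of_nat i) (A i (power_coeff A l (k - i) v)))"
proof (induction l arbitrary: k)
  case 0
  have "cscale (of_nat k) (A i (power_coeff A 0 (k - i) v)) =
        cscale (of_nat i) (A i (power_coeff A 0 (k - i) v))" if "i \<in> {1..k}" for i
    using that by (cases "i = k") (auto simp: power_coeff_0 linear_rule_zero[OF lin])
  hence "(\<Sum>i\<in>{1..k}. cscale (of_nat k) (A i (power_coeff A 0 (k - i) v))) =
         (\<Sum>i\<in>{1..k}. cscale (of_nat i) (A i (power_coeff A 0 (k - i) v)))"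
    by (rule sum.cong[OF refl])
  thus ?case
    by (simp add: power_coeff_Suc[OF lin] cs.scale_sum_right)
next
  case (Suc l)
  let ?P = "power_coeff A"
  define T where "T = {(i, j). i \<in> {1..k} \<and> j \<in> {1..k - i}}"
  have T: "(\<Sum>i\<in>{1..k}. \<Sum>j\<in>{1..k - i}. G i j) = (\<Sum>i\<in>{1..k}. \<Sum>j\<in>{1..k - i}. G j i)"
    for G :: "nat \<Rightarrow> nat \<Rightarrow> lattice_space"
    unfolding sum.Sigma[OF finite_atLeastAtMost ballI[OF finite_atLeastAtMost]]
    by (rule sum.reindex_bij_witness[of _ prod.swap prod.swap]) auto
  have "cscale (of_nat k) (?P (Suc (Suc l)) k v) =
        (\<Sum>i\<in>{1..k}. cscale (of_nat i) (A i (?P (Suc l) (k - i) v))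
             + A i (cscale (of_nat (k - i)) (?P (Suc l) (k - i) v)))"
    unfolding power_coeff_Suc[OF lin, where l = "Suc l"] cs.scale_sum_right
    by (intro sum.cong refl)
       (simp add: linear_rule_scale[OF lin] of_nat_diff flip: cs.scale_left_distrib)
  also have "\<dots> = (\<Sum>i\<in>{1..k}. cscale (of_nat i) (A i (?P (Suc l) (k - i) v))) +
     (\<Sum>i\<in>{1..k}. \<Sum>j\<in>{1..k - i}. cscale (of_nat (Suc l)) (cscale (of_nat j) (A i (A j (?P l (k - i - j) v)))))"
    unfolding Suc sum.distrib
    by (simp add: linear_rule_scale[OF lin] linear_rule_sum[OF lin] cs.scale_sum_right del: of_nat_Suc)
  also have "(\<Sum>i\<in>{1..k}. \<Sum>j\<in>{1..k - i}. cscale (of_nat (Suc l)) (cscale (of_nat j) (A i (A j (?P l (k - i - j) v)))))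
     = (\<Sum>i\<in>{1..k}. \<Sum>j\<in>{1..k - i}. cscale (of_nat (Suc l)) (cscale (of_nat i) (A i (A j (?P l (k - i - j) v)))))"
    by (subst T) (simp add: comm add.commute del: of_nat_Suc)
  also have "\<dots> = cscale (of_nat (Suc l)) (\<Sum>i\<in>{1..k}. cscale (of_nat i) (A i (?P (Suc l) (k - i) v)))"
    by (simp add: power_coeff_Suc[OF lin] linear_rule_sum[OF lin] cs.scale_sum_right del: of_nat_Suc)
  finally show ?case
    by (simp only: of_nat_Suc[of "Suc l"] cs.scale_left_distrib cs.scale_one)
qed

text \<open>The coefficient form of \<open>E' = X' E\<close> for \<open>E = exp X\<close>. Every later property of the exponentials
  follows from this recursion by induction on the degree.\<close>

lemma exp_coeff_recursion:
  assumes lin: "\<And>i. clinear (A i)" and comm: "\<And>i j v. A i (A j v) = A j (A i v)"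
  shows "cscale (of_nat k) (exp_coeff A k v) =
         (\<Sum>i\<in>{1..k}. cscale (of_nat i) (A i (exp_coeff A (k - i) v)))"
proof -
  let ?P = "power_coeff A"
  have "cscale (of_nat k) (exp_coeff A k v) =
        (\<Sum>l\<le>Suc k. cscale (1 / fact l) (cscale (of_nat k) (?P l k v)))"
    by (simp add: exp_coeff_power_coeff[of k "Suc k"] cs.scale_sum_right mult.commute del: sum.atMost_Suc)
  also have "\<dots> = (\<Sum>l\<le>k. cscale (1 / fact (Suc l)) (cscale (of_nat k) (?P (Suc l) k v)))"
    by (subst sum.atMost_Suc_shift) (simp add: power_coeff_0 del: fact_Suc)
  also have "\<dots> = (\<Sum>l\<le>k. cscale (1 / fact l)
       (\<Sum>i\<in>{1..k}. cscale (of_nat i) (A i (?P l (k - i) v))))"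
  proof (rule sum.cong[OF refl])
    fix l
    have "1 / fact (Suc l) * of_nat (Suc l) = (1 / fact l :: complex)"
      by (simp add: fact_Suc del: of_nat_Suc)
    thus "cscale (1 / fact (Suc l)) (cscale (of_nat k) (?P (Suc l) k v)) =
          cscale (1 / fact l) (\<Sum>i\<in>{1..k}. cscale (of_nat i) (A i (?P l (k - i) v)))"
      by (simp only: power_coeff_derivative[OF assms] cs.scale_scale)
  qed
  also have "\<dots> = (\<Sum>i\<in>{1..k}. cscale (of_nat i) (A i (\<Sum>l\<le>k. cscale (1 / fact l) (?P l (k - i) v))))"
    unfolding cs.scale_sum_right linear_rule_sum[OF lin]
    by (subst sum.swap) (simp add: linear_rule_scale[OF lin] mult.commute)
  also have "\<dots> = (\<Sum>i\<in>{1..k}. cscale (of_nat i) (A i (exp_coeff A (k - i) v)))"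
    by (intro sum.cong refl) (subst exp_coeff_power_coeff[of _ k], auto)
  finally show ?thesis .
qed

lemma clinear_exp_coeff:
  assumes lin: "\<And>i. clinear (A i)"
  shows "clinear (exp_coeff A k)"
proof -
  have "foldr A ns (x + y) = foldr A ns x + foldr A ns y"
       "foldr A ns (cscale c x) = cscale c (foldr A ns x)" for ns x y c
    by (induction ns) (simp_all add: linear_rule_add[OF lin] linear_rule_scale[OF lin])
  thus ?thesis
    by (intro clinearI)
       (simp_all add: exp_coeff_def cs.scale_right_distrib sum.distrib cs.scale_sum_right mult.commute)
qed

section \<open>The exponentials of the Heisenberg algebra\<close>

text \<open>The coefficient of \<open>z\<^sup>k\<close> in \<open>exp (c \<Sum>i\<ge>1. \<beta>(si)/i z\<^sup>i)\<close>, with \<open>s\<close> a sign. The degree \<open>k\<close> is an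
  integer, and the coefficient is \<open>0\<close> for \<open>k < 0\<close>, so that degrees can be shifted freely.\<close>

definition hexp :: "int \<Rightarrow> complex \<Rightarrow> int \<Rightarrow> lattice_space \<Rightarrow> lattice_space" where
  "hexp s c k v = (if k < 0 then 0
     else exp_coeff (\<lambda>i v. cscale (c / of_nat i) (beta (s * int i) v)) (nat k) v)"

lemma beta_add: "beta n (x + y) = beta n x + beta n y"
  by (rule linear_rule_add[OF linear_beta])
lemma beta_scale: "beta n (cscale c x) = cscale c (beta n x)"
  by (rule linear_rule_scale[OF linear_beta])
lemma beta_diff: "beta n (x - y) = beta n x - beta n y"
  by (rule linear_rule_diff[OF linear_beta])
lemma beta_sum: "beta n (sum g S) = (\<Sum>i\<in>S. beta n (g i))"
  by (rule linear_rule_sum[OF linear_beta])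
lemmas beta_linear = beta_0_vec beta_add beta_scale beta_diff beta_sum

lemma beta_commute_same_sign: "beta (s * int i) (beta (s * int j) v) = beta (s * int j) (beta (s * int i) v)"
proof -
  have "s * int i + s * int j = 0 \<Longrightarrow> s * int i = 0"
    by (metis add_nonneg_eq_0_iff distrib_left mult_eq_0_iff of_nat_0_le_iff)
  hence "(if s * int i + s * int j = 0 then - of_int (s * int i) else 0) = (0 :: complex)" by auto
  with beta_commutator[of "s * int i" "s * int j" v] show ?thesis by (simp only: cs.scale_zero_left) simp
qed

lemma clinear_scaled_beta: "clinear (\<lambda>v. cscale c (beta n v))"
  by (rule clinearI) (simp_all add: beta_linear cs.scale_right_distrib mult.commute)

lemma clinear_hexp: "clinear (hexp s c k)"
proof -
  note * = clinear_exp_coeff[OF clinear_scaled_beta, of "\<lambda>i. c / of_nat i" "\<lambda>i. s * int i" "nat k"]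
  show ?thesis
    by (rule clinearI) (simp_all add: hexp_def linear_rule_add[OF *] linear_rule_scale[OF *])
qed

lemmas hexp_linear = linear_rule_zero[OF clinear_hexp] linear_rule_add[OF clinear_hexp]
  linear_rule_scale[OF clinear_hexp] linear_rule_diff[OF clinear_hexp] linear_rule_sum[OF clinear_hexp]

lemma hexp_neg: "k < 0 \<Longrightarrow> hexp s c k v = 0"
  by (simp add: hexp_def)

lemma hexp_0: "hexp s c 0 v = v"
  by (simp add: hexp_def exp_coeff_0)

lemma hexp_recursion:
  assumes "k \<le> n"
  shows "cscale (of_int k) (hexp s c k v) = (\<Sum>i\<in>{1..n}. cscale c (beta (s * i) (hexp s c (k - i) v)))"
proof (cases "k < 0")
  case True
  thus ?thesis by (simp add: hexp_neg beta_linear)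
next
  case False
  let ?A = "\<lambda>i v. cscale (c / of_nat i) (beta (s * int i) v)"
  have "cscale (of_int k) (hexp s c k v) = cscale (of_nat (nat k)) (exp_coeff ?A (nat k) v)"
    using False by (simp add: hexp_def)
  also have "\<dots> = (\<Sum>i\<in>{1..nat k}. cscale (of_nat i) (?A i (exp_coeff ?A (nat k - i) v)))"
    by (rule exp_coeff_recursion)
       (simp_all add: clinear_scaled_beta beta_linear beta_commute_same_sign mult.commute)
  also have "\<dots> = (\<Sum>i\<in>{1..k}. cscale c (beta (s * i) (hexp s c (k - i) v)))"
    using False
    by (intro sum.reindex_bij_witness[of _ nat int]) (auto simp: hexp_def nat_diff_distrib)
  also have "\<dots> = (\<Sum>i\<in>{1..n}. cscale c (beta (s * i) (hexp s c (k - i) v)))"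
    using assms by (intro sum.mono_neutral_left) (auto simp: hexp_neg beta_linear)
  finally show ?thesis .
qed

lemma hexp_index_induct [case_names neg zero pos]:
  fixes k :: int
  assumes "\<And>k. k < 0 \<Longrightarrow> P k" "P 0" "\<And>k. k > 0 \<Longrightarrow> (\<And>j. j < k \<Longrightarrow> P j) \<Longrightarrow> P k"
  shows "P k"
proof (induction "nat k" arbitrary: k rule: less_induct)
  case less
  show ?case
  proof (cases k "0::int" rule: linorder_cases)
    case greater
    have "P j" if "j < k" for j
      using less[of j] that greater assms(1,2) by (cases "j < 0") auto
    thus ?thesis using assms(3) greater by blast
  qed (use assms in auto)
qed

lemma cscale_of_int_cancel: "cscale (of_int k) x = cscale (of_int k) y \<Longrightarrow> k \<noteq> 0 \<Longrightarrow> x = y"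
  by simp

lemma beta_beta: "beta m (beta n v) = beta n (beta m v) + cscale (if m + n = 0 then - of_int m else 0) v"
  using beta_commutator[of m n v] by (simp add: algebra_simps)

text \<open>\<open>[\<beta>(n), c \<beta>(si)/i z\<^sup>i]\<close> is the scalar \<open>sc z\<^sup>i\<close> if \<open>n = - si\<close> and \<open>0\<close> otherwise, so the commutator
  with the exponential multiplies it by \<open>sc z\<^bsup>-sn\<^esup>\<close> or by \<open>0\<close>.\<close>

lemma beta_hexp:
  assumes s: "s = 1 \<or> s = - 1"
  shows "beta n (hexp s c k v) = hexp s c k (beta n v) +
           (if s * n < 0 then cscale (of_int s * c) (hexp s c (k + s * n) v) else 0)"
proof (induction k rule: hexp_index_induct)
  case (neg k)
  thus ?case by (simp add: hexp_neg beta_linear)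
next
  case zero
  thus ?case by (simp add: hexp_0 hexp_neg)
next
  case (pos k)
  have ss: "of_int s * of_int s = (1 :: complex)" "s * s = 1" using s by auto
  have "cscale (of_int k) (beta n (hexp s c k v)) =
        (\<Sum>i\<in>{1..k}. cscale c (beta n (beta (s * i) (hexp s c (k - i) v))))"
    by (simp only: beta_scale[symmetric] hexp_recursion[of k k] order.refl beta_sum)
  also have "\<dots> = (\<Sum>i\<in>{1..k}. cscale c (beta (s * i) (beta n (hexp s c (k - i) v)))
       + cscale c (cscale (if n + s * i = 0 then - of_int n else 0) (hexp s c (k - i) v)))"
    by (simp only: beta_beta[of n] cs.scale_right_distrib)
  also have "\<dots> = (\<Sum>i\<in>{1..k}. cscale c (beta (s * i) (hexp s c (k - i) (beta n v)))
      + cscale c (if s * n < 0 then cscale (of_int s * c) (beta (s * i) (hexp s c (k + s * n - i) v)) else 0)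
       + cscale c (cscale (if n + s * i = 0 then - of_int n else 0) (hexp s c (k - i) v)))"
  proof (rule sum.cong[OF refl])
    fix i assume "i \<in> {1..k}"
    hence "k - i < k" by simp
    note IH = pos(2)[OF this]
    have e: "k - i + s * n = k + s * n - i" by simp
    thus "cscale c (beta (s * i) (beta n (hexp s c (k - i) v)))
       + cscale c (cscale (if n + s * i = 0 then - of_int n else 0) (hexp s c (k - i) v))
      = cscale c (beta (s * i) (hexp s c (k - i) (beta n v)))
      + cscale c (if s * n < 0 then cscale (of_int s * c) (beta (s * i) (hexp s c (k + s * n - i) v)) else 0)
       + cscale c (cscale (if n + s * i = 0 then - of_int n else 0) (hexp s c (k - i) v))"
      unfolding IH e by (simp add: beta_linear cs.scale_right_distrib)
  qed
  also have "\<dots> = cscale (of_int k) (hexp s c k (beta n v))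
      + (if s * n < 0 then cscale (of_int s * c) (cscale (of_int (k + s * n)) (hexp s c (k + s * n) v)) else 0)
      + (if s * n < 0 then cscale (- c * of_int n) (hexp s c (k + s * n) v) else 0)"
  proof -
    have "(\<Sum>i\<in>{1..k}. cscale c (cscale (if n + s * i = 0 then - of_int n else 0) (hexp s c (k - i) v)))
       = (\<Sum>i\<in>{1..k}. if i = - (s * n) then cscale (- c * of_int n) (hexp s c (k + s * n) v) else 0)"
      using s by (intro sum.cong refl) auto
    also have "\<dots> = (if s * n < 0 then cscale (- c * of_int n) (hexp s c (k + s * n) v) else 0)"
      by (auto simp: sum.delta hexp_neg)
    finally have 1: "(\<Sum>i\<in>{1..k}. cscale c (cscale (if n + s * i = 0 then - of_int n else 0) (hexp s c (k - i) v)))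
       = (if s * n < 0 then cscale (- c * of_int n) (hexp s c (k + s * n) v) else 0)" .
    have 2: "(\<Sum>i\<in>{1..k}. cscale c (if s * n < 0 then cscale (of_int s * c) (beta (s * i) (hexp s c (k + s * n - i) v)) else 0))
      = (if s * n < 0 then cscale (of_int s * c) (cscale (of_int (k + s * n)) (hexp s c (k + s * n) v)) else 0)"
    proof (cases "s * n < 0")
      case True
      hence "k + s * n \<le> k" by simp
      from hexp_recursion[OF this] True show ?thesis
        by (simp add: cs.scale_sum_right mult.left_commute mult.commute[of c])
    qed auto
    show ?thesis unfolding sum.distrib 1 2 by (simp add: hexp_recursion[of k k])
  qed
  also have "\<dots> = cscale (of_int k) (hexp s c k (beta n v) +
           (if s * n < 0 then cscale (of_int s * c) (hexp s c (k + s * n) v) else 0))"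
  proof -
    have e: "of_int s * c * of_int (k + s * n) + - c * of_int n = of_int k * (of_int s * c)"
      using ss(1) by (simp add: algebra_simps)
    have "cscale (of_int s * c) (cscale (of_int (k + s * n)) w) + cscale (- c * of_int n) w
      = cscale (of_int k) (cscale (of_int s * c) w)" for w :: lattice_space
      unfolding cs.scale_scale e[symmetric] by (simp only: cs.scale_left_distrib)
    from this[of "hexp s c (k + s * n) v"] show ?thesis
      by (cases "s * n < 0")
         (simp_all only: if_True if_False cs.scale_right_distrib add_0_right add.assoc)
  qed
  finally show ?case by (rule cscale_of_int_cancel) (use pos in simp)
qed

lemma beta_hexp_same:
  assumes "s = 1 \<or> s = - 1" "i > 0"
  shows "beta (s * i) (hexp s c k v) = hexp s c k (beta (s * i) v)"
  using assms by (auto simp: beta_hexp)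

lemma beta_hexp_opposite:
  assumes "s = 1 \<or> s = - 1" "i > 0"
  shows "beta (s * i) (hexp (- s) d j v) =
         hexp (- s) d j (beta (s * i) v) - cscale (of_int s * d) (hexp (- s) d (j - i) v)"
  using assms by (auto simp: beta_hexp)

lemma hexp_commute:
  assumes s: "s = 1 \<or> s = - 1"
  shows "hexp s c k (hexp s d j v) = hexp s d j (hexp s c k v)"
proof (induction k rule: hexp_index_induct)
  case (pos k)
  have "cscale (of_int k) (hexp s c k (hexp s d j v)) =
        (\<Sum>i\<in>{1..k}. cscale c (beta (s * i) (hexp s d j (hexp s c (k - i) v))))"
    by (simp add: hexp_recursion[of k k, OF order.refl] pos)
  also have "\<dots> = hexp s d j (\<Sum>i\<in>{1..k}. cscale c (beta (s * i) (hexp s c (k - i) v)))"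
    by (simp add: hexp_linear beta_hexp_same[OF s])
  also have "\<dots> = cscale (of_int k) (hexp s d j (hexp s c k v))"
    by (simp only: hexp_recursion[of k k, OF order.refl, symmetric] hexp_linear)
  finally have "cscale (of_int k) (hexp s c k (hexp s d j v)) = cscale (of_int k) (hexp s d j (hexp s c k v))" .
  thus ?case by (rule cscale_of_int_cancel) (use pos in simp)
qed (simp_all add: hexp_neg hexp_0 hexp_linear)

lemma sum_telescope_int:
  fixes g :: "int \<Rightarrow> 'a::ab_group_add"
  assumes "p \<le> q"
  shows "(\<Sum>i\<in>{p..q}. g i - g (i + 1)) = g p - g (q + 1)"
  using assms
proof (induction q rule: int_ge_induct)
  case (step q)
  have "{p..q + 1} = insert (q + 1) {p..q}" using step by auto
  thus ?case using step by simp
qed simp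

lemma sum_shift_int:
  fixes f :: "int \<Rightarrow> 'a::comm_monoid_add"
  shows "(\<Sum>i\<in>{a..b}. f (i + c)) = (\<Sum>i\<in>{a + c..b + c}. f i)"
  by (rule sum.reindex_bij_witness[of _ "\<lambda>i. i - c" "\<lambda>i. i + c"]) auto

text \<open>If \<open>A\<close> and \<open>B\<close> are the two exponents, in the variables \<open>z\<close> and \<open>w\<close>, then \<open>[A, B]\<close> is the scalar
  \<open>scd log (1 - zw)\<close>, so interchanging the exponentials costs the factor \<open>(1 - zw)\<^bsup>scd\<^esup>\<close>. In the only
  case that occurs the exponent is \<open>1\<close>.\<close>

lemma hexp_exchange:
  assumes s: "s = 1 \<or> s = - 1" and cd: "of_int s * c * d = 1"
  shows "hexp s c k (hexp (- s) d j v) =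
         hexp (- s) d j (hexp s c k v) - hexp (- s) d (j - 1) (hexp s c (k - 1) v)"
proof (induction k rule: hexp_index_induct)
  case (pos k)
  \<comment> \<open>the correction terms of the \<open>k\<close> commutations telescope\<close>
  define g where "g i = hexp (- s) d (j - i) (hexp s c (k - i) v)" for i
  have cd': "c * (of_int s * d) = 1" using cd by (simp add: mult_ac)
  have "cscale (of_int k) (hexp s c k (hexp (- s) d j v)) =
        (\<Sum>i\<in>{1..k}. cscale c (beta (s * i) (hexp (- s) d j (hexp s c (k - i) v)
             - hexp (- s) d (j - 1) (hexp s c (k - 1 - i) v))))"
    by (simp add: hexp_recursion[of k k] pos diff_diff_eq add.commute)
  also have "\<dots> = (\<Sum>i\<in>{1..k}. hexp (- s) d j (cscale c (beta (s * i) (hexp s c (k - i) v)))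
        - hexp (- s) d (j - 1) (cscale c (beta (s * i) (hexp s c (k - 1 - i) v)))
        - (g i - g (i + 1)))"
  proof (rule sum.cong[OF refl])
    fix i assume "i \<in> {1..k}"
    hence i: "i > 0" by simp
    have "g (i + 1) = hexp (- s) d (j - 1 - i) (hexp s c (k - 1 - i) v)"
      by (simp only: g_def diff_diff_eq add.commute[of i])
    thus "cscale c (beta (s * i) (hexp (- s) d j (hexp s c (k - i) v)
             - hexp (- s) d (j - 1) (hexp s c (k - 1 - i) v)))
        = hexp (- s) d j (cscale c (beta (s * i) (hexp s c (k - i) v)))
        - hexp (- s) d (j - 1) (cscale c (beta (s * i) (hexp s c (k - 1 - i) v)))
        - (g i - g (i + 1))"
      by (simp add: beta_diff beta_hexp_opposite[OF s i] hexp_linear cs.scale_right_diff_distrib cd'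
            g_def[of i])
  qed
  also have "\<dots> = hexp (- s) d j (cscale (of_int k) (hexp s c k v))
       - hexp (- s) d (j - 1) (cscale (of_int (k - 1)) (hexp s c (k - 1) v)) - (g 1 - g (k + 1))"
    using pos(1) sum_telescope_int[of 1 k g] hexp_recursion[of "k - 1" k s c v]
    by (simp only: sum_subtractf hexp_recursion[of k k, OF order.refl] hexp_linear(5)[symmetric])
  also have "\<dots> = cscale (of_int k) (hexp (- s) d j (hexp s c k v) - hexp (- s) d (j - 1) (hexp s c (k - 1) v))"
    by (simp add: g_def hexp_neg hexp_linear cs.scale_right_diff_distrib cs.scale_left_diff_distrib)
  finally show ?case by (rule cscale_of_int_cancel) (use pos in simp)
qed (simp_all add: hexp_neg hexp_0 hexp_linear)

context
  fixes s :: int and c :: complex and v :: lattice_space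
  assumes s: "s = 1 \<or> s = - 1"
begin

private definition "conv n = (\<Sum>k\<in>{0..n}. hexp s c k (hexp s (- c) (n - k) v))"

private lemma conv_interval:
  "p \<le> 0 \<Longrightarrow> n \<le> q \<Longrightarrow> (\<Sum>k\<in>{p..q}. hexp s c k (hexp s (- c) (n - k) v)) = conv n"
  unfolding conv_def by (intro sum.mono_neutral_right) (auto simp: hexp_neg hexp_linear)

private lemma conv_weighted:
  "(\<Sum>k\<in>{0..n}. cscale (of_int k) (hexp s c k (hexp s (- c) (n - k) v))) =
   (\<Sum>i\<in>{1..n}. cscale c (beta (s * i) (conv (n - i))))"
proof -
  have "(\<Sum>k\<in>{0..n}. cscale (of_int k) (hexp s c k (hexp s (- c) (n - k) v))) =
        (\<Sum>i\<in>{1..n}. cscale c (beta (s * i) (\<Sum>k\<in>{0..n}. hexp s c (k - i) (hexp s (- c) (n - k) v))))"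
    by (simp add: hexp_recursion[of _ n] beta_sum cs.scale_sum_right) (rule sum.swap)
  also have "\<dots> = (\<Sum>i\<in>{1..n}. cscale c (beta (s * i) (conv (n - i))))"
  proof (rule sum.cong[OF refl])
    fix i assume i: "i \<in> {1..n}"
    have "(\<Sum>k\<in>{0..n}. hexp s c (k - i) (hexp s (- c) (n - k) v)) =
          (\<Sum>k\<in>{0 + - i..n + - i}. hexp s c k (hexp s (- c) (n - i - k) v))"
      by (subst sum_shift_int[symmetric]) (simp add: algebra_simps)
    also have "\<dots> = conv (n - i)" using i by (intro conv_interval) auto
    finally show "cscale c (beta (s * i) (\<Sum>k\<in>{0..n}. hexp s c (k - i) (hexp s (- c) (n - k) v)))
       = cscale c (beta (s * i) (conv (n - i)))" by (rule arg_cong)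
  qed
  finally show ?thesis .
qed

private lemma conv_weighted':
  "(\<Sum>k\<in>{0..n}. cscale (of_int (n - k)) (hexp s c k (hexp s (- c) (n - k) v))) =
   - (\<Sum>i\<in>{1..n}. cscale c (beta (s * i) (conv (n - i))))"
proof -
  have "(\<Sum>k\<in>{0..n}. cscale (of_int (n - k)) (hexp s c k (hexp s (- c) (n - k) v))) =
        (\<Sum>k\<in>{0..n}. \<Sum>i\<in>{1..n}. cscale (- c) (beta (s * i) (hexp s c k (hexp s (- c) (n - i - k) v))))"
  proof (rule sum.cong[OF refl])
    fix k assume k: "k \<in> {0..n}"
    have "cscale (of_int (n - k)) (hexp s c k (hexp s (- c) (n - k) v)) =
          hexp s c k (cscale (of_int (n - k)) (hexp s (- c) (n - k) v))" by (simp only: hexp_linear)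
    also have "\<dots> = hexp s c k (\<Sum>i\<in>{1..n}. cscale (- c) (beta (s * i) (hexp s (- c) (n - k - i) v)))"
      using k by (subst hexp_recursion[of _ n]) auto
    also have "\<dots> = (\<Sum>i\<in>{1..n}. cscale (- c) (beta (s * i) (hexp s c k (hexp s (- c) (n - i - k) v))))"
      unfolding hexp_linear
      by (intro sum.cong refl) (simp add: beta_hexp_same[OF s] diff_right_commute)
    finally show "cscale (of_int (n - k)) (hexp s c k (hexp s (- c) (n - k) v)) = \<dots>" .
  qed
  also have "\<dots> = (\<Sum>i\<in>{1..n}. cscale (- c) (beta (s * i) (\<Sum>k\<in>{0..n}. hexp s c k (hexp s (- c) (n - i - k) v))))"
    by (subst sum.swap) (simp add: beta_sum cs.scale_sum_right)
  also have "\<dots> = (\<Sum>i\<in>{1..n}. cscale (- c) (beta (s * i) (conv (n - i))))"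
    by (intro sum.cong refl) (simp add: conv_interval)
  finally show ?thesis by (simp add: sum_negf)
qed

private lemma conv_eq: "conv n = (if n = 0 then v else 0)"
proof (cases "n = 0")
  case True
  thus ?thesis by (simp add: conv_def hexp_0)
next
  case False
  have "cscale (of_int n) (conv n) =
     (\<Sum>k\<in>{0..n}. cscale (of_int k) (hexp s c k (hexp s (- c) (n - k) v))) +
     (\<Sum>k\<in>{0..n}. cscale (of_int (n - k)) (hexp s c k (hexp s (- c) (n - k) v)))"
    by (simp add: conv_def cs.scale_sum_right sum.distrib[symmetric] cs.scale_left_distrib[symmetric])
  also have "\<dots> = 0" unfolding conv_weighted conv_weighted' by simp
  finally show ?thesis using False by simp
qed

text \<open>\<open>exp X exp (-X) = 1\<close>\<close>

lemma hexp_inverse: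
  assumes "p \<le> 0" "n \<le> q"
  shows "(\<Sum>k\<in>{p..q}. hexp s c k (hexp s (- c) (n - k) v)) = (if n = 0 then v else 0)"
  using assms by (simp add: conv_interval conv_eq)

text \<open>\<open>(z d/dz exp X) exp (-X) = z dX/dz\<close>, which for the present \<open>X\<close> is \<open>c \<Sum>i\<ge>1. \<beta>(si) z\<^sup>i\<close>.\<close>

lemma hexp_log_derivative:
  assumes "p \<le> 0" "n \<le> q"
  shows "(\<Sum>k\<in>{p..q}. cscale (of_int k) (hexp s c k (hexp s (- c) (n - k) v))) =
         (if n > 0 then cscale c (beta (s * n) v) else 0)"
proof -
  have "(\<Sum>k\<in>{p..q}. cscale (of_int k) (hexp s c k (hexp s (- c) (n - k) v))) =
        (\<Sum>k\<in>{0..n}. cscale (of_int k) (hexp s c k (hexp s (- c) (n - k) v)))"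
    using assms by (intro sum.mono_neutral_right) (auto simp: hexp_neg hexp_linear)
  also have "\<dots> = (\<Sum>i\<in>{1..n}. if i = n then cscale c (beta (s * n) v) else 0)"
    unfolding conv_weighted by (intro sum.cong refl) (auto simp: conv_eq beta_linear)
  also have "\<dots> = (if n > 0 then cscale c (beta (s * n) v) else 0)"
    by (auto simp: sum.delta)
  finally show ?thesis .
qed

end

section \<open>The vertex operators on a sector\<close>

definition supported_on :: "lattice_basis set \<Rightarrow> lattice_space set" where
  "supported_on B = {v. Poly_Mapping.keys v \<subseteq> B}"

abbreviation sector :: "int \<Rightarrow> lattice_space set" where
  "sector r \<equiv> supported_on ({r} \<times> UNIV)"

lemma supported_on_0: "0 \<in> supported_on B"
  by (simp add: supported_on_def)

lemma supported_on_add: "x \<in> supported_on B \<Longrightarrow> y \<in> supported_on B \<Longrightarrow> x + y \<in> supported_on B"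
  using keys_add[of x y] by (auto simp: supported_on_def)

lemma supported_on_scale: "x \<in> supported_on B \<Longrightarrow> cscale c x \<in> supported_on B"
  by (auto simp: supported_on_def in_keys_iff)

lemma supported_on_sum: "(\<And>i. i \<in> S \<Longrightarrow> g i \<in> supported_on B) \<Longrightarrow> sum g S \<in> supported_on B"
  by (induction S rule: infinite_finite_induct) (auto intro: supported_on_0 supported_on_add)

lemma supported_on_single: "(c \<noteq> 0 \<Longrightarrow> b \<in> B) \<Longrightarrow> Poly_Mapping.single b c \<in> supported_on B"
  by (auto simp: supported_on_def)

lemma beta_supported_on:
  assumes "v \<in> supported_on B" "\<And>b. b \<in> B \<Longrightarrow> beta_basis n b \<in> supported_on B'"
  shows "beta n v \<in> supported_on B'"
  unfolding beta_def lin_ext_def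
  using assms by (intro supported_on_sum supported_on_scale) (auto simp: supported_on_def)

lemma beta_sector: "v \<in> sector r \<Longrightarrow> beta n v \<in> sector r"
  by (erule beta_supported_on) (auto simp: beta_basis_def intro!: supported_on_single)

text \<open>The degree \<open>k\<close> counts the total degree of the \<open>\<beta>(si)\<close>, so every grading that the \<open>\<beta>(si)\<close> respect
  is respected by the exponential. This gives the sectors and the weights below.\<close>

lemma hexp_graded:
  assumes v: "v \<in> supported_on (B 0)"
    and step: "\<And>i k v. i > 0 \<Longrightarrow> v \<in> supported_on (B k) \<Longrightarrow> beta (s * i) v \<in> supported_on (B (k + i))"
  shows "hexp s c k v \<in> supported_on (B k)"
proof (induction k rule: hexp_index_induct)
  case (pos k)
  have "hexp s c k v = cscale (1 / of_int k) (cscale (of_int k) (hexp s c k v))"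
    using pos by simp
  also have "\<dots> \<in> supported_on (B k)"
    unfolding hexp_recursion[of k k, OF order.refl]
  proof (intro supported_on_scale supported_on_sum)
    fix i assume i: "i \<in> {1..k}"
    hence "beta (s * i) (hexp s c (k - i) v) \<in> supported_on (B (k - i + i))"
      by (intro step pos) auto
    thus "beta (s * i) (hexp s c (k - i) v) \<in> supported_on (B k)" by simp
  qed
  finally show ?case .
qed (use v in \<open>simp_all add: hexp_neg hexp_0 supported_on_0\<close>)

lemma hexp_sector: "v \<in> sector r \<Longrightarrow> hexp s c k v \<in> sector r"
  by (rule hexp_graded[where B = "\<lambda>_. {r} \<times> UNIV"]) (auto intro: beta_sector)

text \<open>The weight of \<open>\<beta>(-1)\<^bsup>a 0\<^esup> \<beta>(-2)\<^bsup>a 1\<^esup> \<dots>\<close>: because of the index shift, \<open>a i\<close> counts factors of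
  degree \<open>i + 1\<close>.\<close>

definition wt :: "(nat \<Rightarrow>\<^sub>0 nat) \<Rightarrow> int" where
  "wt a = (\<Sum>i\<in>Poly_Mapping.keys a. int (Suc i) * int (Poly_Mapping.lookup a i))"

lemma wt_nonneg: "wt a \<ge> 0"
  by (simp add: wt_def sum_nonneg)

lemma wt_0: "wt 0 = 0"
  by (simp add: wt_def)

lemma wt_add: "wt (a + b) = wt a + wt b"
proof -
  have *: "wt c = (\<Sum>i\<in>Poly_Mapping.keys a \<union> Poly_Mapping.keys b. int (Suc i) * int (Poly_Mapping.lookup c i))"
    if "Poly_Mapping.keys c \<subseteq> Poly_Mapping.keys a \<union> Poly_Mapping.keys b" for c
    unfolding wt_def using that by (intro sum.mono_neutral_left) (auto simp: in_keys_iff)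
  show ?thesis
    using keys_add[of a b] by (simp add: * lookup_add sum.distrib[symmetric] algebra_simps)
qed

lemma wt_single: "wt (Poly_Mapping.single i n) = int (Suc i) * int n"
  by (simp add: wt_def)

lemma minus_single_plus:
  "Poly_Mapping.lookup a i > 0 \<Longrightarrow> a - Poly_Mapping.single i 1 + Poly_Mapping.single i 1 = (a :: nat \<Rightarrow>\<^sub>0 nat)"
  by (auto intro!: poly_mapping_eqI simp: lookup_add lookup_minus lookup_single when_def)

lemma wt_minus_single:
  assumes "Poly_Mapping.lookup a i > 0"
  shows "wt (a - Poly_Mapping.single i 1) = wt a - int (Suc i)"
proof -
  have "wt a = wt (a - Poly_Mapping.single i 1) + wt (Poly_Mapping.single i 1)"
    by (simp only: wt_add[symmetric] minus_single_plus[OF assms])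
  thus ?thesis by (simp add: wt_single)
qed

lemma beta_weight:
  assumes "v \<in> supported_on {(r, a). wt a = d}" "n \<noteq> 0"
  shows "beta n v \<in> supported_on {(r, a). wt a = d - n}"
  using assms(1)
proof (rule beta_supported_on)
  fix b assume "b \<in> {(r :: int, a). wt a = d}"
  then obtain r a where b: "b = (r, a)" "wt a = d" by auto
  show "beta_basis n b \<in> supported_on {(r, a). wt a = d - n}"
    using assms(2) b by (auto simp: beta_basis_def wt_add wt_single wt_minus_single
        simp del: One_nat_def intro!: supported_on_single)
qed

lemma hexp_weight:
  assumes "v \<in> supported_on {(r, a). wt a = d}" "s = 1 \<or> s = - 1"
  shows "hexp s c k v \<in> supported_on {(r, a). wt a = d - s * k}"
proof -
  have "beta (s * i) w \<in> supported_on {(r, a). wt a = d - s * (k + i)}"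
    if "i > 0" "w \<in> supported_on {(r, a). wt a = d - s * k}" for i k w
    using beta_weight[OF that(2), of "s * i"] that(1) assms(2) by (auto simp: algebra_simps)
  thus ?thesis
    using assms(1) by (intro hexp_graded[where B = "\<lambda>k. {(r, a). wt a = d - s * k}"]) auto
qed

lemma hexp_bvec_eq_0:
  assumes "k > wt a"
  shows "hexp 1 c k (bvec (r, a)) = 0"
proof -
  have "hexp 1 c k (bvec (r, a)) \<in> supported_on {(r, b). wt b = wt a - 1 * k}"
    by (rule hexp_weight) (auto intro: supported_on_single)
  moreover have "wt b \<noteq> wt a - 1 * k" for b using assms wt_nonneg[of b] by simp
  ultimately have "Poly_Mapping.keys (hexp 1 c k (bvec (r, a))) = {}"
    by (auto simp: supported_on_def)
  thus ?thesis by simp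
qed

lemma lattice_space_expand:
  "v = (\<Sum>b\<in>Poly_Mapping.keys v. cscale (Poly_Mapping.lookup v b) (bvec b))"
  by (rule poly_mapping_eqI)
     (auto simp: lookup_sum lookup_single when_def in_keys_iff if_distrib sum.delta cong: if_cong)

text \<open>Annihilation operators lower the weight, which is nonnegative: this makes every sum below finite.\<close>

lemma hexp_eventually_0: "\<exists>K. \<forall>k>K. \<forall>c. hexp 1 c k v = 0"
proof -
  define K where "K = Max (insert 0 (wt ` snd ` Poly_Mapping.keys v))"
  have "hexp 1 c k v = 0" if "k > K" for k c
  proof -
    have "hexp 1 c k (bvec b) = 0" if b: "b \<in> Poly_Mapping.keys v" for b
    proof -
      have "wt (snd b) \<le> K" unfolding K_def using b by (intro Max_ge) auto
      thus ?thesis using hexp_bvec_eq_0[of "snd b" k c "fst b"] \<open>k > K\<close> by simp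
    qed
    thus ?thesis by (subst lattice_space_expand) (simp add: hexp_linear)
  qed
  thus ?thesis by blast
qed

text \<open>Multiplication by \<open>e\<^bsup>m\<beta>\<^esup>\<close>.\<close>

definition shift :: "int \<Rightarrow> lattice_space \<Rightarrow> lattice_space" where
  "shift m = lin_ext cscale (\<lambda>(r, a). bvec (r + m, a))"

lemma clinear_shift: "clinear (shift m)"
  unfolding shift_def by (rule linear_lin_ext[OF vector_space_cscale])

lemmas shift_linear = linear_rule_zero[OF clinear_shift] linear_rule_add[OF clinear_shift]
  linear_rule_scale[OF clinear_shift] linear_rule_diff[OF clinear_shift] linear_rule_sum[OF clinear_shift]

lemma shift_single: "shift m (Poly_Mapping.single (r, a) c) = Poly_Mapping.single (r + m, a) c"
  by (simp add: shift_def lin_ext_single[OF vector_space_cscale] cscale_single)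

lemma clinear_add_scale: "clinear (\<lambda>v. A v + cscale c (B v))" if "clinear A" "clinear B"
  by (rule clinearI)
     (simp_all add: that[THEN linear_rule_add] that[THEN linear_rule_scale] cs.scale_right_distrib mult.commute)

lemma clinear_comp: "clinear A \<Longrightarrow> clinear B \<Longrightarrow> clinear (\<lambda>v. A (B v))"
  by (rule clinearI) (simp_all add: linear_rule_add linear_rule_scale)

lemma shift_shift: "shift m (shift l v) = shift (m + l) v"
proof -
  have "(\<lambda>v. shift m (shift l v)) = shift (m + l)"
    by (rule linear_eq_on_bvec[OF clinear_comp[OF clinear_shift clinear_shift] clinear_shift])
       (auto simp: shift_single add_ac)
  thus ?thesis by (rule fun_cong)
qed

lemma shift_0: "shift 0 v = v"
proof -
  have "shift 0 = (\<lambda>v. v)"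
    by (rule linear_eq_on_bvec[OF clinear_shift]) (auto simp: shift_single intro: clinearI)
  thus ?thesis by (rule fun_cong)
qed

lemma beta_shift: "beta n (shift m v) = shift m (beta n v) + cscale (if n = 0 then - of_int m else 0) (shift m v)"
proof -
  have "(\<lambda>v. beta n (shift m v)) =
        (\<lambda>v. shift m (beta n v) + cscale (if n = 0 then - of_int m else 0) (shift m v))"
    by (rule linear_eq_on_bvec[OF clinear_comp[OF linear_beta clinear_shift]
          clinear_add_scale[OF clinear_comp[OF clinear_shift linear_beta] clinear_shift]])
       (auto simp: shift_single beta_single beta_basis_def cscale_single single_add[symmetric] algebra_simps)
  thus ?thesis by (rule fun_cong)
qed

lemma hexp_shift:
  assumes "s = 1 \<or> s = - 1"
  shows "hexp s c k (shift m v) = shift m (hexp s c k v)"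
proof (induction k rule: hexp_index_induct)
  case (pos k)
  have "cscale (of_int k) (hexp s c k (shift m v)) =
        (\<Sum>i\<in>{1..k}. cscale c (beta (s * i) (shift m (hexp s c (k - i) v))))"
    by (simp add: hexp_recursion[of k k, OF order.refl] pos)
  also have "\<dots> = shift m (\<Sum>i\<in>{1..k}. cscale c (beta (s * i) (hexp s c (k - i) v)))"
    using assms by (auto simp: shift_linear beta_shift intro!: sum.cong)
  also have "\<dots> = cscale (of_int k) (shift m (hexp s c k v))"
    by (simp only: hexp_recursion[of k k, OF order.refl, symmetric] shift_linear)
  finally show ?case by (rule cscale_of_int_cancel) (use pos in simp)
qed (simp_all add: hexp_neg hexp_0 shift_linear)

lemma shift_sector: "v \<in> sector r \<Longrightarrow> shift m v \<in> sector (r + m)"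
  unfolding shift_def lin_ext_def
  by (intro supported_on_sum supported_on_scale) (auto simp: supported_on_def)

text \<open>\<open>Y(e\<^bsup>m\<beta>\<^esup>, z)\<close> is the product of the generating functions of \<open>raising m\<close> in \<open>z\<close> and \<open>lowering m\<close> in
  \<open>z\<^bsup>-1\<^esup>\<close>, of multiplication by \<open>e\<^bsup>m\<beta>\<^esup>\<close>, and of \<open>z\<^bsup>m\<beta>(0)\<^esup>\<close>, which is \<open>z\<^bsup>-mr\<^esup>\<close> on the sector \<open>r\<close>.\<close>

abbreviation raising :: "int \<Rightarrow> int \<Rightarrow> lattice_space \<Rightarrow> lattice_space" where
  "raising m \<equiv> hexp (- 1) (of_int m)"

abbreviation lowering :: "int \<Rightarrow> int \<Rightarrow> lattice_space \<Rightarrow> lattice_space" where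
  "lowering m \<equiv> hexp 1 (- of_int m)"

lemma vertex_op_bvec:
  assumes "K \<ge> wt a"
  shows "vertex_op m n (bvec (r, a)) =
         (\<Sum>k\<in>{0..K}. raising m (k + m * r - n - 1) (lowering m k (bvec (r + m, a))))"
proof -
  define T where "T k = raising m (k + m * r - n - 1) (lowering m k (bvec (r + m, a)))" for k
  have K: "K \<ge> 0" using assms wt_nonneg[of a] by simp
  have "vertex_op m n (bvec (r, a)) = Sum_any (\<lambda>k. T (int k))"
    unfolding vertex_op_def lin_ext_single[OF vector_space_cscale] vertex_op_basis_def prod.case cs.scale_one
    by (intro arg_cong[where f = Sum_any] ext) (simp add: T_def hexp_def Let_def)
  also have "\<dots> = (\<Sum>k\<in>{0..nat K}. T (int k))"
  proof (rule Sum_any.expand_superset)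
    show "{k. T (int k) \<noteq> 0} \<subseteq> {0..nat K}"
    proof
      fix k assume "k \<in> {k. T (int k) \<noteq> 0}"
      hence "\<not> int k > wt a" unfolding T_def using hexp_bvec_eq_0 by (auto simp: hexp_linear)
      thus "k \<in> {0..nat K}" using assms by auto
    qed
  qed simp
  also have "\<dots> = (\<Sum>k\<in>{0..K}. T k)"
    using K by (intro sum.reindex_bij_witness[of _ nat int]) auto
  finally show ?thesis unfolding T_def .
qed

lemma clinear_vertex_op: "clinear (vertex_op m n)"
  unfolding vertex_op_def by (rule linear_lin_ext[OF vector_space_cscale])

lemmas vertex_op_linear = linear_rule_zero[OF clinear_vertex_op] linear_rule_add[OF clinear_vertex_op]
  linear_rule_scale[OF clinear_vertex_op] linear_rule_diff[OF clinear_vertex_op]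
  linear_rule_sum[OF clinear_vertex_op]

text \<open>The summation bound may be any bound beyond which the annihilating exponential vanishes on the
  given vector; products of vertex operators need a bound common to several terms.\<close>

lemma vertex_op_sector_formula:
  assumes v: "v \<in> sector r" and K: "\<And>k. k > K \<Longrightarrow> lowering m k (shift m v) = 0"
  shows "vertex_op m n v = (\<Sum>k\<in>{0..K}. raising m (k + m * r - n - 1) (lowering m k (shift m v)))"
proof -
  define K' where "K' = Max (insert K (wt ` snd ` Poly_Mapping.keys v))"
  have K': "wt (snd b) \<le> K'" if "b \<in> Poly_Mapping.keys v" for b
    unfolding K'_def using that by (intro Max_ge) auto
  let ?S = "\<lambda>w. \<Sum>k\<in>{0..K'}. raising m (k + m * r - n - 1) (lowering m k (shift m w))"
  have b: "vertex_op m n (bvec b) = ?S (bvec b)" if "b \<in> Poly_Mapping.keys v" for b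
    using vertex_op_bvec[OF K'[OF that], of m n "fst b"] v that
    by (auto simp: supported_on_def shift_single)
  have "vertex_op m n v = (\<Sum>b\<in>Poly_Mapping.keys v. cscale (Poly_Mapping.lookup v b) (vertex_op m n (bvec b)))"
    by (subst lattice_space_expand[of v]) (simp only: vertex_op_linear)
  also have "\<dots> = (\<Sum>b\<in>Poly_Mapping.keys v. cscale (Poly_Mapping.lookup v b) (?S (bvec b)))"
    by (intro sum.cong refl) (simp only: b)
  also have "\<dots> = ?S (\<Sum>b\<in>Poly_Mapping.keys v. cscale (Poly_Mapping.lookup v b) (bvec b))"
    unfolding shift_linear hexp_linear cs.scale_sum_right by (rule sum.swap)
  also have "\<dots> = ?S v" by (simp only: lattice_space_expand[of v, symmetric])
  also have "\<dots> = (\<Sum>k\<in>{0..K}. raising m (k + m * r - n - 1) (lowering m k (shift m v)))"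
    using K by (intro sum.mono_neutral_right) (auto simp: K'_def hexp_linear)
  finally show ?thesis .
qed

lemma bvec_sector: "bvec (r, a) \<in> sector r"
  by (rule supported_on_single) simp

lemma vertex_op_sector:
  assumes "v \<in> sector r"
  shows "vertex_op m n v \<in> sector (r + m)"
proof -
  obtain K where "\<And>k c. k > K \<Longrightarrow> hexp 1 c k (shift m v) = 0"
    using hexp_eventually_0 by metis
  from vertex_op_sector_formula[OF assms this] show ?thesis
    using assms by (simp add: supported_on_sum hexp_sector shift_sector)
qed

text \<open>\<open>(e\<^bsup>m\<beta>\<^esup>)\<^sub>n e\<^bsup>t\<beta>\<^esup> = e\<^bsup>t\<beta>\<^esup> (e\<^bsup>m\<beta>\<^esup>)\<^bsub>n-mt\<^esub>\<close>: this produces the spectral flow.\<close>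

lemma vertex_op_shift: "vertex_op m n (shift t v) = shift t (vertex_op m (n - m * t) v)"
proof -
  have "(\<lambda>v. vertex_op m n (shift t v)) = (\<lambda>v. shift t (vertex_op m (n - m * t) v))"
  proof (rule linear_eq_on_bvec[OF clinear_comp[OF clinear_vertex_op clinear_shift]
        clinear_comp[OF clinear_shift clinear_vertex_op]])
    fix b :: lattice_basis
    obtain r a where b: "b = (r, a)" by force
    show "vertex_op m n (shift t (bvec b)) = shift t (vertex_op m (n - m * t) (bvec b))"
      unfolding b shift_single vertex_op_bvec[OF order.refl] shift_linear
      by (simp add: hexp_shift[symmetric] shift_single algebra_simps)
  qed
  thus ?thesis by (rule fun_cong)
qed

lemma vertex_op_eventually_0: "\<exists>N. \<forall>n\<ge>N. vertex_op m n v = 0"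
proof -
  have "\<forall>n\<ge>wt a + \<bar>m * r\<bar>. vertex_op m n (bvec (r, a)) = 0" for r a
    by (auto simp: vertex_op_bvec[OF order.refl] hexp_neg intro!: sum.neutral)
  hence "\<exists>N. \<forall>n\<ge>N. vertex_op m n (bvec b) = 0" for b by (cases b) blast
  then obtain N where N: "\<And>b n. n \<ge> N b \<Longrightarrow> vertex_op m n (bvec b) = 0" by metis
  have "vertex_op m n v = 0" if "n \<ge> Max (insert 0 (N ` Poly_Mapping.keys v))" for n
  proof -
    have "vertex_op m n (bvec b) = 0" if b: "b \<in> Poly_Mapping.keys v" for b
      using \<open>n \<ge> _\<close> b by (intro N) simp
    thus ?thesis by (subst lattice_space_expand) (simp add: vertex_op_linear)
  qed
  thus ?thesis by blast
qed

text \<open>For \<open>n > 0\<close> the commutator comes from the creating exponential, for \<open>n < 0\<close> from the annihilating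
  one, and for \<open>n = 0\<close> from the multiplication by \<open>e\<^bsup>m\<beta>\<^esup>\<close>.\<close>

lemma beta_vertex_op_sector:
  assumes v: "v \<in> sector r"
  shows "beta n (vertex_op m p v) = vertex_op m p (beta n v) - cscale (of_int m) (vertex_op m (p + n) v)"
proof -
  obtain K0 where K0: "\<And>k c. k > K0 \<Longrightarrow> hexp 1 c k (shift m v) = 0"
    using hexp_eventually_0[of "shift m v"] by metis
  obtain K1 where K1: "\<And>k c. k > K1 \<Longrightarrow> hexp 1 c k (shift m (beta n v)) = 0"
    using hexp_eventually_0[of "shift m (beta n v)"] by metis
  define K where "K = max 0 (max K0 K1) + \<bar>n\<bar>"
  define w where "w = shift m v"
  define A where "A = m * r - p - 1"
  have van: "lowering m k w = 0" if "k > K - \<bar>n\<bar>" for k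
    using that K0 unfolding w_def K_def by simp
  have Yp: "vertex_op m p v = (\<Sum>k\<in>{0..K}. raising m (k + A) (lowering m k w))"
    unfolding w_def using K0 by (subst vertex_op_sector_formula[OF v, of K]) (auto simp: K_def A_def algebra_simps)
  have Ypn: "vertex_op m (p + n) v = (\<Sum>k\<in>{0..K}. raising m (k + A - n) (lowering m k w))"
    unfolding w_def using K0 by (subst vertex_op_sector_formula[OF v, of K]) (auto simp: K_def A_def algebra_simps)
  have Ypb: "vertex_op m p (beta n v) = (\<Sum>k\<in>{0..K}. raising m (k + A) (lowering m k (shift m (beta n v))))"
    using K1 by (subst vertex_op_sector_formula[OF beta_sector[OF v], of K]) (auto simp: K_def A_def algebra_simps)
  consider "n > 0" | "n = 0" | "n < 0" by linarith
  thus ?thesis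
  proof cases
    case 1
    thus ?thesis
      unfolding Yp Ypn Ypb w_def
      by (simp add: beta_linear beta_hexp beta_shift hexp_linear sum_subtractf cs.scale_sum_right sum_negf
          sum.distrib)
  next
    case 2
    thus ?thesis
      unfolding Yp Ypn Ypb w_def
      by (simp add: beta_linear beta_hexp beta_shift hexp_linear sum_subtractf cs.scale_sum_right sum_negf
          sum.distrib)
  next
    case 3
    have "(\<Sum>k\<in>{0..K}. raising m (k + A) (lowering m (k + n) w)) =
          (\<Sum>k\<in>{0 + n..K + n}. raising m (k + A - n) (lowering m k w))"
      by (subst sum_shift_int[symmetric]) (simp add: algebra_simps)
    also have "\<dots> = (\<Sum>k\<in>{0..K + n}. raising m (k + A - n) (lowering m k w))"
      using 3 by (intro sum.mono_neutral_right) (auto simp: hexp_neg hexp_linear)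
    also have "\<dots> = (\<Sum>k\<in>{0..K}. raising m (k + A - n) (lowering m k w))"
      using 3 van by (intro sum.mono_neutral_left) (auto simp: hexp_linear)
    finally have "vertex_op m (p + n) v = (\<Sum>k\<in>{0..K}. raising m (k + A) (lowering m (k + n) w))"
      unfolding Ypn by (rule sym)
    thus ?thesis
      using 3 unfolding Yp Ypb w_def
      by (simp add: beta_linear beta_hexp beta_shift hexp_linear sum_subtractf cs.scale_sum_right sum_negf
          sum.distrib)
  qed
qed

lemma beta_vertex_op:
  "beta n (vertex_op m p v) = vertex_op m p (beta n v) + cscale (- of_int m) (vertex_op m (p + n) v)"
proof -
  have "(\<lambda>v. beta n (vertex_op m p v)) =
        (\<lambda>v. vertex_op m p (beta n v) + cscale (- of_int m) (vertex_op m (p + n) v))"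
  proof (rule linear_eq_on_bvec[OF clinear_comp[OF linear_beta clinear_vertex_op]
        clinear_add_scale[OF clinear_comp[OF clinear_vertex_op linear_beta] clinear_vertex_op]])
    fix b :: lattice_basis
    obtain r a where "b = (r, a)" by force
    thus "beta n (vertex_op m p (bvec b)) =
          vertex_op m p (beta n (bvec b)) + cscale (- of_int m) (vertex_op m (p + n) (bvec b))"
      using beta_vertex_op_sector[OF bvec_sector] by simp
  qed
  thus ?thesis by (rule fun_cong)
qed

section \<open>Products of vertex operators\<close>

text \<open>The coefficient of \<open>z\<^sup>a w\<^sup>b\<close> in the product of the creating exponentials at \<open>z\<close> and \<open>w\<close>, followed on
  the right by the annihilating ones; \<open>K\<close> bounds the degrees in which the latter act nontrivially.\<close>

definition normal_product :: "int \<Rightarrow> int \<Rightarrow> int \<Rightarrow> int \<Rightarrow> int \<Rightarrow> lattice_space \<Rightarrow> lattice_space" where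
  "normal_product K m l a b w = (\<Sum>k\<in>{0..K}. \<Sum>k'\<in>{0..K}.
     raising m (k + a) (raising l (k' + b) (lowering m k (lowering l k' w))))"

definition lowered_to_0 :: "int \<Rightarrow> lattice_space \<Rightarrow> bool" where
  "lowered_to_0 K w \<longleftrightarrow> (\<forall>k>K. \<forall>c. hexp 1 c k w = 0)"

lemma ex_lowered_to_0: "\<exists>K. lowered_to_0 K w"
  unfolding lowered_to_0_def by (rule hexp_eventually_0)

lemma lowering_commute: "lowering m k (lowering l j w) = lowering l j (lowering m k w)"
  by (rule hexp_commute) simp

lemma raising_commute: "raising m k (raising l j w) = raising l j (raising m k w)"
  by (rule hexp_commute) simp

lemma lowering_lowering_eq_0:
  "lowered_to_0 K w \<Longrightarrow> k > K \<or> j > K \<Longrightarrow> hexp 1 c k (hexp 1 d j w) = 0"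
  using hexp_commute[of 1 c k d j w] by (auto simp: lowered_to_0_def hexp_linear)

lemma normal_product_swap: "normal_product K m l a b w = normal_product K l m b a w"
  unfolding normal_product_def
  by (subst sum.swap) (simp add: raising_commute[of m _ l] lowering_commute[of m _ l])

text \<open>The corresponding coefficient of the product of two vertex operators before it is put into
  normal order.\<close>

definition product_expansion :: "int \<Rightarrow> int \<Rightarrow> int \<Rightarrow> int \<Rightarrow> int \<Rightarrow> int \<Rightarrow> lattice_space \<Rightarrow> lattice_space" where
  "product_expansion K' K m l a b w = (\<Sum>k\<in>{0..K'}. \<Sum>k'\<in>{0..K}.
     raising m (k + a) (lowering m k (raising l (k' + b) (lowering l k' w))))"

text \<open>The outer bound \<open>K'\<close> is left variable because putting the product into normal order shifts the
  summation index.\<close>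

lemma vertex_op_product:
  assumes v: "v \<in> sector r" and K: "lowered_to_0 K (shift m (shift l v))"
  shows "\<exists>K2. \<forall>K'\<ge>K2. vertex_op m p (vertex_op l q v) =
     product_expansion K' K m l (m * (r + l) - p - 1) (l * r - q - 1) (shift m (shift l v))"
proof -
  obtain K2 where K2: "\<And>k c. k > K2 \<Longrightarrow> hexp 1 c k (shift m (vertex_op l q v)) = 0"
    using hexp_eventually_0 by metis
  have "vertex_op m p (vertex_op l q v) =
     product_expansion K' K m l (m * (r + l) - p - 1) (l * r - q - 1) (shift m (shift l v))" if "K' \<ge> K2" for K'
  proof -
    have low: "lowering l k (shift l v) = 0" if "k > K" for k
    proof -
      have "shift m (lowering l k (shift l v)) = 0"
        using K that by (simp add: lowered_to_0_def hexp_shift[symmetric])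
      hence "shift (- m) (shift m (lowering l k (shift l v))) = 0" by (simp add: shift_linear)
      thus ?thesis by (simp add: shift_shift shift_0)
    qed
    have inner: "vertex_op l q v = (\<Sum>k\<in>{0..K}. raising l (k + l * r - q - 1) (lowering l k (shift l v)))"
      by (rule vertex_op_sector_formula[OF v low])
    have outer: "vertex_op m p (vertex_op l q v) =
      (\<Sum>k\<in>{0..K'}. raising m (k + m * (r + l) - p - 1) (lowering m k (shift m (vertex_op l q v))))"
      by (rule vertex_op_sector_formula[OF vertex_op_sector[OF v]]) (use K2 that in simp)
    show ?thesis
      unfolding outer unfolding inner product_expansion_def
      by (simp add: hexp_linear shift_linear hexp_shift[symmetric] algebra_simps)
  qed
  thus ?thesis by blast
qed

text \<open>For \<open>ml = -1\<close>: \<open>Y(e\<^bsup>m\<beta>\<^esup>, z) Y(e\<^bsup>l\<beta>\<^esup>, w) = (z - w) :Y(e\<^bsup>m\<beta>\<^esup>, z) Y(e\<^bsup>l\<beta>\<^esup>, w):\<close>.\<close>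

lemma product_expansion_opposite:
  assumes ml: "m * l = - 1" and K: "lowered_to_0 K w" and K': "K' > K"
  shows "product_expansion K' K m l a b w = normal_product K m l a b w - normal_product K m l (a + 1) (b - 1) w"
proof -
  have c: "of_int 1 * (- of_int m) * of_int l = (1 :: complex)"
    using arg_cong[OF ml, of "of_int :: int \<Rightarrow> complex"] by simp
  have ex: "lowering m k (raising l j u) = raising l j (lowering m k u) - raising l (j - 1) (lowering m (k - 1) u)"
    for k j u using hexp_exchange[OF _ c, of k j u] by simp
  let ?X = "\<lambda>k k'. raising m (k + a) (raising l (k' + b) (lowering m k (lowering l k' w)))"
  let ?Y = "\<lambda>k k'. raising m (k + (a + 1)) (raising l (k' + (b - 1)) (lowering m k (lowering l k' w)))"
  have "product_expansion K' K m l a b w =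
     (\<Sum>k\<in>{0..K'}. \<Sum>k'\<in>{0..K}. ?X k k') - (\<Sum>k\<in>{0..K'}. \<Sum>k'\<in>{0..K}. ?Y (k - 1) k')"
    unfolding product_expansion_def ex by (simp add: hexp_linear sum_subtractf algebra_simps)
  also have "(\<Sum>k\<in>{0..K'}. \<Sum>k'\<in>{0..K}. ?X k k') = normal_product K m l a b w"
    unfolding normal_product_def using K K'
    by (intro sum.mono_neutral_right) (auto intro!: sum.neutral simp: lowering_lowering_eq_0 hexp_linear)
  also have "(\<Sum>k\<in>{0..K'}. \<Sum>k'\<in>{0..K}. ?Y (k - 1) k') = (\<Sum>k\<in>{0 + - 1..K' + - 1}. \<Sum>k'\<in>{0..K}. ?Y k k')"
    by (subst sum_shift_int[symmetric]) simp
  also have "\<dots> = normal_product K m l (a + 1) (b - 1) w"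
    unfolding normal_product_def using K K'
    by (intro sum.mono_neutral_right)
       (auto intro!: sum.neutral simp: lowering_lowering_eq_0 hexp_linear hexp_neg)
  finally show ?thesis .
qed

text \<open>For \<open>ml = 1\<close>: \<open>(z - w) Y(e\<^bsup>m\<beta>\<^esup>, z) Y(e\<^bsup>l\<beta>\<^esup>, w) = :Y(e\<^bsup>m\<beta>\<^esup>, z) Y(e\<^bsup>l\<beta>\<^esup>, w):\<close>.\<close>

lemma product_expansion_same:
  assumes ml: "m * l = 1" and K: "lowered_to_0 K w" and K': "K' > K"
  shows "normal_product K m l a b w = product_expansion K' K m l a b w - product_expansion (K' - 1) K m l (a + 1) (b - 1) w"
proof -
  have c: "of_int (- 1) * (of_int l) * (- of_int m) = (1 :: complex)"
    using arg_cong[OF ml, of "of_int :: int \<Rightarrow> complex"] by (simp add: mult.commute)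
  have ex: "raising l j (lowering m k u) = lowering m k (raising l j u) - lowering m (k - 1) (raising l (j - 1) u)"
    for k j u using hexp_exchange[OF _ c, of j k u] by simp
  let ?X = "\<lambda>a b k k'. raising m (k + a) (lowering m k (raising l (k' + b) (lowering l k' w)))"
  have "normal_product K m l a b w = (\<Sum>k\<in>{0..K'}. \<Sum>k'\<in>{0..K}.
     raising m (k + a) (raising l (k' + b) (lowering m k (lowering l k' w))))"
    unfolding normal_product_def using K K'
    by (intro sum.mono_neutral_left) (auto intro!: sum.neutral simp: lowering_lowering_eq_0 hexp_linear)
  also have "\<dots> = (\<Sum>k\<in>{0..K'}. \<Sum>k'\<in>{0..K}. ?X a b k k')
     - (\<Sum>k\<in>{0..K'}. \<Sum>k'\<in>{0..K}. ?X (a + 1) (b - 1) (k - 1) k')"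
    unfolding ex by (simp add: hexp_linear sum_subtractf algebra_simps)
  also have "(\<Sum>k\<in>{0..K'}. \<Sum>k'\<in>{0..K}. ?X (a + 1) (b - 1) (k - 1) k')
     = (\<Sum>k\<in>{0 + - 1..K' + - 1}. \<Sum>k'\<in>{0..K}. ?X (a + 1) (b - 1) k k')"
    by (subst sum_shift_int[symmetric]) simp
  also have "\<dots> = product_expansion (K' - 1) K m l (a + 1) (b - 1) w"
    unfolding product_expansion_def
    by (intro sum.mono_neutral_right) (auto intro!: sum.neutral simp: hexp_linear hexp_neg)
  finally show ?thesis unfolding product_expansion_def .
qed

lemma vertex_op_product_opposite:
  assumes v: "v \<in> sector r" and ml: "m * l = - 1" and K: "lowered_to_0 K v"
  shows "vertex_op m p (vertex_op l q v) =
     normal_product K m l (m * r - p - 2) (l * r - q - 1) v - normal_product K m l (m * r - p - 1) (l * r - q - 2) v"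
proof -
  have "m = - l" using ml by (auto simp: zmult_eq_neg1_iff)
  hence w: "shift m (shift l v) = v" by (simp add: shift_shift shift_0)
  from vertex_op_product[OF v, of K m l p q] K w
  obtain K2 where "\<And>K'. K' \<ge> K2 \<Longrightarrow> vertex_op m p (vertex_op l q v) =
     product_expansion K' K m l (m * (r + l) - p - 1) (l * r - q - 1) v" by auto
  from this[of "max K2 (K + 1)"] product_expansion_opposite[OF ml K, of "max K2 (K + 1)"]
  have *: "vertex_op m p (vertex_op l q v) =
    normal_product K m l (m * (r + l) - p - 1) (l * r - q - 1) v - normal_product K m l (m * (r + l) - p - 1 + 1) (l * r - q - 1 - 1) v"
    by simp
  have e: "m * (r + l) - p - 1 = m * r - p - 2" "m * r - p - 2 + 1 = m * r - p - 1" "l * r - q - 1 - 1 = l * r - q - 2"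
    using ml by (simp_all add: algebra_simps)
  show ?thesis using * unfolding e .
qed

lemma vertex_op_anticommute:
  assumes ml: "m * l = - 1"
  shows "vertex_op m p (vertex_op l q v) = - vertex_op l q (vertex_op m p v)"
proof -
  have "(\<lambda>v. vertex_op m p (vertex_op l q v)) = (\<lambda>v. cscale (- 1) (vertex_op l q (vertex_op m p v)))"
  proof (rule linear_eq_on_bvec[of cscale])
    show "clinear (\<lambda>v. vertex_op m p (vertex_op l q v))"
      by (rule clinear_comp[OF clinear_vertex_op clinear_vertex_op])
    show "clinear (\<lambda>v. cscale (- 1) (vertex_op l q (vertex_op m p v)))"
      by (rule clinearI) (simp_all add: vertex_op_linear cs.scale_right_distrib)
    fix b :: lattice_basis
    obtain r a where b: "b = (r, a)" by force
    obtain K where K: "lowered_to_0 K (bvec b)" using ex_lowered_to_0 by blast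
    have lm: "l * m = - 1" using ml by (simp add: mult.commute)
    have s: "bvec b \<in> sector r" by (simp add: b bvec_sector)
    show "vertex_op m p (vertex_op l q (bvec b)) = cscale (- 1) (vertex_op l q (vertex_op m p (bvec b)))"
      unfolding vertex_op_product_opposite[OF s ml K] vertex_op_product_opposite[OF s lm K]
      by (simp add: normal_product_swap[of K l m])
  qed
  thus ?thesis by (simp add: fun_eq_iff)
qed

text \<open>Both products of \<open>Y(e\<^bsup>m\<beta>\<^esup>, z)\<close> and \<open>Y(e\<^bsup>m\<beta>\<^esup>, w)\<close>, multiplied by \<open>z - w\<close>, give the same normally
  ordered product up to sign, so \<open>z - w\<close> annihilates the anticommutator.\<close>

lemma vertex_op_anticommutator_step:
  assumes mm: "m * m = 1"
  shows "vertex_op m p (vertex_op m q v) + vertex_op m q (vertex_op m p v) =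
         vertex_op m (p - 1) (vertex_op m (q + 1) v) + vertex_op m (q + 1) (vertex_op m (p - 1) v)"
proof -
  have "(\<lambda>v. vertex_op m p (vertex_op m q v) + vertex_op m q (vertex_op m p v)) =
     (\<lambda>v. vertex_op m (p - 1) (vertex_op m (q + 1) v) + vertex_op m (q + 1) (vertex_op m (p - 1) v))"
  proof (rule linear_eq_on_bvec[of cscale])
    show "clinear (\<lambda>v. vertex_op m p (vertex_op m q v) + vertex_op m q (vertex_op m p v))" for p q
      by (rule clinearI) (simp_all add: vertex_op_linear cs.scale_right_distrib)
    thus "clinear (\<lambda>v. vertex_op m (p - 1) (vertex_op m (q + 1) v) + vertex_op m (q + 1) (vertex_op m (p - 1) v))" .
    fix b :: lattice_basis
    obtain r a where b: "b = (r, a)" by force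
    define v where "v = bvec b"
    define w where "w = shift m (shift m v)"
    obtain K where K: "lowered_to_0 K w" using ex_lowered_to_0 by blast
    have s: "v \<in> sector r" by (simp add: v_def b bvec_sector)
    have step: "normal_product K m m (m * r - p) (m * r - q - 1) w =
      vertex_op m p (vertex_op m q v) - vertex_op m (p - 1) (vertex_op m (q + 1) v)" for p q
    proof -
      obtain K2 where K2: "\<And>K'. K' \<ge> K2 \<Longrightarrow> vertex_op m p (vertex_op m q v) =
         product_expansion K' K m m (m * (r + m) - p - 1) (m * r - q - 1) w"
        using vertex_op_product[OF s, of K m m p q] K unfolding w_def by auto
      obtain K3 where K3: "\<And>K'. K' \<ge> K3 \<Longrightarrow> vertex_op m (p - 1) (vertex_op m (q + 1) v) =
         product_expansion K' K m m (m * (r + m) - (p - 1) - 1) (m * r - (q + 1) - 1) w"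
        using vertex_op_product[OF s, of K m m "p - 1" "q + 1"] K unfolding w_def by auto
      define K' where "K' = max (K2 + 1) (max (K3 + 1) (K + 1))"
      have e: "m * (r + m) - p - 1 = m * r - p" "m * (r + m) - (p - 1) - 1 = m * r - p + 1"
        "m * r - (q + 1) - 1 = m * r - q - 1 - 1"
        using mm by (simp_all add: algebra_simps)
      show ?thesis
        using K2[of K'] K3[of "K' - 1"] product_expansion_same[OF mm K, of K' "m * r - p" "m * r - q - 1"]
        unfolding e by (simp add: K'_def)
    qed
    have "vertex_op m p (vertex_op m q v) - vertex_op m (p - 1) (vertex_op m (q + 1) v) =
          normal_product K m m (m * r - p) (m * r - q - 1) w" by (rule step[symmetric])
    also have "\<dots> = normal_product K m m (m * r - (q + 1)) (m * r - (p - 1) - 1) w"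
      by (subst normal_product_swap) (simp add: algebra_simps)
    also have "\<dots> = vertex_op m (q + 1) (vertex_op m (p - 1) v) - vertex_op m q (vertex_op m p v)"
      using step[of "q + 1" "p - 1"] by simp
    finally show "vertex_op m p (vertex_op m q (bvec b)) + vertex_op m q (vertex_op m p (bvec b)) =
         vertex_op m (p - 1) (vertex_op m (q + 1) (bvec b)) + vertex_op m (q + 1) (vertex_op m (p - 1) (bvec b))"
      unfolding v_def by (simp add: algebra_simps)
  qed
  thus ?thesis by (rule fun_cong)
qed

lemma vertex_op_anticommutator:
  assumes mm: "m * m = 1" and sum: "p + q = p' + q'"
  shows "vertex_op m p (vertex_op m q v) + vertex_op m q (vertex_op m p v) =
         vertex_op m p' (vertex_op m q' v) + vertex_op m q' (vertex_op m p' v)"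
proof -
  define Z where "Z p q = vertex_op m p (vertex_op m q v) + vertex_op m q (vertex_op m p v)" for p q
  have "Z p q = Z (p - int n) (q + int n)" for n p q
  proof (induction n)
    case (Suc n)
    note Suc
    also have "Z (p - int n) (q + int n) = Z (p - int n - 1) (q + int n + 1)"
      unfolding Z_def by (rule vertex_op_anticommutator_step[OF mm])
    also have "\<dots> = Z (p - int (Suc n)) (q + int (Suc n))"
      by (rule arg_cong2[where f = Z]) simp_all
    finally show ?case .
  qed simp
  note Z = this
  have "Z p q = Z p' q'"
  proof (cases "p' \<le> p")
    case True
    have "p - int (nat (p - p')) = p'" "q + int (nat (p - p')) = q'" using True sum by simp_all
    with Z[of p q "nat (p - p')"] show ?thesis by (simp only:)
  next
    case False
    have "p' - int (nat (p' - p)) = p" "q' + int (nat (p' - p)) = q" using False sum by simp_all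
    with Z[of p' q' "nat (p' - p)"] show ?thesis by (simp only:)
  qed
  thus ?thesis by (simp only: Z_def)
qed

section \<open>The sum behind the commutator of \<open>e\<close> and \<open>f\<close>\<close>

text \<open>The two annihilating exponentials are inverse to each other, so collecting the terms of equal total
  degree \<open>N = k + k'\<close> leaves only \<open>N = 0\<close>. The factor \<open>2\<close> in the bound ensures that every nonzero
  term has \<open>N \<le> K\<close>.\<close>

lemma lowering_conv:
  assumes K0: "lowered_to_0 K0 w" and K: "K \<ge> 2 * K0" "K \<ge> 0"
    and G: "\<And>N. clinear (G N)"
  shows "(\<Sum>k\<in>{0..K}. \<Sum>k'\<in>{0..K}. G (k + k') (hexp 1 c k (hexp 1 (- c) k' w))) = G 0 w"
proof -
  let ?X = "\<lambda>k k'. hexp 1 c k (hexp 1 (- c) k' w)"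
  have "(\<Sum>k'\<in>{0..K}. G (k + k') (?X k k')) = (\<Sum>N\<in>{0..K}. G N (?X k (N - k)))" if k: "k \<in> {0..K}" for k
  proof -
    have "(\<Sum>k'\<in>{0..K}. G (k + k') (?X k k')) = (\<Sum>N\<in>{k..K + k}. G N (?X k (N - k)))"
      using sum_shift_int[of "\<lambda>N. G N (?X k (N - k))" k 0 K] by (simp add: add.commute)
    also have "\<dots> = (\<Sum>N\<in>{k..K}. G N (?X k (N - k)))"
    proof (intro sum.mono_neutral_right ballI)
      fix N assume "N \<in> {k..K + k} - {k..K}"
      hence "k > K0 \<or> N - k > K0" using K by auto
      thus "G N (?X k (N - k)) = 0" using K0 by (simp add: lowering_lowering_eq_0 linear_rule_zero[OF G])
    qed (use k in auto)
    also have "\<dots> = (\<Sum>N\<in>{0..K}. G N (?X k (N - k)))"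
      using k by (intro sum.mono_neutral_left) (auto simp: hexp_neg hexp_linear linear_rule_zero[OF G])
    finally show ?thesis .
  qed
  hence "(\<Sum>k\<in>{0..K}. \<Sum>k'\<in>{0..K}. G (k + k') (?X k k')) = (\<Sum>k\<in>{0..K}. \<Sum>N\<in>{0..K}. G N (?X k (N - k)))"
    by (rule sum.cong[OF refl])
  also have "\<dots> = (\<Sum>N\<in>{0..K}. G N (\<Sum>k\<in>{0..K}. ?X k (N - k)))"
    by (subst sum.swap) (simp add: linear_rule_sum[OF G])
  also have "\<dots> = (\<Sum>N\<in>{0..K}. if N = 0 then G 0 w else 0)"
    by (intro sum.cong refl) (auto simp: hexp_inverse linear_rule_zero[OF G])
  also have "\<dots> = G 0 w" using K by (simp add: sum.delta)
  finally show ?thesis .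
qed

text \<open>Summing \<open>:Y\<^sup>+(z) Y\<^sup>-(w):\<close> along a diagonal \<open>a + b = d\<close> puts \<open>w = z\<close>, and a factor \<open>a\<close> puts \<open>w = z\<close>
  after applying \<open>z \<partial>\<^sub>z\<close>. The exponentials at \<open>z\<close> cancel, and what remains are the logarithmic
  derivatives: the creating and the annihilating half of the field \<open>\<Sum>n. \<beta>(n) z\<^bsup>-n\<^esup>\<close>.\<close>

lemma normal_product_weighted_sum:
  fixes r m n :: int and lam mu :: complex
  assumes K0: "lowered_to_0 K0 v" and K: "K \<ge> 2 * K0" "K \<ge> K0" "K \<ge> \<bar>m + n\<bar>"
    and v: "v \<in> sector r"
    and L: "L > K + \<bar>r - m\<bar> + \<bar>r + n\<bar>"
  shows "(\<Sum>i\<in>{1 - L..L}. cscale (lam - mu - 2 * of_int i) (normal_product K 1 (- 1) (r - m + i) (- r - n - i) v)) =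
     cscale (- 2) (beta (m + n) v) + (if m + n = 0 then cscale (lam - mu - 2 * of_int m) v else 0)"
proof -
  define d where "d = - (m + n)"
  \<comment> \<open>\<open>lam - mu - 2 * i = C + 2 * k - 2 * x\<close> in terms of the degree \<open>x = k + (r - m + i)\<close> of the first exponential\<close>
  define C where "C = lam - mu + 2 * of_int (r - m)"
  let ?X = "\<lambda>k k'. lowering 1 k (lowering (- 1) k' v)"
  have inner: "(\<Sum>i\<in>{1 - L..L}. cscale (lam - mu - 2 * of_int i)
      (raising 1 (k + (r - m + i)) (raising (- 1) (k' + (- r - n - i)) (?X k k')))) =
      (if k + k' + d = 0 then cscale (C + 2 * of_int k) (?X k k') else 0)
      + (if k + k' + d > 0 then cscale (- 2) (beta (- (k + k' + d)) (?X k k')) else 0)"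
    if k: "k \<in> {0..K}" and k': "k' \<in> {0..K}" for k k'
  proof -
    let ?u = "?X k k'"
    let ?D = "k + r - m"
    have "(\<Sum>i\<in>{1 - L..L}. cscale (lam - mu - 2 * of_int i)
      (raising 1 (k + (r - m + i)) (raising (- 1) (k' + (- r - n - i)) ?u))) =
      (\<Sum>x\<in>{1 - L + ?D..L + ?D}. cscale (C + 2 * of_int k - 2 * of_int x) (raising 1 x (raising (- 1) (k + k' + d - x) ?u)))"
      by (subst sum_shift_int[symmetric]) (simp add: C_def d_def algebra_simps)
    also have "\<dots> = cscale (C + 2 * of_int k) (\<Sum>x\<in>{1 - L + ?D..L + ?D}. raising 1 x (raising (- 1) (k + k' + d - x) ?u))
      + cscale (- 2) (\<Sum>x\<in>{1 - L + ?D..L + ?D}. cscale (of_int x) (raising 1 x (raising (- 1) (k + k' + d - x) ?u)))"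
      by (simp add: cs.scale_left_diff_distrib sum_subtractf cs.scale_sum_right sum_negf)
    also have "(\<Sum>x\<in>{1 - L + ?D..L + ?D}. raising 1 x (raising (- 1) (k + k' + d - x) ?u)) =
      (if k + k' + d = 0 then ?u else 0)"
      using hexp_inverse[of "- 1" "1 - L + ?D" "k + k' + d" "L + ?D" 1 ?u] L k k' by (auto simp: d_def)
    also have "(\<Sum>x\<in>{1 - L + ?D..L + ?D}. cscale (of_int x) (raising 1 x (raising (- 1) (k + k' + d - x) ?u))) =
      (if k + k' + d > 0 then beta (- (k + k' + d)) ?u else 0)"
      using hexp_log_derivative[of "- 1" "1 - L + ?D" "k + k' + d" "L + ?D" 1 ?u] L k k' by (auto simp: d_def)
    finally show ?thesis by simp
  qed
  have "(\<Sum>i\<in>{1 - L..L}. cscale (lam - mu - 2 * of_int i) (normal_product K 1 (- 1) (r - m + i) (- r - n - i) v)) =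
    (\<Sum>k\<in>{0..K}. \<Sum>k'\<in>{0..K}. \<Sum>i\<in>{1 - L..L}. cscale (lam - mu - 2 * of_int i)
      (raising 1 (k + (r - m + i)) (raising (- 1) (k' + (- r - n - i)) (?X k k'))))"
    unfolding normal_product_def cs.scale_sum_right
    by (subst sum.swap) (rule sum.cong[OF refl], rule sum.swap)
  also have "\<dots> = (\<Sum>k\<in>{0..K}. \<Sum>k'\<in>{0..K}. (if k + k' + d = 0 then cscale (C + 2 * of_int k) (?X k k') else 0)
      + (if k + k' + d > 0 then cscale (- 2) (beta (- (k + k' + d)) (?X k k')) else 0))"
    by (intro sum.cong refl inner)
  also have "\<dots> = (\<Sum>k\<in>{0..K}. \<Sum>k'\<in>{0..K}. if k + k' + d = 0 then cscale (C + 2 * of_int k) (?X k k') else 0)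
      + (\<Sum>k\<in>{0..K}. \<Sum>k'\<in>{0..K}. if k + k' + d > 0 then cscale (- 2) (beta (- (k + k' + d)) (?X k k')) else 0)"
    by (simp only: sum.distrib)
  also have "(\<Sum>k\<in>{0..K}. \<Sum>k'\<in>{0..K}. if k + k' + d > 0 then cscale (- 2) (beta (- (k + k' + d)) (?X k k')) else 0)
     = (if d > 0 then cscale (- 2) (beta (- d) v) else 0)"
  proof -
    define G where "G N u = (if N + d > 0 then cscale (- 2) (beta (- (N + d)) u) else 0)" for N :: int and u
    have lin: "clinear (G N)" for N
      by (rule clinearI) (simp_all add: G_def beta_linear cs.scale_right_distrib)
    have "(\<Sum>k\<in>{0..K}. \<Sum>k'\<in>{0..K}. G (k + k') (hexp 1 (- 1) k (hexp 1 (- (- 1)) k' v))) = G 0 v"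
      by (rule lowering_conv[OF K0 K(1) _ lin]) (use K in simp)
    thus ?thesis by (simp only: G_def of_int_1 of_int_minus minus_minus add_0)
  qed
  also have "(\<Sum>k\<in>{0..K}. \<Sum>k'\<in>{0..K}. if k + k' + d = 0 then cscale (C + 2 * of_int k) (?X k k') else 0) =
     (if d = 0 then cscale C v else 0) + (if d < 0 then cscale (- 2) (beta (- d) v) else 0)"
  proof -
    have "(\<Sum>k'\<in>{0..K}. if k + k' + d = 0 then cscale (C + 2 * of_int k) (?X k k') else 0)
        = cscale (C + 2 * of_int k) (?X k (- d - k))" if k: "k \<in> {0..K}" for k
    proof -
      have "(\<Sum>k'\<in>{0..K}. if k + k' + d = 0 then cscale (C + 2 * of_int k) (?X k k') else 0)
        = (\<Sum>k'\<in>{0..K}. if k' = - d - k then cscale (C + 2 * of_int k) (?X k (- d - k)) else 0)"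
        by (intro sum.cong refl) auto
      moreover have "?X k (- d - k) = 0" if "- d - k \<notin> {0..K}"
      proof (cases "- d - k < 0")
        case False
        hence "- d - k > K0" using that K by auto
        thus ?thesis using K0 by (simp add: lowering_lowering_eq_0)
      qed (simp add: hexp_neg hexp_linear)
      ultimately show ?thesis by (auto simp: sum.delta)
    qed
    hence "(\<Sum>k\<in>{0..K}. \<Sum>k'\<in>{0..K}. if k + k' + d = 0 then cscale (C + 2 * of_int k) (?X k k') else 0) =
      (\<Sum>k\<in>{0..K}. cscale (C + 2 * of_int k) (?X k (- d - k)))"
      by (rule sum.cong[OF refl])
    also have "\<dots> = cscale C (\<Sum>k\<in>{0..K}. ?X k (- d - k)) + cscale 2 (\<Sum>k\<in>{0..K}. cscale (of_int k) (?X k (- d - k)))"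
      by (simp add: cs.scale_left_distrib sum.distrib cs.scale_sum_right)
    also have "\<dots> = (if d = 0 then cscale C v else 0) + (if d < 0 then cscale (- 2) (beta (- d) v) else 0)"
      using hexp_inverse[of 1 0 "- d" K "- 1" v] hexp_log_derivative[of 1 0 "- d" K "- 1" v] K
      by (auto simp: d_def)
    finally show ?thesis .
  qed
  also have "(if d = 0 then cscale C v else 0) + (if d < 0 then cscale (- 2) (beta (- d) v) else 0)
       + (if d > 0 then cscale (- 2) (beta (- d) v) else 0) =
     cscale (- 2) (beta (m + n) v) + (if m + n = 0 then cscale (lam - mu - 2 * of_int m) v else 0)"
  proof (cases "m + n = 0")
    case True
    have "beta 0 v = cscale (- of_int r) v"
    proof -
      have "beta 0 (bvec b) = cscale (- of_int r) (bvec b)" if "b \<in> Poly_Mapping.keys v" for b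
        using that v by (cases b) (auto simp: supported_on_def beta_zero cscale_single)
      hence "(\<Sum>b\<in>Poly_Mapping.keys v. cscale (Poly_Mapping.lookup v b) (beta 0 (bvec b))) =
             (\<Sum>b\<in>Poly_Mapping.keys v. cscale (Poly_Mapping.lookup v b) (cscale (- of_int r) (bvec b)))"
        by (intro sum.cong) auto
      thus ?thesis
        by (subst (1 2) lattice_space_expand)
           (simp only: beta_linear cs.scale_sum_right cs.scale_left_commute)
    qed
    hence b: "cscale (- 2) (beta (m + n) v) = cscale (2 * of_int r) v" using True by simp
    have "d = 0" using True by (simp add: d_def)
    moreover have "C = 2 * of_int r + (lam - mu - 2 * of_int m)" by (simp add: C_def)
    ultimately show ?thesis
      unfolding b using True by (simp only: cs.scale_left_distrib) simp
  next
    case False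
    have e: "- d = m + n" by (simp add: d_def)
    from False have "d > 0 \<or> d < 0" by (auto simp: d_def)
    thus ?thesis unfolding e using False by auto
  qed
  finally show ?thesis .
qed

text \<open>The product \<open>Y\<^sup>+ Y\<^sup>-\<close> has the coefficients \<open>N (i - 1) - N i\<close> of \<open>z - w\<close> times a normally ordered
  product. Summation by parts replaces the quadratic weight \<open>P i = (\<lambda> - i)(\<mu> - 1 + i)\<close> by its
  difference \<open>P (i + 1) - P i = \<lambda> - \<mu> - 2i\<close>. The range starts at \<open>1 - L\<close> because it consists of the
  \<open>i\<close> for which both \<open>i\<close> and \<open>1 - i\<close> lie in \<open>{-L..L}\<close>.\<close>

lemma vertex_op_weighted_sum:
  fixes m n :: int and lam mu :: complex
  shows "\<exists>L0. \<forall>L\<ge>L0. (\<Sum>i\<in>{1 - L..L}. cscale ((lam - of_int i) * (mu - 1 + of_int i))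
       (vertex_op 1 (m - i - 1) (vertex_op (- 1) (n + i - 2) (bvec b)))) =
     cscale (- 2) (beta (m + n) (bvec b)) + (if m + n = 0 then cscale (lam - mu - 2 * of_int m) (bvec b) else 0)"
proof -
  define v :: lattice_space where "v = bvec b"
  obtain r a where b: "b = (r, a)" by force
  have v: "v \<in> sector r" by (simp add: v_def b bvec_sector)
  obtain K0 where K0: "lowered_to_0 K0 v" using ex_lowered_to_0 by blast
  define K where "K = max (2 * K0) (max K0 \<bar>m + n\<bar>)"
  have K: "lowered_to_0 K v" using K0 by (auto simp: lowered_to_0_def K_def)
  define N where "N i = normal_product K 1 (- 1) (r - m + i) (- r - n - i) v" for i
  define P where "P i = (lam - of_int i) * (mu - 1 + of_int i)" for i
  define L0 where "L0 = K + \<bar>r - m\<bar> + \<bar>r + n\<bar> + 1"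
  have N0: "N i = 0" if "\<bar>i\<bar> \<ge> L0" for i
  proof -
    have "raising 1 (k + (r - m + i)) (raising (- 1) (k' + (- r - n - i)) u) = 0"
      if "k \<in> {0..K}" "k' \<in> {0..K}" for k k' u
    proof (cases "i \<ge> 0")
      case True
      hence "k' + (- r - n - i) < 0" using \<open>\<bar>i\<bar> \<ge> L0\<close> that by (auto simp: L0_def)
      thus ?thesis by (simp add: hexp_neg hexp_linear)
    next
      case False
      hence "k + (r - m + i) < 0" using \<open>\<bar>i\<bar> \<ge> L0\<close> that by (auto simp: L0_def)
      thus ?thesis by (simp add: hexp_neg hexp_linear)
    qed
    thus ?thesis unfolding N_def normal_product_def by (intro sum.neutral ballI) auto
  qed
  have "(\<Sum>i\<in>{1 - L..L}. cscale (P i) (vertex_op 1 (m - i - 1) (vertex_op (- 1) (n + i - 2) v))) =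
     cscale (- 2) (beta (m + n) v) + (if m + n = 0 then cscale (lam - mu - 2 * of_int m) v else 0)"
    if L: "L \<ge> L0" for L
  proof -
    \<comment> \<open>summation by parts\<close>
    define g where "g i = cscale (P i) (N (i - 1))" for i
    have "L \<ge> 1" using L by (simp add: L0_def K_def)
    have prod: "vertex_op 1 (m - i - 1) (vertex_op (- 1) (n + i - 2) v) = N (i - 1) - N i" for i
    proof -
      have e: "1 * r - (m - i - 1) - 2 = r - m + (i - 1)" "- 1 * r - (n + i - 2) - 1 = - r - n - (i - 1)"
        "1 * r - (m - i - 1) - 1 = r - m + i" "- 1 * r - (n + i - 2) - 2 = - r - n - i" by simp_all
      show ?thesis
        using vertex_op_product_opposite[OF v _ K, of 1 "- 1" "m - i - 1" "n + i - 2"]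
        unfolding e N_def by simp
    qed
    have P1: "P (i + 1) = P i + (lam - mu - 2 * of_int i)" for i by (simp add: P_def algebra_simps)
    have "cscale (P i) (vertex_op 1 (m - i - 1) (vertex_op (- 1) (n + i - 2) v)) =
       cscale (lam - mu - 2 * of_int i) (N i) + (g i - g (i + 1))" for i
      unfolding prod g_def P1 cs.scale_right_diff_distrib cs.scale_left_distrib by simp
    moreover have "g (1 - L) = 0" "g (L + 1) = 0"
      using N0[of "- L"] N0[of L] L \<open>L \<ge> 1\<close> by (simp_all add: g_def)
    ultimately have "(\<Sum>i\<in>{1 - L..L}. cscale (P i) (vertex_op 1 (m - i - 1) (vertex_op (- 1) (n + i - 2) v))) =
       (\<Sum>i\<in>{1 - L..L}. cscale (lam - mu - 2 * of_int i) (N i))"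
      using sum_telescope_int[of "1 - L" L g] \<open>L \<ge> 1\<close> by (simp add: sum.distrib)
    also have "(\<Sum>i\<in>{1 - L..L}. cscale (lam - mu - 2 * of_int i) (N i)) =
      cscale (- 2) (beta (m + n) v) + (if m + n = 0 then cscale (lam - mu - 2 * of_int m) v else 0)"
      unfolding N_def by (rule normal_product_weighted_sum[OF K0 _ _ _ v]) (use L in \<open>auto simp: K_def L0_def\<close>)
    finally show ?thesis by simp
  qed
  thus ?thesis unfolding v_def P_def by blast
qed

section \<open>Operators on the tensor product\<close>

lemma lookup_pscale:
  assumes "vector_space scale"
  shows "Poly_Mapping.lookup (pscale scale c p) b = scale c (Poly_Mapping.lookup p b)"
proof -
  interpret vector_space scale by fact
  show ?thesis by (auto simp: pscale_def map.rep_eq when_def)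
qed

lemma vector_space_pscale:
  fixes scale :: "complex \<Rightarrow> 'v::ab_group_add \<Rightarrow> 'v"
  assumes "vector_space scale"
  shows "vector_space (pscale scale :: complex \<Rightarrow> ('b \<Rightarrow>\<^sub>0 'v) \<Rightarrow> _)"
proof -
  interpret vector_space scale by fact
  show ?thesis
    by unfold_locales
       (auto intro!: poly_mapping_eqI
          simp: lookup_add lookup_pscale[OF assms] scale_right_distrib scale_left_distrib)
qed

text \<open>In the vertex algebra sense: \<open>\<Sum>i. \<Psi>(i - 1/2) z\<^bsup>-i\<^esup>\<close> applied to a vector is a Laurent series.\<close>

definition vertex_field ::
  "(complex \<Rightarrow> 'f::ab_group_add \<Rightarrow> 'f) \<Rightarrow> (rat \<Rightarrow> 'f \<Rightarrow> 'f) \<Rightarrow> bool" where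
  "vertex_field scale \<Psi> \<longleftrightarrow>
     (\<forall>i::int. Vector_Spaces.linear scale scale (\<Psi> (of_int i - 1/2))) \<and>
     (\<forall>x. \<exists>N::int. \<forall>i\<ge>N. \<Psi> (of_int i - 1/2) x = 0)"

locale complex_vector_space = vector_space scale
  for scale :: "complex \<Rightarrow> 'f::ab_group_add \<Rightarrow> 'f"
begin

lemma vs: "vector_space scale" by unfold_locales

sublocale ts: vector_space "pscale scale :: complex \<Rightarrow> ('b \<Rightarrow>\<^sub>0 'f) \<Rightarrow> _"
  by (rule vector_space_pscale[OF vs])

abbreviation ten :: "'f \<Rightarrow> lattice_space \<Rightarrow> 'f tensor_space" where
  "ten \<equiv> tensor scale"

abbreviation tscale :: "complex \<Rightarrow> 'f tensor_space \<Rightarrow> 'f tensor_space" where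
  "tscale \<equiv> pscale scale"

abbreviation tlinear :: "('f tensor_space \<Rightarrow> 'f tensor_space) \<Rightarrow> bool" where
  "tlinear \<equiv> Vector_Spaces.linear tscale tscale"

abbreviation tmap :: "('f \<Rightarrow> 'f) \<Rightarrow> (lattice_space \<Rightarrow> lattice_space) \<Rightarrow> 'f tensor_space \<Rightarrow> 'f tensor_space" where
  "tmap \<equiv> tensor_op scale"

lemma tlinearI:
  assumes "\<And>x y. A (x + y) = A x + A y" "\<And>c x. A (tscale c x) = tscale c (A x)"
  shows "tlinear A"
  using assms by unfold_locales

lemma tlinear_comp: "tlinear A \<Longrightarrow> tlinear B \<Longrightarrow> tlinear (\<lambda>v. A (B v))"
  by (rule tlinearI) (simp_all add: linear_rule_add linear_rule_scale)

lemma tlinear_add: "tlinear A \<Longrightarrow> tlinear B \<Longrightarrow> tlinear (\<lambda>v. A v + B v)"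
  by (rule tlinearI) (simp_all add: linear_rule_add linear_rule_scale ts.scale_right_distrib)

lemma tlinear_diff: "tlinear A \<Longrightarrow> tlinear B \<Longrightarrow> tlinear (\<lambda>v. A v - B v)"
  by (rule tlinearI) (simp_all add: linear_rule_add linear_rule_scale ts.scale_right_diff_distrib)

lemma tlinear_scale: "tlinear A \<Longrightarrow> tlinear (\<lambda>v. tscale c (A v))"
  by (rule tlinearI)
     (simp_all add: linear_rule_add linear_rule_scale ts.scale_right_distrib mult.commute)

lemma tlinear_id: "tlinear (\<lambda>v. v)"
  by (rule tlinearI) auto

lemma tlinear_0: "tlinear (\<lambda>v. 0)"
  by (rule tlinearI) auto

lemma lookup_tensor: "Poly_Mapping.lookup (ten x y) b = scale (Poly_Mapping.lookup y b) x"
  by (auto simp: tensor_def map.rep_eq when_def)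

lemma tensor_rules:
  shows tensor_0_left: "ten 0 y = 0"
    and tensor_0_right: "ten x 0 = 0"
    and tensor_add_left: "ten (x + x') y = ten x y + ten x' y"
    and tensor_add_right: "ten x (y + y') = ten x y + ten x y'"
    and tensor_scale_left: "ten (scale c x) y = tscale c (ten x y)"
    and tensor_scale_right: "ten x (cscale c y) = tscale c (ten x y)"
    and tensor_minus_left: "ten (- x) y = - ten x y"
    and tensor_minus_right: "ten x (- y) = - ten x y"
    and tensor_diff_right: "ten x (y - y') = ten x y - ten x y'"
  by (auto intro!: poly_mapping_eqI simp: lookup_tensor lookup_add lookup_minus lookup_pscale[OF vs]
      scale_right_distrib scale_left_distrib scale_left_diff_distrib mult.commute)

lemma tensor_sum_left: "ten (sum g S) y = (\<Sum>i\<in>S. ten (g i) y)"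
  by (induction S rule: infinite_finite_induct) (simp_all add: tensor_rules)

lemma tensor_sum_right: "ten x (sum g S) = (\<Sum>i\<in>S. ten x (g i))"
  by (induction S rule: infinite_finite_induct) (simp_all add: tensor_rules)

lemma tensor_bvec: "ten x (bvec b) = Poly_Mapping.single b x"
  by (auto intro!: poly_mapping_eqI simp: lookup_tensor lookup_single when_def)

lemma tensor_expand: "v = (\<Sum>b\<in>Poly_Mapping.keys v. ten (Poly_Mapping.lookup v b) (bvec b))"
  by (rule poly_mapping_eqI)
     (auto simp: tensor_bvec lookup_sum lookup_single when_def in_keys_iff cong: if_cong)

lemma tlinear_tensor_op:
  assumes A: "Vector_Spaces.linear scale scale A"
  shows "tlinear (tmap A B)"
proof -
  have sup: "tmap A B p = (\<Sum>b\<in>S. ten (A (Poly_Mapping.lookup p b)) (B (bvec b)))"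
    if "finite S" "Poly_Mapping.keys p \<subseteq> S" for S and p :: "'f tensor_space"
    unfolding tensor_op_def using that
    by (intro sum.mono_neutral_left) (auto simp: in_keys_iff linear_rule_zero[OF A] tensor_rules)
  show ?thesis
  proof (rule tlinearI)
    fix p q :: "'f tensor_space"
    let ?S = "Poly_Mapping.keys p \<union> Poly_Mapping.keys q"
    show "tmap A B (p + q) = tmap A B p + tmap A B q"
      using keys_add[of p q]
      by (simp add: sup[of ?S] lookup_add linear_rule_add[OF A] tensor_rules sum.distrib)
  next
    fix c and p :: "'f tensor_space"
    have "Poly_Mapping.keys (tscale c p) \<subseteq> Poly_Mapping.keys p"
      by (auto simp: in_keys_iff lookup_pscale[OF vs])
    thus "tmap A B (tscale c p) = tscale c (tmap A B p)"
      by (simp add: sup[of "Poly_Mapping.keys p"] lookup_pscale[OF vs] linear_rule_scale[OF A]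
          tensor_rules ts.scale_sum_right)
  qed
qed

lemma linear_id_scale: "Vector_Spaces.linear scale scale id"
  by unfold_locales auto

lemma clinear_id: "clinear id"
  by (rule clinearI) auto

lemma tlinear_eqI:
  assumes "tlinear A" "tlinear B" "\<And>x b. A (ten x (bvec b)) = B (ten x (bvec b))"
  shows "A v = B v"
  by (subst (1 2) tensor_expand)
     (simp only: linear_rule_sum[OF assms(1)] linear_rule_sum[OF assms(2)] assms(3))

subsection \<open>Currents\<close>

context
  fixes \<Psi> :: "rat \<Rightarrow> 'f \<Rightarrow> 'f"
  assumes field: "vertex_field scale \<Psi>"
begin

lemma field_linear: "Vector_Spaces.linear scale scale (\<Psi> (of_int i - 1/2))"
  using field by (simp add: vertex_field_def)

lemmas field_rules = linear_rule_zero[OF field_linear] linear_rule_add[OF field_linear]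
  linear_rule_scale[OF field_linear] linear_rule_sum[OF field_linear] linear_rule_diff[OF field_linear]

lemma tlinear_current_term: "tlinear (\<lambda>v. current_term scale \<Psi> \<epsilon> a m v i)"
  unfolding current_term_def by (intro tlinear_scale tlinear_tensor_op field_linear)

lemma current_term_tensor:
  "current_term scale \<Psi> \<epsilon> a m (ten x y) i =
   tscale (a - of_int i) (ten (\<Psi> (of_int i - 1/2) x) (vertex_op \<epsilon> (m - i - 1) y))"
  unfolding current_term_def by (simp add: tensor_op_tensor[OF field_linear clinear_vertex_op])

text \<open>Sums over modes are turned into finite sums over \<open>{-L..L}\<close>. Every \<open>L\<close> that is large enough works,
  so several such sums can be brought to the same range.\<close>

definition term_bound :: "int \<Rightarrow> int \<Rightarrow> 'f \<Rightarrow> lattice_space \<Rightarrow> int \<Rightarrow> bool" where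
  "term_bound \<epsilon> m x y L \<longleftrightarrow>
     (\<forall>i. \<bar>i\<bar> > L \<longrightarrow> \<Psi> (of_int i - 1/2) x = 0 \<or> vertex_op \<epsilon> (m - i - 1) y = 0)"

lemma ex_term_bound: "\<exists>L. term_bound \<epsilon> m x y L"
proof -
  obtain N where N: "\<And>i. i \<ge> N \<Longrightarrow> \<Psi> (of_int i - 1/2) x = 0"
    using field unfolding vertex_field_def by blast
  obtain N' where N': "\<And>n. n \<ge> N' \<Longrightarrow> vertex_op \<epsilon> n y = 0"
    using vertex_op_eventually_0 by metis
  have "term_bound \<epsilon> m x y (\<bar>N\<bar> + \<bar>N'\<bar> + \<bar>m\<bar> + 1)"
    unfolding term_bound_def using N N' by (smt (verit))
  thus ?thesis by blast
qed

lemma term_bound_eventually: "eventually (term_bound \<epsilon> m x y) at_top"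
proof -
  obtain L where "term_bound \<epsilon> m x y L" using ex_term_bound by blast
  hence "\<forall>L'\<ge>L. term_bound \<epsilon> m x y L'" by (auto simp: term_bound_def)
  thus ?thesis by (auto simp: eventually_at_top_linorder)
qed

lemma finite_current_term: "finite {i. current_term scale \<Psi> \<epsilon> a m v i \<noteq> 0}"
proof -
  have t: "finite {i. current_term scale \<Psi> \<epsilon> a m (ten x y) i \<noteq> 0}" for x y
  proof -
    obtain L where L: "term_bound \<epsilon> m x y L" using ex_term_bound by blast
    have "{i. current_term scale \<Psi> \<epsilon> a m (ten x y) i \<noteq> 0} \<subseteq> {- L..L}"
    proof
      fix i assume "i \<in> {i. current_term scale \<Psi> \<epsilon> a m (ten x y) i \<noteq> 0}"
      hence "\<not> \<bar>i\<bar> > L"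
        using L by (auto simp: term_bound_def current_term_tensor tensor_rules)
      thus "i \<in> {- L..L}" by auto
    qed
    thus ?thesis by (rule finite_subset) simp
  qed
  have "{i. current_term scale \<Psi> \<epsilon> a m v i \<noteq> 0} \<subseteq>
     (\<Union>b\<in>Poly_Mapping.keys v. {i. current_term scale \<Psi> \<epsilon> a m (ten (Poly_Mapping.lookup v b) (bvec b)) i \<noteq> 0})"
    (is "?A \<subseteq> ?B")
  proof
    fix i assume "i \<in> ?A"
    hence "(\<Sum>b\<in>Poly_Mapping.keys v. current_term scale \<Psi> \<epsilon> a m (ten (Poly_Mapping.lookup v b) (bvec b)) i) \<noteq> 0"
      by (simp add: linear_rule_sum[OF tlinear_current_term, symmetric] tensor_expand[of v, symmetric])
    thus "i \<in> ?B" by (auto dest: sum.not_neutral_contains_not_neutral)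
  qed
  thus ?thesis by (rule finite_subset) (simp add: t)
qed

lemma tlinear_current: "tlinear (current scale \<Psi> \<epsilon> a m)"
proof (rule tlinearI)
  fix v w
  show "current scale \<Psi> \<epsilon> a m (v + w) = current scale \<Psi> \<epsilon> a m v + current scale \<Psi> \<epsilon> a m w"
    unfolding current_def linear_rule_add[OF tlinear_current_term]
    by (rule Sum_any.distrib) (rule finite_current_term)+
next
  fix c v
  have "current_term scale \<Psi> \<epsilon> a m (tscale c v) = (\<lambda>i. tscale c (current_term scale \<Psi> \<epsilon> a m v i))"
    by (rule ext) (rule linear_rule_scale[OF tlinear_current_term])
  hence "current scale \<Psi> \<epsilon> a m (tscale c v) = Sum_any (\<lambda>i. tscale c (current_term scale \<Psi> \<epsilon> a m v i))"
    by (simp add: current_def)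
  also have "\<dots> = (\<Sum>i\<in>{i. current_term scale \<Psi> \<epsilon> a m v i \<noteq> 0}. tscale c (current_term scale \<Psi> \<epsilon> a m v i))"
    by (rule Sum_any.expand_superset) (auto simp: finite_current_term)
  also have "\<dots> = tscale c (current scale \<Psi> \<epsilon> a m v)"
    by (simp add: current_def Sum_any.expand_set ts.scale_sum_right)
  finally show "current scale \<Psi> \<epsilon> a m (tscale c v) = tscale c (current scale \<Psi> \<epsilon> a m v)" .
qed

lemmas current_rules = linear_rule_zero[OF tlinear_current] linear_rule_add[OF tlinear_current]
  linear_rule_scale[OF tlinear_current] linear_rule_sum[OF tlinear_current] linear_rule_diff[OF tlinear_current]

lemma current_tensor:
  assumes L: "term_bound \<epsilon> m x y L"
  shows "current scale \<Psi> \<epsilon> a m (ten x y) =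
    (\<Sum>i\<in>{- L..L}. tscale (a - of_int i) (ten (\<Psi> (of_int i - 1/2) x) (vertex_op \<epsilon> (m - i - 1) y)))"
  unfolding current_def
proof (subst Sum_any.expand_superset[where A = "{- L..L}"])
  show "{i. current_term scale \<Psi> \<epsilon> a m (ten x y) i \<noteq> 0} \<subseteq> {- L..L}"
  proof
    fix i assume "i \<in> {i. current_term scale \<Psi> \<epsilon> a m (ten x y) i \<noteq> 0}"
    hence "\<not> \<bar>i\<bar> > L"
      using L by (auto simp: term_bound_def current_term_tensor tensor_rules)
    thus "i \<in> {- L..L}" by auto
  qed
qed (simp_all add: current_term_tensor)

end

lemma current_current_tensor:
  assumes \<Psi>: "vertex_field scale \<Psi>" and \<Psi>': "vertex_field scale \<Psi>'"
  shows "\<forall>\<^sub>F L in at_top. current scale \<Psi> \<epsilon> a m (current scale \<Psi>' \<epsilon>' b n (ten x y)) =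
    (\<Sum>i\<in>{- L..L}. \<Sum>j\<in>{- L..L}. tscale ((a - of_int i) * (b - of_int j))
       (ten (\<Psi> (of_int i - 1/2) (\<Psi>' (of_int j - 1/2) x))
            (vertex_op \<epsilon> (m - i - 1) (vertex_op \<epsilon>' (n - j - 1) y))))"
proof -
  obtain L0 where L0: "term_bound \<Psi>' \<epsilon>' n x y L0" using ex_term_bound[OF \<Psi>'] by blast
  let ?x = "\<lambda>j. \<Psi>' (of_int j - 1/2) x" and ?y = "\<lambda>j. vertex_op \<epsilon>' (n - j - 1) y"
  let ?T = "\<lambda>i j. ten (\<Psi> (of_int i - 1/2) (?x j)) (vertex_op \<epsilon> (m - i - 1) (?y j))"
  have 1: "\<forall>\<^sub>F L in at_top. \<forall>j\<in>{- L0..L0}. term_bound \<Psi> \<epsilon> m (?x j) (?y j) L"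
    by (rule eventually_ball_finite) (auto intro: term_bound_eventually[OF \<Psi>])
  have 2: "\<forall>\<^sub>F L in at_top. term_bound \<Psi>' \<epsilon>' n x y L" by (rule term_bound_eventually[OF \<Psi>'])
  show ?thesis
    using 1 2
  proof eventually_elim
    case (elim L)
    have inner: "current scale \<Psi> \<epsilon> a m (ten (?x j) (?y j)) = (\<Sum>i\<in>{- L..L}. tscale (a - of_int i) (?T i j))" for j
    proof (cases "j \<in> {- L0..L0}")
      case True
      thus ?thesis using elim(1) by (intro current_tensor[OF \<Psi>]) auto
    next
      case False
      hence "\<bar>j\<bar> > L0" by auto
      hence "?x j = 0 \<or> ?y j = 0" using L0 unfolding term_bound_def[OF \<Psi>'] by blast
      thus ?thesis
        by (auto simp: tensor_rules current_rules[OF \<Psi>] field_rules[OF \<Psi>] vertex_op_linear)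
    qed
    have "current scale \<Psi> \<epsilon> a m (current scale \<Psi>' \<epsilon>' b n (ten x y)) =
       (\<Sum>j\<in>{- L..L}. \<Sum>i\<in>{- L..L}. tscale (b - of_int j) (tscale (a - of_int i) (?T i j)))"
      unfolding current_tensor[OF \<Psi>' elim(2)] current_rules[OF \<Psi>] inner ts.scale_sum_right ..
    also have "\<dots> = (\<Sum>i\<in>{- L..L}. \<Sum>j\<in>{- L..L}. tscale ((a - of_int i) * (b - of_int j)) (?T i j))"
      by (subst sum.swap) (simp add: mult.commute)
    finally show ?case .
  qed
qed

lemma eventually_at_top_obtain:
  fixes P :: "int \<Rightarrow> bool"
  assumes "eventually P at_top"
  obtains L where "P L"
  using eventually_happens[OF assms] by auto

text \<open>The commutator is the sum of \<open>\<Psi>(i - 1/2) \<Psi>(j - 1/2)\<close>, antisymmetric in \<open>i\<close> and \<open>j\<close>, tensored with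
  an anticommutator of vertex operator modes and multiplied by a scalar, both symmetric.\<close>

lemma current_self_commute:
  assumes \<Psi>: "vertex_field scale \<Psi>" and \<epsilon>: "\<epsilon> * \<epsilon> = 1"
    and anti: "\<And>i j x. \<Psi> (of_int i - 1/2) (\<Psi> (of_int j - 1/2) x) = - \<Psi> (of_int j - 1/2) (\<Psi> (of_int i - 1/2) x)"
  shows "current scale \<Psi> \<epsilon> a m (current scale \<Psi> \<epsilon> a n v) = current scale \<Psi> \<epsilon> a n (current scale \<Psi> \<epsilon> a m v)"
proof (rule tlinear_eqI[where A = "\<lambda>v. current scale \<Psi> \<epsilon> a m (current scale \<Psi> \<epsilon> a n v)"
      and B = "\<lambda>v. current scale \<Psi> \<epsilon> a n (current scale \<Psi> \<epsilon> a m v)"])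
  show "tlinear (\<lambda>v. current scale \<Psi> \<epsilon> a m (current scale \<Psi> \<epsilon> a n v))" for m n
    by (intro tlinear_comp[OF tlinear_current[OF \<Psi>]] tlinear_current[OF \<Psi>])
  thus "tlinear (\<lambda>v. current scale \<Psi> \<epsilon> a n (current scale \<Psi> \<epsilon> a m v))" .
  fix x and b :: lattice_basis
  define y :: lattice_space where "y = bvec b"
  let ?Y = "vertex_op \<epsilon>" and ?P = "\<lambda>i. \<Psi> (of_int i - 1/2)"
  obtain L where L1: "current scale \<Psi> \<epsilon> a m (current scale \<Psi> \<epsilon> a n (ten x y)) =
     (\<Sum>i\<in>{- L..L}. \<Sum>j\<in>{- L..L}. tscale ((a - of_int i) * (a - of_int j))
       (ten (?P i (?P j x)) (?Y (m - i - 1) (?Y (n - j - 1) y))))"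
    and L2: "current scale \<Psi> \<epsilon> a n (current scale \<Psi> \<epsilon> a m (ten x y)) =
     (\<Sum>i\<in>{- L..L}. \<Sum>j\<in>{- L..L}. tscale ((a - of_int i) * (a - of_int j))
       (ten (?P i (?P j x)) (?Y (n - i - 1) (?Y (m - j - 1) y))))"
    using eventually_at_top_obtain[OF eventually_conj[OF current_current_tensor[OF \<Psi> \<Psi>, of \<epsilon> a m \<epsilon> a n x y]
          current_current_tensor[OF \<Psi> \<Psi>, of \<epsilon> a n \<epsilon> a m x y]]] by blast
  define t where "t i j = tscale ((a - of_int i) * (a - of_int j))
       (ten (?P i (?P j x)) (?Y (m - i - 1) (?Y (n - j - 1) y) + ?Y (n - j - 1) (?Y (m - i - 1) y)))" for i j
  have anti_t: "t j i = - t i j" for i j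
    unfolding t_def vertex_op_anticommutator[OF \<epsilon>, of "m - j - 1" "n - i - 1" "m - i - 1" "n - j - 1", simplified]
    by (subst anti)
       (simp add: tensor_rules mult.commute ts.scale_right_distrib ts.scale_right_diff_distrib)
  have L2': "current scale \<Psi> \<epsilon> a n (current scale \<Psi> \<epsilon> a m (ten x y)) =
     (\<Sum>i\<in>{- L..L}. \<Sum>j\<in>{- L..L}. - tscale ((a - of_int i) * (a - of_int j))
       (ten (?P i (?P j x)) (?Y (n - j - 1) (?Y (m - i - 1) y))))"
    unfolding L2 by (subst sum.swap) (subst anti, simp add: tensor_rules mult.commute)
  define X where "X = (\<Sum>i\<in>{- L..L}. \<Sum>j\<in>{- L..L}. t i j)"
  have "X = (\<Sum>i\<in>{- L..L}. \<Sum>j\<in>{- L..L}. t j i)" unfolding X_def by (rule sum.swap)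
  also have "\<dots> = (\<Sum>i\<in>{- L..L}. \<Sum>j\<in>{- L..L}. - t i j)" by (intro sum.cong refl anti_t)
  also have "\<dots> = - X" by (simp add: X_def sum_negf)
  finally have "tscale 2 X = 0" by (metis add.right_inverse mult_2 mult.commute one_add_one ts.scale_left_distrib ts.scale_one)
  hence "X = 0" by simp
  moreover have "current scale \<Psi> \<epsilon> a m (current scale \<Psi> \<epsilon> a n (ten x y)) -
      current scale \<Psi> \<epsilon> a n (current scale \<Psi> \<epsilon> a m (ten x y)) = X"
    unfolding L1 L2' X_def t_def by (simp add: sum_negf sum.distrib tensor_rules ts.scale_right_distrib)
  ultimately show "current scale \<Psi> \<epsilon> a m (current scale \<Psi> \<epsilon> a n (ten x (bvec b))) =
      current scale \<Psi> \<epsilon> a n (current scale \<Psi> \<epsilon> a m (ten x (bvec b)))"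
    unfolding y_def by simp
qed

lemma h_current_tensor:
  "h_current scale lam mu m (ten x y) =
   ten x (cscale (- 2) (beta m y) + (if m = 0 then cscale (lam - mu) y else 0))"
  by (simp add: h_current_def tensor_op_tensor[OF linear_id_scale linear_beta] tensor_rules)

lemma tlinear_h_current: "tlinear (h_current scale lam mu m)"
proof -
  have "tlinear (\<lambda>v. if m = 0 then tscale (lam - mu) v else 0)"
    by (cases "m = 0") (simp_all add: tlinear_scale[OF tlinear_id] tlinear_0)
  thus ?thesis
    unfolding h_current_def
    by (intro tlinear_add tlinear_scale tlinear_tensor_op linear_id_scale)
qed

lemma h_current_commutator:
  "h_current scale lam mu m (h_current scale lam mu n v) - h_current scale lam mu n (h_current scale lam mu m v) =
   tscale (if m + n = 0 then - 4 * of_int m else 0) v"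
proof (rule tlinear_eqI[where B = "tscale (if m + n = 0 then - 4 * of_int m else 0)"
      and A = "\<lambda>v. h_current scale lam mu m (h_current scale lam mu n v)
      - h_current scale lam mu n (h_current scale lam mu m v)"])
  show "tlinear (\<lambda>v. h_current scale lam mu m (h_current scale lam mu n v)
      - h_current scale lam mu n (h_current scale lam mu m v))"
    by (intro tlinear_diff tlinear_comp[OF tlinear_h_current] tlinear_h_current)
  show "tlinear (tscale (if m + n = 0 then - 4 * of_int m else 0))"
    by (rule tlinear_scale[OF tlinear_id])
  fix x and b :: lattice_basis
  let ?y = "bvec b :: lattice_space"
  let ?h = "\<lambda>m y. cscale (- 2) (beta m y) + (if m = 0 then cscale (lam - mu) y else 0)"
  have "?h m (?h n ?y) - ?h n (?h m ?y) = cscale 4 (beta m (beta n ?y) - beta n (beta m ?y))"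
    by (simp add: beta_linear cs.scale_right_distrib cs.scale_right_diff_distrib mult.commute)
  also have "\<dots> = cscale (if m + n = 0 then - 4 * of_int m else 0) ?y"
    unfolding beta_commutator by simp
  finally have e: "?h m (?h n ?y) = ?h n (?h m ?y) + cscale (if m + n = 0 then - 4 * of_int m else 0) ?y"
    by (simp add: algebra_simps)
  show "h_current scale lam mu m (h_current scale lam mu n (ten x ?y))
     - h_current scale lam mu n (h_current scale lam mu m (ten x ?y)) =
     tscale (if m + n = 0 then - 4 * of_int m else 0) (ten x ?y)"
    unfolding h_current_tensor e unfolding tensor_add_right[of x "?h n (?h m ?y)"]
    by (simp add: tensor_rules)
qed

lemma h_current_current:
  assumes \<Psi>: "vertex_field scale \<Psi>"
  shows "h_current scale lam mu m (current scale \<Psi> \<epsilon> a n v) - current scale \<Psi> \<epsilon> a n (h_current scale lam mu m v)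
    = tscale (2 * of_int \<epsilon>) (current scale \<Psi> \<epsilon> a (m + n) v)"
proof (rule tlinear_eqI[where B = "\<lambda>v. tscale (2 * of_int \<epsilon>) (current scale \<Psi> \<epsilon> a (m + n) v)"
      and A = "\<lambda>v. h_current scale lam mu m (current scale \<Psi> \<epsilon> a n v)
      - current scale \<Psi> \<epsilon> a n (h_current scale lam mu m v)"])
  show "tlinear (\<lambda>v. h_current scale lam mu m (current scale \<Psi> \<epsilon> a n v) - current scale \<Psi> \<epsilon> a n (h_current scale lam mu m v))"
    by (intro tlinear_diff tlinear_comp[OF tlinear_h_current] tlinear_comp[OF tlinear_current[OF \<Psi>]]
        tlinear_h_current tlinear_current[OF \<Psi>])
  show "tlinear (\<lambda>v. tscale (2 * of_int \<epsilon>) (current scale \<Psi> \<epsilon> a (m + n) v))"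
    by (intro tlinear_scale tlinear_current[OF \<Psi>])
  fix x and b :: lattice_basis
  define y :: lattice_space where "y = bvec b"
  let ?h = "\<lambda>y. cscale (- 2) (beta m y) + (if m = 0 then cscale (lam - mu) y else 0)"
  obtain L where L: "term_bound \<Psi> \<epsilon> n x y L" "term_bound \<Psi> \<epsilon> n x (?h y) L" "term_bound \<Psi> \<epsilon> (m + n) x y L"
    using eventually_at_top_obtain[OF eventually_conj[OF term_bound_eventually[OF \<Psi>, of \<epsilon> n x y]
       eventually_conj[OF term_bound_eventually[OF \<Psi>, of \<epsilon> n x "?h y"]
         term_bound_eventually[OF \<Psi>, of \<epsilon> "m + n" x y]]]] by blast
  have *: "?h (vertex_op \<epsilon> p y) = vertex_op \<epsilon> p (?h y) + cscale (2 * of_int \<epsilon>) (vertex_op \<epsilon> (p + m) y)" for p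
    by (simp add: beta_vertex_op vertex_op_linear cs.scale_right_distrib cs.scale_right_diff_distrib)
  have e: "n - i - 1 + m = m + n - i - 1" for i by simp
  show "h_current scale lam mu m (current scale \<Psi> \<epsilon> a n (ten x (bvec b)))
      - current scale \<Psi> \<epsilon> a n (h_current scale lam mu m (ten x (bvec b)))
    = tscale (2 * of_int \<epsilon>) (current scale \<Psi> \<epsilon> a (m + n) (ten x (bvec b)))"
    unfolding y_def[symmetric] h_current_tensor current_tensor[OF \<Psi> L(1)] current_tensor[OF \<Psi> L(2)]
      current_tensor[OF \<Psi> L(3)] linear_rule_sum[OF tlinear_h_current] linear_rule_scale[OF tlinear_h_current] * e
    unfolding tensor_add_right[of _ "vertex_op _ _ (?h y)"] ts.scale_right_distrib sum.distrib
    by (simp add: tensor_scale_right ts.scale_sum_right mult.commute)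
qed

end

sublocale charged_fock_space \<subseteq> complex_vector_space scale ..

section \<open>The realization\<close>

locale twisted_fock_space = charged_fock_space scale \<Psi>\<^sub>p \<Psi>\<^sub>m vac J
  for scale :: "complex \<Rightarrow> 'f::ab_group_add \<Rightarrow> 'f" and \<Psi>\<^sub>p \<Psi>\<^sub>m :: "rat \<Rightarrow> 'f \<Rightarrow> 'f" and vac :: 'f
    and J :: "'f \<Rightarrow> 'f" +
  fixes lam mu :: complex
begin

abbreviation psi_p :: "int \<Rightarrow> 'f \<Rightarrow> 'f" where "psi_p i \<equiv> \<Psi>\<^sub>p (of_int i - 1/2)"
abbreviation psi_m :: "int \<Rightarrow> 'f \<Rightarrow> 'f" where "psi_m i \<equiv> \<Psi>\<^sub>m (of_int i - 1/2)"

lemma psi_linear: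
  shows linear_psi_p: "Vector_Spaces.linear scale scale (psi_p i)"
    and linear_psi_m: "Vector_Spaces.linear scale scale (psi_m i)"
  by (simp_all add: linear_p linear_m half_odd_shift)

lemma psi_zero [simp]: "psi_p i 0 = 0" "psi_m i 0 = 0"
  by (simp_all add: linear_rule_zero[OF linear_psi_p] linear_rule_zero[OF linear_psi_m])

lemma psi_anticommute:
  shows psi_p_p: "psi_p i (psi_p j x) = - psi_p j (psi_p i x)"
    and psi_m_m: "psi_m i (psi_m j x) = - psi_m j (psi_m i x)"
    and psi_p_m: "psi_p i (psi_m j x) = - psi_m j (psi_p i x) + (if j = 1 - i then x else 0)"
proof -
  show "psi_p i (psi_p j x) = - psi_p j (psi_p i x)" "psi_m i (psi_m j x) = - psi_m j (psi_m i x)"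
    using anticommute_pp[OF half_odd_shift half_odd_shift, of i j x]
      anticommute_mm[OF half_odd_shift half_odd_shift, of i j x]
    by (simp_all add: eq_neg_iff_add_eq_0)
  have "(of_int i - 1/2 + (of_int j - 1/2) = (0 :: rat)) \<longleftrightarrow> of_int (i + j) = (of_int 1 :: rat)"
    by auto
  hence "(of_int i - 1/2 + (of_int j - 1/2) = (0 :: rat)) \<longleftrightarrow> j = 1 - i"
    unfolding of_int_eq_iff by auto
  thus "psi_p i (psi_m j x) = - psi_m j (psi_p i x) + (if j = 1 - i then x else 0)"
    using anticommute_pm[OF half_odd_shift half_odd_shift, of i j x]
    by (simp add: algebra_simps split: if_splits)
qed

lemma psi_m_p: "psi_m j (psi_p i x) = - psi_p i (psi_m j x) + (if j = 1 - i then x else 0)"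
  by (simp add: psi_p_m)

lemma clifford_submoduleI:
  assumes "subspace U" "\<And>i x. x \<in> U \<Longrightarrow> psi_p i x \<in> U" "\<And>i x. x \<in> U \<Longrightarrow> psi_m i x \<in> U"
  shows "clifford_submodule U"
  using assms unfolding clifford_submodule_def by (metis half_odd_cases)

text \<open>The vectors with this property form a Clifford submodule, and it contains the vacuum.\<close>

lemma psi_eventually_0: "\<exists>N. \<forall>i\<ge>N. psi_p i x = 0 \<and> psi_m i x = 0"
proof -
  define U where "U = {x. \<exists>N. \<forall>i\<ge>N. psi_p i x = 0 \<and> psi_m i x = 0}"
  have "clifford_submodule U"
  proof (rule clifford_submoduleI)
    show "subspace U"
    proof (rule subspaceI)
      show "0 \<in> U" by (simp add: U_def)
    next
      fix x y assume "x \<in> U" "y \<in> U"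
      then obtain N N' where N: "\<forall>i\<ge>N. psi_p i x = 0 \<and> psi_m i x = 0" "\<forall>i\<ge>N'. psi_p i y = 0 \<and> psi_m i y = 0"
        by (auto simp: U_def)
      hence "\<forall>i\<ge>max N N'. psi_p i (x + y) = 0 \<and> psi_m i (x + y) = 0"
        by (simp add: linear_rule_add[OF linear_psi_p] linear_rule_add[OF linear_psi_m])
      thus "x + y \<in> U" unfolding U_def by blast
    next
      fix c x assume "x \<in> U"
      then obtain N where N: "\<forall>i\<ge>N. psi_p i x = 0 \<and> psi_m i x = 0" by (auto simp: U_def)
      hence "\<forall>i\<ge>N. psi_p i (scale c x) = 0 \<and> psi_m i (scale c x) = 0"
        by (simp add: linear_rule_scale[OF linear_psi_p] linear_rule_scale[OF linear_psi_m])
      thus "scale c x \<in> U" unfolding U_def by blast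
    qed
  next
    fix j x assume "x \<in> U"
    then obtain N where N: "\<forall>i\<ge>N. psi_p i x = 0 \<and> psi_m i x = 0" by (auto simp: U_def)
    have "\<forall>i\<ge>max N (2 - j). psi_p i (psi_p j x) = 0 \<and> psi_m i (psi_p j x) = 0"
      using N by (auto simp: psi_p_p[of _ j] psi_m_p)
    thus "psi_p j x \<in> U" unfolding U_def by blast
    have "\<forall>i\<ge>max N (2 - j). psi_p i (psi_m j x) = 0 \<and> psi_m i (psi_m j x) = 0"
      using N by (auto simp: psi_m_m[of _ j] psi_p_m)
    thus "psi_m j x \<in> U" unfolding U_def by blast
  qed
  moreover have "vac \<in> U"
  proof -
    have "psi_p i vac = 0 \<and> psi_m i vac = 0" if "i \<ge> 1" for i
    proof -
      have "(0::rat) < of_int i - 1/2" using that by linarith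
      thus ?thesis using annihilate_p annihilate_m half_odd_shift by blast
    qed
    thus ?thesis unfolding U_def by blast
  qed
  ultimately have "x \<in> U" using generated by blast
  thus ?thesis by (simp add: U_def)
qed

lemma vertex_field_psi:
  shows vertex_field_p: "vertex_field scale \<Psi>\<^sub>p" and vertex_field_m: "vertex_field scale \<Psi>\<^sub>m"
  unfolding vertex_field_def using psi_linear psi_eventually_0 by blast+

definition e_op :: "int \<Rightarrow> 'f tensor_space \<Rightarrow> 'f tensor_space" where "e_op = current scale \<Psi>\<^sub>p 1 lam"
definition f_op :: "int \<Rightarrow> 'f tensor_space \<Rightarrow> 'f tensor_space" where "f_op = current scale \<Psi>\<^sub>m (- 1) mu"
definition h_op :: "int \<Rightarrow> 'f tensor_space \<Rightarrow> 'f tensor_space" where "h_op = h_current scale lam mu"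

lemma tlinear_ops: "tlinear (e_op m)" "tlinear (f_op m)" "tlinear (h_op m)"
  unfolding e_op_def f_op_def h_op_def
  by (rule tlinear_current[OF vertex_field_p] tlinear_current[OF vertex_field_m] tlinear_h_current)+

lemma e_e: "e_op m (e_op n v) = e_op n (e_op m v)"
  unfolding e_op_def by (rule current_self_commute[OF vertex_field_p _ psi_p_p]) simp

lemma f_f: "f_op m (f_op n v) = f_op n (f_op m v)"
  unfolding f_op_def by (rule current_self_commute[OF vertex_field_m _ psi_m_m]) simp

lemma h_e: "h_op m (e_op n v) - e_op n (h_op m v) = tscale 2 (e_op (m + n) v)"
  unfolding e_op_def h_op_def using h_current_current[OF vertex_field_p, of lam mu m 1 lam n v] by simp

lemma h_f: "h_op m (f_op n v) - f_op n (h_op m v) = tscale (- 2) (f_op (m + n) v)"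
  unfolding f_op_def h_op_def using h_current_current[OF vertex_field_m, of lam mu m "- 1" mu n v] by simp

lemma h_h: "h_op m (h_op n v) - h_op n (h_op m v) = tscale (if m + n = 0 then - 4 * of_int m else 0) v"
  unfolding h_op_def by (rule h_current_commutator)

text \<open>The modes of \<open>Y\<^sup>+\<close> and \<open>Y\<^sup>-\<close> anticommute, so the commutator contains the anticommutators of \<open>\<Psi>\<^sup>+\<close>
  and \<open>\<Psi>\<^sup>-\<close>, which force \<open>j = 1 - i\<close>.\<close>

lemma e_f: "e_op m (f_op n v) - f_op n (e_op m v) =
    h_op (m + n) v + tscale (if m + n = 0 then - 2 * of_int m else 0) v"
proof (rule tlinear_eqI[where A = "\<lambda>v. e_op m (f_op n v) - f_op n (e_op m v)"
      and B = "\<lambda>v. h_op (m + n) v + tscale (if m + n = 0 then - 2 * of_int m else 0) v"])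
  show "tlinear (\<lambda>v. e_op m (f_op n v) - f_op n (e_op m v))"
    by (intro tlinear_diff tlinear_comp[OF tlinear_ops(1)] tlinear_comp[OF tlinear_ops(2)] tlinear_ops)
  show "tlinear (\<lambda>v. h_op (m + n) v + tscale (if m + n = 0 then - 2 * of_int m else 0) v)"
    by (intro tlinear_add tlinear_ops tlinear_scale[OF tlinear_id])
  fix x and b :: lattice_basis
  define y :: lattice_space where "y = bvec b"
  let ?p = "\<lambda>i. vertex_op 1 (m - i - 1)" and ?m = "\<lambda>j. vertex_op (- 1) (n - j - 1)"
  let ?R = "cscale (- 2) (beta (m + n) y) + (if m + n = 0 then cscale (lam - mu - 2 * of_int m) y else 0)"
  have "\<forall>\<^sub>F L in at_top. (\<Sum>i\<in>{1 - L..L}. cscale ((lam - of_int i) * (mu - 1 + of_int i))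
       (vertex_op 1 (m - i - 1) (vertex_op (- 1) (n + i - 2) y))) = ?R"
    unfolding y_def eventually_at_top_linorder by (rule vertex_op_weighted_sum)
  from eventually_at_top_obtain[OF eventually_conj[OF this eventually_conj[OF
     current_current_tensor[OF vertex_field_p vertex_field_m, of 1 lam m "- 1" mu n x y]
     eventually_conj[OF current_current_tensor[OF vertex_field_m vertex_field_p, of "- 1" mu n 1 lam m x y]
      eventually_ge_at_top[of 1]]]]]
  obtain L where L: "L \<ge> 1"
    and sum: "(\<Sum>i\<in>{1 - L..L}. cscale ((lam - of_int i) * (mu - 1 + of_int i))
       (vertex_op 1 (m - i - 1) (vertex_op (- 1) (n + i - 2) y))) = ?R"
    and ef: "e_op m (f_op n (ten x y)) = (\<Sum>i\<in>{- L..L}. \<Sum>j\<in>{- L..L}.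
       tscale ((lam - of_int i) * (mu - of_int j)) (ten (psi_p i (psi_m j x)) (?p i (?m j y))))"
    and fe: "f_op n (e_op m (ten x y)) = (\<Sum>i\<in>{- L..L}. \<Sum>j\<in>{- L..L}.
       tscale ((mu - of_int i) * (lam - of_int j)) (ten (psi_m i (psi_p j x)) (?m i (?p j y))))"
    unfolding e_op_def f_op_def by blast
  have fe': "f_op n (e_op m (ten x y)) = (\<Sum>i\<in>{- L..L}. \<Sum>j\<in>{- L..L}.
       - tscale ((lam - of_int i) * (mu - of_int j)) (ten (psi_m j (psi_p i x)) (?p i (?m j y))))"
    unfolding fe by (subst sum.swap) (simp add: vertex_op_anticommute[of "- 1" 1] tensor_rules mult.commute)
  have anti: "ten (psi_p i (psi_m j x)) w + ten (psi_m j (psi_p i x)) w = (if j = 1 - i then ten x w else 0)"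
    for i j w
    unfolding tensor_add_left[symmetric] psi_p_m by (simp add: tensor_rules)
  have "e_op m (f_op n (ten x y)) - f_op n (e_op m (ten x y)) =
     (\<Sum>i\<in>{- L..L}. \<Sum>j\<in>{- L..L}. if j = 1 - i
        then tscale ((lam - of_int i) * (mu - of_int j)) (ten x (?p i (?m j y))) else 0)"
    unfolding ef fe' sum_subtractf[symmetric]
    by (intro sum.cong refl) (simp only: diff_minus_eq_add ts.scale_right_distrib[symmetric] anti, simp)
  also have "\<dots> = (\<Sum>i\<in>{- L..L}. if i \<in> {1 - L..L}
        then tscale ((lam - of_int i) * (mu - 1 + of_int i)) (ten x (?p i (vertex_op (- 1) (n + i - 2) y))) else 0)"
  proof (rule sum.cong[OF refl])
    fix i assume i: "i \<in> {- L..L}"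
    define F where "F j = tscale ((lam - of_int i) * (mu - of_int j)) (ten x (?p i (?m j y)))" for j
    have "n - (1 - i) - 1 = n + i - 2" "mu - of_int (1 - i) = mu - 1 + of_int i" by simp_all
    hence F: "F (1 - i) = tscale ((lam - of_int i) * (mu - 1 + of_int i)) (ten x (?p i (vertex_op (- 1) (n + i - 2) y)))"
      by (simp only: F_def)
    have "(\<Sum>j\<in>{- L..L}. if j = 1 - i then F j else 0) = (if 1 - i \<in> {- L..L} then F (1 - i) else 0)"
      by (simp add: sum.delta)
    also have "1 - i \<in> {- L..L} \<longleftrightarrow> i \<in> {1 - L..L}" using i by auto
    also note F
    finally show "(\<Sum>j\<in>{- L..L}. if j = 1 - i
        then tscale ((lam - of_int i) * (mu - of_int j)) (ten x (?p i (?m j y))) else 0) = (if i \<in> {1 - L..L}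
        then tscale ((lam - of_int i) * (mu - 1 + of_int i)) (ten x (?p i (vertex_op (- 1) (n + i - 2) y))) else 0)"
      unfolding F_def .
  qed
  also have "\<dots> = (\<Sum>i\<in>{1 - L..L}. tscale ((lam - of_int i) * (mu - 1 + of_int i))
        (ten x (?p i (vertex_op (- 1) (n + i - 2) y))))"
    by (rule sum.mono_neutral_cong_right) auto
  also have "\<dots> = ten x ?R"
    unfolding sum[symmetric] tensor_sum_right tensor_scale_right ..
  also have "\<dots> = h_op (m + n) (ten x y) + tscale (if m + n = 0 then - 2 * of_int m else 0) (ten x y)"
    unfolding h_op_def h_current_tensor
    by (simp add: tensor_rules cs.scale_left_diff_distrib ts.scale_left_diff_distrib)
  finally show "e_op m (f_op n (ten x (bvec b))) - f_op n (e_op m (ten x (bvec b))) =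
     h_op (m + n) (ten x (bvec b)) + tscale (if m + n = 0 then - 2 * of_int m else 0) (ten x (bvec b))"
    unfolding y_def .
qed

fun gen_op :: "affine_basis \<Rightarrow> 'f tensor_space \<Rightarrow> 'f tensor_space" where
  "gen_op (Loop sl2_e m) v = e_op m v"
| "gen_op (Loop sl2_f m) v = f_op m v"
| "gen_op (Loop sl2_h m) v = h_op m v"
| "gen_op Central v = tscale (- 2) v"

lemma tlinear_gen_op: "tlinear (gen_op b)"
proof (cases b)
  case (Loop x m)
  have "gen_op (Loop x m) = (case x of sl2_e \<Rightarrow> e_op m | sl2_f \<Rightarrow> f_op m | sl2_h \<Rightarrow> h_op m)"
    by (cases x) auto
  thus ?thesis using Loop tlinear_ops by (cases x) simp_all
next
  case Central
  have "gen_op Central = tscale (- 2)" by auto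
  thus ?thesis unfolding Central by (simp add: tlinear_scale[OF tlinear_id])
qed

definition rho :: "affine_sl2 \<Rightarrow> 'f tensor_space \<Rightarrow> 'f tensor_space" where
  "rho x v = lin_ext tscale (\<lambda>b. gen_op b v) x"

lemma linear_rho: "Vector_Spaces.linear cscale tscale (\<lambda>x. rho x v)"
  unfolding rho_def by (rule linear_lin_ext[OF ts.vector_space_axioms])

lemma rho_single: "rho (Poly_Mapping.single b c) v = tscale c (gen_op b v)"
  unfolding rho_def by (rule lin_ext_single[OF ts.vector_space_axioms])

lemma tlinear_rho: "tlinear (rho x)"
  by (rule tlinearI)
     (simp_all add: rho_def lin_ext_def linear_rule_add[OF tlinear_gen_op] linear_rule_scale[OF tlinear_gen_op]
        ts.scale_right_distrib sum.distrib ts.scale_sum_right mult.commute)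

lemma rho_bracket_basis:
  "rho (affine_bracket_basis b b') v = gen_op b (gen_op b' v) - gen_op b' (gen_op b v)"
proof (cases "b = Central \<or> b' = Central")
  case True
  hence "affine_bracket_basis b b' = 0" by (cases b; cases b') auto
  thus ?thesis
    using True by (auto simp: linear_rule_zero[OF linear_rho] linear_rule_scale[OF tlinear_gen_op]
        simp del: ts.scale_minus_left)
next
  case False
  then obtain x m y n where b: "b = Loop x m" "b' = Loop y n" by (metis affine_basis.exhaust)
  note r = linear_rule_add[OF linear_rho] linear_rule_zero[OF linear_rho] rho_single
    lin_ext_single[OF vector_space_cscale] cscale_single lin_ext_def[of _ _ 0]
  have eh: "e_op m (h_op n v) - h_op n (e_op m v) = tscale (- 2) (e_op (m + n) v)" for m n
    using arg_cong[OF h_e[of n m v], of uminus] by (simp add: add.commute)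
  have fh: "f_op m (h_op n v) - h_op n (f_op m v) = tscale 2 (f_op (m + n) v)" for m n
    using arg_cong[OF h_f[of n m v], of uminus] by (simp add: add.commute)
  have fe: "f_op m (e_op n v) - e_op n (f_op m v) =
     tscale (- 1) (h_op (m + n) v) + tscale (if m + n = 0 then - 2 * of_int m else 0) v" for m n
  proof -
    have "f_op m (e_op n v) - e_op n (f_op m v) = - (e_op n (f_op m v) - f_op m (e_op n v))" by simp
    also have "\<dots> = tscale (- 1) (h_op (m + n) v) + tscale (if m + n = 0 then - 2 * of_int m else 0) v"
    proof (cases "m + n = 0")
      case True
      hence "n = - m" by simp
      thus ?thesis unfolding e_f by simp
    qed (simp add: e_f add.commute)
    finally show ?thesis .
  qed
  show ?thesis
    unfolding b
    by (cases x; cases y)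
       (simp_all add: r e_e[of n m] f_f[of n m] h_e h_f h_h e_f eh fh fe mult.commute)
qed

lemma rho_lin_ext: "rho (lin_ext cscale g x) v = lin_ext tscale (\<lambda>b. rho (g b) v) x"
  by (simp add: lin_ext_def linear_rule_sum[OF linear_rho] linear_rule_scale[OF linear_rho])

lemma rho_bracket: "rho (affine_bracket x y) v = rho x (rho y v) - rho y (rho x v)"
proof -
  let ?X = "Poly_Mapping.keys x" and ?Y = "Poly_Mapping.keys y"
  let ?x = "Poly_Mapping.lookup x" and ?y = "Poly_Mapping.lookup y"
  have "rho (affine_bracket x y) v = (\<Sum>a\<in>?X. \<Sum>b\<in>?Y. tscale (?x a * ?y b) (gen_op a (gen_op b v)))
       - (\<Sum>a\<in>?X. \<Sum>b\<in>?Y. tscale (?x a * ?y b) (gen_op b (gen_op a v)))"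
    unfolding affine_bracket_def rho_lin_ext rho_bracket_basis
    by (simp add: lin_ext_def ts.scale_sum_right ts.scale_right_diff_distrib sum_subtractf)
  also have "(\<Sum>a\<in>?X. \<Sum>b\<in>?Y. tscale (?x a * ?y b) (gen_op a (gen_op b v))) = rho x (rho y v)"
    by (simp add: rho_def lin_ext_def linear_rule_sum[OF tlinear_gen_op] linear_rule_scale[OF tlinear_gen_op]
        ts.scale_sum_right)
  also have "(\<Sum>a\<in>?X. \<Sum>b\<in>?Y. tscale (?x a * ?y b) (gen_op b (gen_op a v))) = rho y (rho x v)"
    by (subst sum.swap)
       (simp add: rho_def lin_ext_def linear_rule_sum[OF tlinear_gen_op] linear_rule_scale[OF tlinear_gen_op]
        ts.scale_sum_right mult.commute)
  finally show ?thesis .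
qed

lemma affine_module_rho: "affine_module tscale UNIV rho"
  by unfold_locales
     (simp_all add: linear_rule_add[OF tlinear_rho] linear_rule_scale[OF tlinear_rho]
        linear_rule_add[OF linear_rho] linear_rule_scale[OF linear_rho] rho_bracket)

lemma is_realization_iff: "is_realization scale \<Psi>\<^sub>p \<Psi>\<^sub>m lam mu \<rho> \<longleftrightarrow> \<rho> = rho"
proof
  assume \<rho>: "is_realization scale \<Psi>\<^sub>p \<Psi>\<^sub>m lam mu \<rho>"
  then interpret M: affine_module tscale UNIV \<rho> by (simp add: is_realization_def)
  have gen: "\<rho> (bvec b) v = gen_op b v" for b v
    using \<rho> by (cases b; cases "case b of Loop x m \<Rightarrow> x")
       (auto simp: is_realization_def e_op_def f_op_def h_op_def split: affine_basis.splits)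
  have "(\<lambda>x. \<rho> x v) = (\<lambda>x. rho x v)" for v
  proof (rule linear_eq_on_bvec[OF _ linear_rho])
    show "Vector_Spaces.linear cscale tscale (\<lambda>x. \<rho> x v)"
      by unfold_locales (simp_all add: M.add_action M.scale_action)
  qed (simp add: gen rho_single)
  thus "\<rho> = rho" by (auto simp: fun_eq_iff)
next
  assume "\<rho> = rho"
  moreover have "rho (bvec b) = gen_op b" for b by (auto simp: rho_single)
  ultimately show "is_realization scale \<Psi>\<^sub>p \<Psi>\<^sub>m lam mu \<rho>"
    by (auto simp: is_realization_def affine_module_rho e_op_def f_op_def h_op_def)
qed

end

section \<open>Direct sums of eigenspaces\<close>

text \<open>The sum of a finite family; for families of vectors in given subspaces this is the map from their
  external direct sum.\<close>

definition family_sum :: "('i \<Rightarrow>\<^sub>0 'v::comm_monoid_add) \<Rightarrow> 'v" where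
  "family_sum g = (\<Sum>i\<in>Poly_Mapping.keys g. Poly_Mapping.lookup g i)"

lemma family_sum_superset:
  "finite S \<Longrightarrow> Poly_Mapping.keys g \<subseteq> S \<Longrightarrow> family_sum g = (\<Sum>i\<in>S. Poly_Mapping.lookup g i)"
  unfolding family_sum_def by (intro sum.mono_neutral_left) (auto simp: in_keys_iff)

lemma family_sum_single: "family_sum (Poly_Mapping.single i x) = x"
  by (simp add: family_sum_def)

lemma family_sum_0: "family_sum 0 = 0"
  by (simp add: family_sum_def)

lemma family_sum_add: "family_sum (g + h) = family_sum g + family_sum h"
  using keys_add[of g h]
  by (simp add: family_sum_superset[of "Poly_Mapping.keys g \<union> Poly_Mapping.keys h"] lookup_add sum.distrib)

lemma family_sum_sum: "family_sum (sum g S) = (\<Sum>i\<in>S. family_sum (g i))"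
  by (induction S rule: infinite_finite_induct) (simp_all add: family_sum_0 family_sum_add)

context complex_vector_space
begin

lemma family_sum_scale: "family_sum (pscale scale c g) = scale c (family_sum g)"
proof -
  have "Poly_Mapping.keys (pscale scale c g) \<subseteq> Poly_Mapping.keys g"
    by (auto simp: in_keys_iff lookup_pscale[OF vs])
  hence "family_sum (pscale scale c g) = (\<Sum>i\<in>Poly_Mapping.keys g. scale c (Poly_Mapping.lookup g i))"
    by (simp add: family_sum_superset[OF finite_keys] lookup_pscale[OF vs])
  thus ?thesis by (simp add: family_sum_def scale_sum_right)
qed

lemma span_Union_family_sum:
  assumes W: "\<And>i. subspace (W i)" and x: "x \<in> span (\<Union>i. W i)"
  shows "\<exists>g. (\<forall>i. Poly_Mapping.lookup g i \<in> W i) \<and> x = family_sum g"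
proof -
  let ?T = "{family_sum g |g. \<forall>i. Poly_Mapping.lookup g i \<in> W i}"
  have "subspace ?T"
  proof (rule subspaceI)
    show "0 \<in> ?T" using subspace_0[OF W] family_sum_0 by (auto intro!: exI[of _ 0])
  next
    fix x y assume "x \<in> ?T" "y \<in> ?T"
    then obtain g h where "\<forall>i. Poly_Mapping.lookup g i \<in> W i" "x = family_sum g"
      "\<forall>i. Poly_Mapping.lookup h i \<in> W i" "y = family_sum h" by blast
    thus "x + y \<in> ?T"
      using subspace_add[OF W] by (auto simp: lookup_add family_sum_add intro!: exI[of _ "g + h"])
  next
    fix c x assume "x \<in> ?T"
    then obtain g where "\<forall>i. Poly_Mapping.lookup g i \<in> W i" "x = family_sum g" by blast
    thus "scale c x \<in> ?T"
      using subspace_scale[OF W]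
      by (auto simp: lookup_pscale[OF vs] family_sum_scale intro!: exI[of _ "pscale scale c g"])
  qed
  moreover have "(\<Union>i. W i) \<subseteq> ?T"
  proof
    fix x assume "x \<in> (\<Union>i. W i)"
    then obtain i where "x \<in> W i" by blast
    hence "\<forall>j. Poly_Mapping.lookup (Poly_Mapping.single i x) j \<in> W j"
      using subspace_0[OF W] by (auto simp: lookup_single when_def)
    moreover have "x = family_sum (Poly_Mapping.single i x)" by (simp add: family_sum_single)
    ultimately show "x \<in> ?T" by blast
  qed
  ultimately have "span (\<Union>i. W i) \<subseteq> ?T" by (rule span_minimal[rotated])
  thus ?thesis using x by blast
qed

lemma linear_span_into:
  assumes A: "Vector_Spaces.linear scale scale A" and V: "subspace V"
    and S: "\<And>y. y \<in> S \<Longrightarrow> A y \<in> V" and x: "x \<in> span S"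
  shows "A x \<in> V"
proof -
  have "subspace {y. A y \<in> V}"
    by (rule subspaceI)
       (simp_all add: linear_rule_zero[OF A] linear_rule_add[OF A] linear_rule_scale[OF A]
          subspace_0[OF V] subspace_add[OF V] subspace_scale[OF V])
  hence "span S \<subseteq> {y. A y \<in> V}" using S by (intro span_minimal) auto
  thus ?thesis using x by blast
qed

definition eigenspace :: "('f \<Rightarrow> 'f) \<Rightarrow> int \<Rightarrow> 'f set" where
  "eigenspace T s = {x. T x = scale (of_int s) x}"

lemma subspace_eigenspace:
  assumes T: "Vector_Spaces.linear scale scale T"
  shows "subspace (eigenspace T s)"
proof (rule subspaceI)
  show "0 \<in> eigenspace T s" by (simp add: eigenspace_def linear_rule_zero[OF T])
next
  fix x y assume "x \<in> eigenspace T s" "y \<in> eigenspace T s"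
  thus "x + y \<in> eigenspace T s"
    by (simp add: eigenspace_def linear_rule_add[OF T] scale_right_distrib)
next
  fix c x assume "x \<in> eigenspace T s"
  hence e: "T x = scale (of_int s) x" by (simp add: eigenspace_def)
  have "T (scale c x) = scale c (scale (of_int s) x)" unfolding linear_rule_scale[OF T] e ..
  also have "\<dots> = scale (of_int s) (scale c x)" by (rule scale_left_commute)
  finally show "scale c x \<in> eigenspace T s" by (simp add: eigenspace_def)
qed

lemma eigenvectors_independent:
  assumes T: "Vector_Spaces.linear scale scale T"
    and "finite S" "\<And>i. i \<in> S \<Longrightarrow> g i \<in> eigenspace T i" "(\<Sum>i\<in>S. g i) = 0" "i \<in> S"
  shows "g i = 0"
  using assms(2-)
proof (induction S arbitrary: g i rule: finite_induct)
  case (insert t S)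
  have g: "T (g j) = scale (of_int j) (g j)" if "j \<in> insert t S" for j
    using insert.prems(1)[OF that] by (simp add: eigenspace_def)
  have s0: "g t + (\<Sum>j\<in>S. g j) = 0" using insert.prems(2) insert.hyps by simp
  have "(\<Sum>j\<in>S. scale (of_int j - of_int t) (g j)) =
     T (g t + (\<Sum>j\<in>S. g j)) - scale (of_int t) (g t + (\<Sum>j\<in>S. g j))"
    by (simp add: linear_rule_add[OF T] linear_rule_sum[OF T] g scale_right_distrib scale_sum_right
        scale_left_diff_distrib sum_subtractf)
  also have "\<dots> = 0" unfolding s0 by (simp add: linear_rule_zero[OF T])
  finally have sum0: "(\<Sum>j\<in>S. scale (of_int j - of_int t) (g j)) = 0" .
  have z: "scale (of_int j - of_int t) (g j) = 0" if "j \<in> S" for j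
  proof (rule insert.IH[OF _ sum0 that])
    fix k assume "k \<in> S"
    thus "scale (of_int k - of_int t) (g k) \<in> eigenspace T k"
      by (intro subspace_scale[OF subspace_eigenspace[OF T]] insert.prems) simp
  qed
  have S0: "g j = 0" if "j \<in> S" for j
    using z[OF that] that insert.hyps by auto
  with s0 have "g t = 0" by simp
  with S0 insert.prems(3) show ?case by auto
qed simp

lemma eigen_family_sum_unique:
  assumes T: "Vector_Spaces.linear scale scale T"
    and "\<And>i. Poly_Mapping.lookup g i \<in> eigenspace T i" "\<And>i. Poly_Mapping.lookup h i \<in> eigenspace T i"
    and "family_sum g = family_sum h"
  shows "g = h"
proof (rule poly_mapping_eqI)
  fix i
  let ?S = "insert i (Poly_Mapping.keys g \<union> Poly_Mapping.keys h)"
  have "(\<Sum>i\<in>?S. Poly_Mapping.lookup g i - Poly_Mapping.lookup h i) = family_sum g - family_sum h"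
    unfolding sum_subtractf by (subst (1 2) family_sum_superset[of ?S]) auto
  hence sum0: "(\<Sum>i\<in>?S. Poly_Mapping.lookup g i - Poly_Mapping.lookup h i) = 0"
    using assms(4) by simp
  have "Poly_Mapping.lookup g i - Poly_Mapping.lookup h i = 0"
    by (rule eigenvectors_independent[OF T _ _ sum0])
       (simp_all add: subspace_diff[OF subspace_eigenspace[OF T]] assms(2,3))
  thus "Poly_Mapping.lookup g i = Poly_Mapping.lookup h i" by simp
qed

text \<open>Induction on the number of nonzero components: a diagonal operator that separates \<open>b\<close> from another
  index, minus its eigenvalue there, removes the component at that index.\<close>

lemma component_in_subspace:
  fixes U :: "'f tensor_space set"
  assumes U: "ts.subspace U"
    and separate: "\<And>b b'. b \<noteq> b' \<Longrightarrow>
      \<exists>c. (\<forall>u\<in>U. \<exists>w\<in>U. \<forall>d. Poly_Mapping.lookup w d = scale (c d) (Poly_Mapping.lookup u d)) \<and> c b \<noteq> c b'"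
    and "u \<in> U"
  shows "Poly_Mapping.single b (Poly_Mapping.lookup u b) \<in> U"
  using \<open>u \<in> U\<close>
proof (induction "card (Poly_Mapping.keys u)" arbitrary: u rule: less_induct)
  case less
  show ?case
  proof (cases "Poly_Mapping.keys u \<subseteq> {b}")
    case True
    hence "Poly_Mapping.single b (Poly_Mapping.lookup u b) = u"
      by (auto intro!: poly_mapping_eqI simp: lookup_single when_def in_keys_iff)
    thus ?thesis using less.prems by simp
  next
    case False
    then obtain b' where b': "b' \<in> Poly_Mapping.keys u" "b' \<noteq> b" by blast
    from separate[OF b'(2)] obtain c w where c: "c b' \<noteq> c b" and w: "w \<in> U"
      "\<And>d. Poly_Mapping.lookup w d = scale (c d) (Poly_Mapping.lookup u d)"
      using less.prems by blast
    define u' where "u' = tscale (1 / (c b - c b')) (w - tscale (c b') u)"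
    have u': "u' \<in> U"
      unfolding u'_def using w less.prems
      by (intro ts.subspace_scale[OF U] ts.subspace_diff[OF U])
    have l: "Poly_Mapping.lookup u' d = scale ((c d - c b') / (c b - c b')) (Poly_Mapping.lookup u d)" for d
      by (simp add: u'_def lookup_pscale[OF vs] lookup_minus w scale_left_diff_distrib[symmetric])
    have "Poly_Mapping.keys u' \<subseteq> Poly_Mapping.keys u - {b'}"
      using l by (auto simp: in_keys_iff)
    hence "card (Poly_Mapping.keys u') < card (Poly_Mapping.keys u)"
      using b' by (intro psubset_card_mono) auto
    hence "Poly_Mapping.single b (Poly_Mapping.lookup u' b) \<in> U" using u' by (rule less.hyps)
    thus ?thesis using c by (simp add: l)
  qed
qed

lemma tensor_op_diagonal:
  assumes "\<And>b. B (bvec b) = cscale (c b) (bvec b)"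
  shows "Poly_Mapping.lookup (tmap id B v) b = scale (c b) (Poly_Mapping.lookup v b)"
proof -
  have "Poly_Mapping.lookup (tmap id B v) b =
     (\<Sum>d\<in>Poly_Mapping.keys v. if d = b then scale (c b) (Poly_Mapping.lookup v b) else 0)"
    unfolding tensor_op_def assms lookup_sum tensor_scale_right tensor_bvec lookup_pscale[OF vs] lookup_single
    by (intro sum.cong refl) (auto simp: when_def)
  thus ?thesis by (auto simp: sum.delta' in_keys_iff)
qed

lemma tensor_op_id_right: "Poly_Mapping.lookup (tmap A id v) b =
    (if b \<in> Poly_Mapping.keys v then A (Poly_Mapping.lookup v b) else 0)"
  by (auto simp: tensor_op_def tensor_bvec lookup_sum lookup_single when_def cong: if_cong)

lemma tensor_op_comp:
  assumes "clinear B" "clinear C"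
  shows "tmap id B (tmap id C v) = tmap id (\<lambda>y. B (C y)) v"
proof (rule tlinear_eqI[where A = "\<lambda>v. tmap id B (tmap id C v)" and B = "\<lambda>v. tmap id (\<lambda>y. B (C y)) v"])
  show "tlinear (\<lambda>v. tmap id B (tmap id C v))"
    by (rule tlinear_comp[OF tlinear_tensor_op[OF linear_id_scale] tlinear_tensor_op[OF linear_id_scale]])
  show "tlinear (tmap id (\<lambda>y. B (C y)))"
    by (intro tlinear_tensor_op linear_id_scale)
qed (simp add: tensor_op_tensor[OF linear_id_scale] assms clinear_comp)

end

section \<open>Irreducibility of the charge eigenspaces\<close>

context twisted_fock_space
begin

text \<open>The operator \<open>H(0)\<close>.\<close>

definition charge_op :: "'f tensor_space \<Rightarrow> 'f tensor_space" where
  "charge_op v = tmap J id v + tmap id (beta 0) v"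

abbreviation charge_space :: "int \<Rightarrow> 'f tensor_space set" where
  "charge_space s \<equiv> {v. charge_op v = tscale (of_int s) v}"

lemma tlinear_charge_op: "tlinear charge_op"
proof -
  have "tlinear (\<lambda>v. tmap J id v + tmap id (beta 0) v)"
    by (intro tlinear_add tlinear_tensor_op charge_linear linear_id_scale)
  thus ?thesis by (simp add: charge_op_def[abs_def])
qed

lemma charge_op_tensor: "charge_op (ten x y) = ten (J x) y + ten x (beta 0 y)"
  by (simp add: charge_op_def tensor_op_tensor charge_linear clinear_id linear_id_scale linear_beta)

lemma lookup_charge_op: "Poly_Mapping.lookup (charge_op v) (r, a) =
    J (Poly_Mapping.lookup v (r, a)) - scale (of_int r) (Poly_Mapping.lookup v (r, a))"
proof -
  have "Poly_Mapping.lookup (tmap id (beta 0) v) (r, a) = scale (- of_int r) (Poly_Mapping.lookup v (r, a))"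
    using tensor_op_diagonal[of "beta 0" "\<lambda>(r, a). - of_int r" v "(r, a)"]
    by (auto simp: beta_zero cscale_single)
  thus ?thesis
    by (auto simp: charge_op_def lookup_add tensor_op_id_right in_keys_iff linear_rule_zero[OF charge_linear])
qed

lemma charge_space_iff: "v \<in> charge_space s \<longleftrightarrow>
    (\<forall>r a. Poly_Mapping.lookup v (r, a) \<in> eigenspace J (r + s))"
proof -
  have "v \<in> charge_space s \<longleftrightarrow> (\<forall>r a. Poly_Mapping.lookup (charge_op v) (r, a) = Poly_Mapping.lookup (tscale (of_int s) v) (r, a))"
    by (auto intro: poly_mapping_eqI)
  also have "\<dots> \<longleftrightarrow> (\<forall>r a. Poly_Mapping.lookup v (r, a) \<in> eigenspace J (r + s))"
    by (auto simp: lookup_charge_op lookup_pscale[OF vs] eigenspace_def scale_left_distrib algebra_simps)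
  finally show ?thesis .
qed

lemma vac_nonzero: "vac \<noteq> 0"
proof
  assume "vac = 0"
  moreover have "clifford_submodule {0}"
    by (rule clifford_submoduleI) (auto simp: subspace_def)
  ultimately show False using generated[of "{0}"] nontrivial by auto
qed

text \<open>The annihilating exponential fixes \<open>e\<^bsup>(r+\<epsilon>)\<beta>\<^esup>\<close>, and the coefficient of \<open>z\<^sup>k\<close> in the creating one
  raises its weight from \<open>0\<close> to \<open>k\<close>.\<close>

lemma vertex_op_vacuum_coeff:
  "Poly_Mapping.lookup (vertex_op \<epsilon> n (bvec (r, 0))) (r + \<epsilon>, 0) = (if n = \<epsilon> * r - 1 then 1 else 0)"
proof -
  define k where "k = \<epsilon> * r - n - 1"
  have *: "vertex_op \<epsilon> n (bvec (r, 0)) = raising \<epsilon> k (bvec (r + \<epsilon>, 0))"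
    using vertex_op_bvec[of 0 0 \<epsilon> n r] by (simp add: wt_0 hexp_0 k_def)
  show ?thesis
  proof (cases "k = 0")
    case True
    thus ?thesis by (simp add: * hexp_0 k_def)
  next
    case False
    have "bvec (r + \<epsilon>, 0) \<in> supported_on {(r, a). wt a = 0}"
      by (rule supported_on_single) (simp add: wt_0)
    from hexp_weight[OF this, of "- 1" "of_int \<epsilon>" k]
    have "raising \<epsilon> k (bvec (r + \<epsilon>, 0)) \<in> supported_on {(r, a). wt a = k}" by simp
    hence "(r + \<epsilon>, 0) \<notin> Poly_Mapping.keys (raising \<epsilon> k (bvec (r + \<epsilon>, 0)))"
      using False by (auto simp: supported_on_def wt_0)
    thus ?thesis using False by (simp add: * in_keys_iff k_def)
  qed
qed

text \<open>This recovers the single operators \<open>\<Psi>\<close> from the currents, up to the factor \<open>a - i\<close>, which is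
  nonzero if \<open>a\<close> is not an integer.\<close>

lemma current_vacuum_coeff:
  assumes \<Psi>: "vertex_field scale \<Psi>"
  shows "Poly_Mapping.lookup (current scale \<Psi> \<epsilon> a (i + \<epsilon> * r) (ten x (bvec (r, 0)))) (r + \<epsilon>, 0) =
    scale (a - of_int i) (\<Psi> (of_int i - 1/2) x)"
proof -
  obtain L where L: "term_bound \<Psi> \<epsilon> (i + \<epsilon> * r) x (bvec (r, 0)) L" "L \<ge> \<bar>i\<bar>"
    using eventually_at_top_obtain[OF eventually_conj[OF term_bound_eventually[OF \<Psi>] eventually_ge_at_top]]
    by blast
  have "Poly_Mapping.lookup (current scale \<Psi> \<epsilon> a (i + \<epsilon> * r) (ten x (bvec (r, 0)))) (r + \<epsilon>, 0) =
     (\<Sum>j\<in>{- L..L}. if j = i then scale (a - of_int i) (\<Psi> (of_int i - 1/2) x) else 0)"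
    unfolding current_tensor[OF \<Psi> L(1)] lookup_sum lookup_pscale[OF vs] lookup_tensor vertex_op_vacuum_coeff
    by (intro sum.cong refl) auto
  also have "\<dots> = scale (a - of_int i) (\<Psi> (of_int i - 1/2) x)"
  proof -
    have "- L \<le> i" "i \<le> L" using L(2) by auto
    thus ?thesis by (simp add: sum.delta)
  qed
  finally show ?thesis .
qed

context
  fixes U :: "'f tensor_space set" and s :: int
  assumes U: "affine_module tscale U rho" and U_charge: "U \<subseteq> charge_space s"
begin

interpretation M: affine_module tscale U rho by (rule U)

lemma sub_U: "ts.subspace U" by (rule M.carrier_subspace)

lemma gen_op_U: "v \<in> U \<Longrightarrow> gen_op b v \<in> U"
  using M.action_closed[of v "bvec b"] by (simp add: rho_single)

lemma beta_U:
  assumes "v \<in> U"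
  shows "tmap id (beta m) v \<in> U"
proof -
  have "tscale (- 1/2) (gen_op (Loop sl2_h m) v - (if m = 0 then tscale (lam - mu) v else 0)) \<in> U"
    using assms ts.subspace_0[OF sub_U]
    by (intro ts.subspace_scale[OF sub_U] ts.subspace_diff[OF sub_U] gen_op_U)
       (auto intro: ts.subspace_scale[OF sub_U])
  thus ?thesis by (simp add: h_op_def h_current_def)
qed

text \<open>The operators \<open>\<beta>(0)\<close> and \<open>\<beta>(-n) \<beta>(n)\<close> are diagonal, and their eigenvalues determine \<open>r\<close> and all
  exponents of a basis vector.\<close>

lemma component_U:
  assumes "u \<in> U"
  shows "Poly_Mapping.single b (Poly_Mapping.lookup u b) \<in> U"
proof (rule component_in_subspace[OF sub_U _ assms])
  fix b b' :: lattice_basis assume "b \<noteq> b'"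
  obtain r a r' a' where b: "b = (r, a)" "b' = (r', a')" by force
  show "\<exists>c. (\<forall>u\<in>U. \<exists>w\<in>U. \<forall>d. Poly_Mapping.lookup w d = scale (c d) (Poly_Mapping.lookup u d)) \<and> c b \<noteq> c b'"
  proof (cases "r = r'")
    case False
    define c :: "lattice_basis \<Rightarrow> complex" where "c = (\<lambda>(r, a). - of_int r)"
    have "beta 0 (bvec d) = cscale (c d) (bvec d)" for d
      by (cases d) (simp add: beta_zero cscale_single c_def)
    hence "Poly_Mapping.lookup (tmap id (beta 0) u) d = scale (c d) (Poly_Mapping.lookup u d)" for u d
      by (rule tensor_op_diagonal)
    moreover have "c b \<noteq> c b'" using False by (simp add: b c_def)
    ultimately show ?thesis using beta_U by blast
  next
    case True
    hence "a \<noteq> a'" using b \<open>b \<noteq> b'\<close> by simp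
    then obtain i where i: "Poly_Mapping.lookup a i \<noteq> Poly_Mapping.lookup a' i"
      by (meson poly_mapping_eqI)
    define c :: "lattice_basis \<Rightarrow> complex" where
      "c = (\<lambda>(r, a). - (of_nat (Suc i) * of_nat (Poly_Mapping.lookup a i)))"
    have "beta (- int (Suc i)) (beta (int (Suc i)) (bvec d)) = cscale (c d) (bvec d)" for d
    proof -
      obtain r a where d: "d = (r, a)" by force
      show ?thesis
      proof (cases "Poly_Mapping.lookup a i = 0")
        case True
        thus ?thesis unfolding d beta_pos by (simp add: c_def beta_linear)
      next
        case False
        thus ?thesis
          using minus_single_plus[of a i] unfolding d beta_pos beta_neg by (simp add: c_def cscale_single)
      qed
    qed
    hence "Poly_Mapping.lookup (tmap id (\<lambda>y. beta (- int (Suc i)) (beta (int (Suc i)) y)) u) d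
         = scale (c d) (Poly_Mapping.lookup u d)" for u d
      by (rule tensor_op_diagonal)
    hence "Poly_Mapping.lookup (tmap id (beta (- int (Suc i))) (tmap id (beta (int (Suc i))) u)) d
         = scale (c d) (Poly_Mapping.lookup u d)" for u d
      by (simp only: tensor_op_comp[OF linear_beta linear_beta])
    moreover have "c b \<noteq> c b'" using i by (simp add: b c_def del: of_nat_Suc)
    ultimately show ?thesis using beta_U by blast
  qed
qed

lemma lower_U:
  assumes "ten x (bvec (r, a)) \<in> U"
  shows "ten x (bvec (r, 0)) \<in> U"
  using assms
proof (induction "nat (wt a)" arbitrary: a rule: less_induct)
  case less
  show ?case
  proof (cases "a = 0")
    case False
    then obtain i where i: "Poly_Mapping.lookup a i > 0"
      by (metis neq0_conv lookup_zero poly_mapping_eqI)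
    define k :: complex where "k = - (of_nat (Suc i) * of_nat (Poly_Mapping.lookup a i))"
    have k: "k \<noteq> 0" using i by (simp add: k_def del: of_nat_Suc)
    have "tmap id (beta (int (Suc i))) (ten x (bvec (r, a))) \<in> U" by (rule beta_U[OF less.prems])
    moreover have "beta (int (Suc i)) (bvec (r, a)) = cscale k (bvec (r, a - Poly_Mapping.single i 1))"
      unfolding beta_pos by (simp add: k_def cscale_single)
    ultimately have "tscale k (ten x (bvec (r, a - Poly_Mapping.single i 1))) \<in> U"
      by (simp add: tensor_op_tensor[OF linear_id_scale linear_beta] tensor_scale_right)
    hence "tscale (1 / k) (tscale k (ten x (bvec (r, a - Poly_Mapping.single i 1)))) \<in> U"
      by (rule ts.subspace_scale[OF sub_U])
    hence "ten x (bvec (r, a - Poly_Mapping.single i 1)) \<in> U" using k by simp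
    moreover have "nat (wt (a - Poly_Mapping.single i 1)) < nat (wt a)"
      using wt_minus_single[OF i] wt_nonneg[of "a - Poly_Mapping.single i 1"] by linarith
    ultimately show ?thesis using less.hyps by blast
  qed (use less.prems in simp)
qed

lemma raise_U:
  assumes "ten x (bvec (r, 0)) \<in> U"
  shows "ten x (bvec (r, a)) \<in> U"
proof (induction "nat (wt a)" arbitrary: a rule: less_induct)
  case less
  show ?case
  proof (cases "a = 0")
    case False
    then obtain i where i: "Poly_Mapping.lookup a i > 0"
      by (metis neq0_conv lookup_zero poly_mapping_eqI)
    have "nat (wt (a - Poly_Mapping.single i 1)) < nat (wt a)"
      using wt_minus_single[OF i] wt_nonneg[of "a - Poly_Mapping.single i 1"] by linarith
    hence "ten x (bvec (r, a - Poly_Mapping.single i 1)) \<in> U" by (rule less.hyps)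
    hence "tmap id (beta (- int (Suc i))) (ten x (bvec (r, a - Poly_Mapping.single i 1))) \<in> U" by (rule beta_U)
    thus ?thesis
      using i by (simp only: tensor_op_tensor[OF linear_id_scale linear_beta] beta_neg minus_single_plus id_apply)
  qed (use assms in simp)
qed

lemma psi_U:
  assumes "ten x (bvec (r, 0)) \<in> U"
  shows "lam \<notin> \<int> \<Longrightarrow> ten (psi_p i x) (bvec (r + 1, 0)) \<in> U"
    and "mu \<notin> \<int> \<Longrightarrow> ten (psi_m i x) (bvec (r - 1, 0)) \<in> U"
proof -
  have scale_U: "ten y b \<in> U" if "ten (scale c y) b \<in> U" "c \<noteq> 0" for c y b
    using ts.subspace_scale[OF sub_U that(1), of "1 / c"] that(2) by (simp add: tensor_scale_left)
  show "ten (psi_p i x) (bvec (r + 1, 0)) \<in> U" if "lam \<notin> \<int>"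
  proof (rule scale_U)
    show "ten (scale (lam - of_int i) (psi_p i x)) (bvec (r + 1, 0)) \<in> U"
      using component_U[OF gen_op_U[OF assms, of "Loop sl2_e (i + 1 * r)"], of "(r + 1, 0)"]
      unfolding gen_op.simps e_op_def current_vacuum_coeff[OF vertex_field_p] by (simp add: tensor_bvec)
    show "lam - of_int i \<noteq> 0" using that by auto
  qed
  show "ten (psi_m i x) (bvec (r - 1, 0)) \<in> U" if "mu \<notin> \<int>"
  proof (rule scale_U)
    show "ten (scale (mu - of_int i) (psi_m i x)) (bvec (r - 1, 0)) \<in> U"
      using component_U[OF gen_op_U[OF assms, of "Loop sl2_f (i + - 1 * r)"], of "(r + - 1, 0)"]
      unfolding gen_op.simps f_op_def current_vacuum_coeff[OF vertex_field_m] by (simp add: tensor_bvec)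
    show "mu - of_int i \<noteq> 0" using that by auto
  qed
qed

text \<open>The spaces \<open>W i\<close> of vectors \<open>x\<close> with \<open>x \<otimes> e\<^bsup>(i-s)\<beta>\<^esup> \<in> U\<close> consist of vectors of charge \<open>i\<close> and are mapped
  to each other by the operators \<open>\<Psi>\<^sup>\<plusminus>\<close>. So their sum is \<open>F\<close>, and as the charge eigenspaces are
  independent, \<open>W i\<close> is the whole eigenspace.\<close>

lemma charge_space_minimal:
  assumes lam: "lam \<notin> \<int>" and mu: "mu \<notin> \<int>" and "U \<noteq> {0}"
  shows "U = charge_space s"
proof
  define W where "W i = {x. ten x (bvec (i - s, 0)) \<in> U}" for i
  have W: "subspace (W i)" for i
    by (rule subspaceI)
       (auto simp: W_def tensor_rules intro: ts.subspace_0[OF sub_U] ts.subspace_add[OF sub_U]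
         ts.subspace_scale[OF sub_U])
  have W_eigen: "W i \<subseteq> eigenspace J i" for i
  proof
    fix x assume "x \<in> W i"
    hence "ten x (bvec (i - s, 0)) \<in> charge_space s" using U_charge by (auto simp: W_def)
    hence "Poly_Mapping.lookup (ten x (bvec (i - s, 0))) (i - s, 0) \<in> eigenspace J (i - s + s)"
      by (simp only: charge_space_iff)
    thus "x \<in> eigenspace J i" by (simp add: lookup_tensor)
  qed
  have psi_W: "psi_p j x \<in> W (i + 1)" "psi_m j x \<in> W (i - 1)" if "x \<in> W i" for i j x
    using psi_U(1)[OF _ lam, of x "i - s" j] psi_U(2)[OF _ mu, of x "i - s" j] that
    by (simp_all add: W_def algebra_simps)
  have psi_span: "psi_p j x \<in> span (\<Union>i. W i)" "psi_m j x \<in> span (\<Union>i. W i)"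
    if "x \<in> (\<Union>i. W i)" for j x
    using that psi_W[of x _ j] by (auto intro!: span_base)
  have "clifford_submodule (span (\<Union>i. W i))"
  proof (rule clifford_submoduleI)
    fix j x assume x: "x \<in> span (\<Union>i. W i)"
    show "psi_p j x \<in> span (\<Union>i. W i)"
      by (rule linear_span_into[OF linear_psi_p subspace_span psi_span(1) x])
    show "psi_m j x \<in> span (\<Union>i. W i)"
      by (rule linear_span_into[OF linear_psi_m subspace_span psi_span(2) x])
  qed (rule subspace_span)
  moreover have "span (\<Union>i. W i) \<noteq> {0}"
  proof -
    obtain u where "u \<in> U" "u \<noteq> 0" using \<open>U \<noteq> {0}\<close> ts.subspace_0[OF sub_U] by blast
    then obtain r a where ra: "Poly_Mapping.lookup u (r, a) \<noteq> 0"
      by (metis lookup_zero poly_mapping_eqI surj_pair)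
    have "ten (Poly_Mapping.lookup u (r, a)) (bvec (r, 0)) \<in> U"
      using component_U[OF \<open>u \<in> U\<close>, of "(r, a)"] by (intro lower_U[where a = a]) (simp add: tensor_bvec)
    hence "Poly_Mapping.lookup u (r, a) \<in> W (r + s)" by (simp add: W_def)
    hence "Poly_Mapping.lookup u (r, a) \<in> span (\<Union>i. W i)" by (blast intro: span_base)
    thus ?thesis using ra by blast
  qed
  ultimately have all: "x \<in> span (\<Union>i. W i)" for x
    using irreducible[of "span (\<Union>i. W i)"] by auto
  have key: "x \<in> W i" if "x \<in> eigenspace J i" for x i
  proof -
    obtain g where g: "\<And>j. Poly_Mapping.lookup g j \<in> W j" "x = family_sum g"
      using span_Union_family_sum[OF W all] by blast
    have "g = Poly_Mapping.single i x"
    proof (rule eigen_family_sum_unique[OF charge_linear])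
      show "Poly_Mapping.lookup g j \<in> eigenspace J j" for j using g W_eigen by blast
      show "Poly_Mapping.lookup (Poly_Mapping.single i x) j \<in> eigenspace J j" for j
        using that subspace_0[OF subspace_eigenspace[OF charge_linear]]
        by (auto simp: lookup_single when_def)
      show "family_sum g = family_sum (Poly_Mapping.single i x)" by (simp add: g family_sum_single)
    qed
    thus ?thesis using g(1)[of i] by simp
  qed
  show "charge_space s \<subseteq> U"
  proof
    fix v assume v: "v \<in> charge_space s"
    have "ten (Poly_Mapping.lookup v b) (bvec b) \<in> U" for b
    proof -
      obtain r a where b: "b = (r, a)" by force
      have "Poly_Mapping.lookup v (r, a) \<in> W (r + s)"
        using v by (intro key) (simp only: charge_space_iff)
      hence "ten (Poly_Mapping.lookup v (r, a)) (bvec (r, 0)) \<in> U" by (simp add: W_def)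
      thus ?thesis unfolding b by (rule raise_U)
    qed
    hence "(\<Sum>b\<in>Poly_Mapping.keys v. ten (Poly_Mapping.lookup v b) (bvec b)) \<in> U"
      by (rule ts.subspace_sum[OF sub_U])
    thus "v \<in> U" by (simp only: tensor_expand[symmetric])
  qed
qed (rule U_charge)

end

end

section \<open>The decomposition into spectral flows\<close>

context twisted_fock_space
begin

lemma charge_op_current:
  assumes \<Psi>: "vertex_field scale \<Psi>"
    and J: "\<And>i x. J (\<Psi> (of_int i - 1/2) x) = \<Psi> (of_int i - 1/2) (J x) + scale (of_int \<epsilon>) (\<Psi> (of_int i - 1/2) x)"
  shows "charge_op (current scale \<Psi> \<epsilon> a m v) = current scale \<Psi> \<epsilon> a m (charge_op v)"
proof (rule tlinear_eqI[where A = "\<lambda>v. charge_op (current scale \<Psi> \<epsilon> a m v)"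
      and B = "\<lambda>v. current scale \<Psi> \<epsilon> a m (charge_op v)"])
  show "tlinear (\<lambda>v. charge_op (current scale \<Psi> \<epsilon> a m v))"
    by (rule tlinear_comp[OF tlinear_charge_op tlinear_current[OF \<Psi>]])
  show "tlinear (\<lambda>v. current scale \<Psi> \<epsilon> a m (charge_op v))"
    by (rule tlinear_comp[OF tlinear_current[OF \<Psi>] tlinear_charge_op])
  fix x and b :: lattice_basis
  define y :: lattice_space where "y = bvec b"
  obtain L where L: "term_bound \<Psi> \<epsilon> m x y L" "term_bound \<Psi> \<epsilon> m (J x) y L" "term_bound \<Psi> \<epsilon> m x (beta 0 y) L"
    using eventually_at_top_obtain[OF eventually_conj[OF term_bound_eventually[OF \<Psi>, of \<epsilon> m x y]
       eventually_conj[OF term_bound_eventually[OF \<Psi>, of \<epsilon> m "J x" y]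
         term_bound_eventually[OF \<Psi>, of \<epsilon> m x "beta 0 y"]]]] by blast
  have *: "charge_op (ten (\<Psi> (of_int i - 1/2) x) (vertex_op \<epsilon> n y)) =
     ten (\<Psi> (of_int i - 1/2) (J x)) (vertex_op \<epsilon> n y) + ten (\<Psi> (of_int i - 1/2) x) (vertex_op \<epsilon> n (beta 0 y))" for i n
    by (simp add: charge_op_tensor J beta_vertex_op tensor_rules)
  show "charge_op (current scale \<Psi> \<epsilon> a m (ten x (bvec b))) = current scale \<Psi> \<epsilon> a m (charge_op (ten x (bvec b)))"
    unfolding y_def[symmetric] charge_op_tensor[of x] current_rules[OF \<Psi>] current_tensor[OF \<Psi> L(1)]
      current_tensor[OF \<Psi> L(2)] current_tensor[OF \<Psi> L(3)]
    unfolding linear_rule_sum[OF tlinear_charge_op] linear_rule_scale[OF tlinear_charge_op] *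
      ts.scale_right_distrib sum.distrib ..
qed

lemma charge_op_h: "charge_op (h_op m v) = h_op m (charge_op v)"
proof (rule tlinear_eqI[where A = "\<lambda>v. charge_op (h_op m v)" and B = "\<lambda>v. h_op m (charge_op v)"])
  show "tlinear (\<lambda>v. charge_op (h_op m v))"
    by (rule tlinear_comp[OF tlinear_charge_op tlinear_ops(3)])
  show "tlinear (\<lambda>v. h_op m (charge_op v))"
    by (rule tlinear_comp[OF tlinear_ops(3) tlinear_charge_op])
  fix x and b :: lattice_basis
  have "beta 0 (beta m (bvec b)) = beta m (beta 0 (bvec b))"
    using beta_commutator[of 0 m "bvec b"] by (cases "m = 0") simp_all
  thus "charge_op (h_op m (ten x (bvec b))) = h_op m (charge_op (ten x (bvec b)))"
    unfolding h_op_def h_current_tensor charge_op_tensor linear_rule_add[OF tlinear_h_current]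
    by (simp add: beta_linear)
qed

lemma charge_op_gen: "charge_op (gen_op b v) = gen_op b (charge_op v)"
proof -
  have J: "J (psi_p i x) = psi_p i (J x) + scale (of_int 1) (psi_p i x)"
    "J (psi_m i x) = psi_m i (J x) + scale (of_int (- 1)) (psi_m i x)" for i x
    using charge_p[OF half_odd_shift, of i x] charge_m[OF half_odd_shift, of i x]
    by (simp_all add: algebra_simps)
  show ?thesis
    by (cases "(b, v)" rule: gen_op.cases)
       (simp_all add: e_op_def f_op_def charge_op_current[OF vertex_field_p J(1)]
          charge_op_current[OF vertex_field_m J(2)] charge_op_h linear_rule_scale[OF tlinear_charge_op]
          del: ts.scale_minus_left)
qed

lemma charge_op_rho: "charge_op (rho x v) = rho x (charge_op v)"
  by (simp add: rho_def lin_ext_def linear_rule_sum[OF tlinear_charge_op]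
      linear_rule_scale[OF tlinear_charge_op] charge_op_gen)

lemma rho_charge_space: "v \<in> charge_space s \<Longrightarrow> rho x v \<in> charge_space s"
  by (simp add: charge_op_rho linear_rule_scale[OF tlinear_rho])

lemma subspace_charge_space: "ts.subspace (charge_space s)"
proof (rule ts.subspaceI)
  fix c v assume "v \<in> charge_space s"
  thus "tscale c v \<in> charge_space s"
    by (simp add: linear_rule_scale[OF tlinear_charge_op] mult.commute)
qed (simp_all add: linear_rule_zero[OF tlinear_charge_op] linear_rule_add[OF tlinear_charge_op]
      ts.scale_right_distrib)

lemma affine_module_charge_space: "affine_module tscale (charge_space s) rho"
proof -
  interpret R: affine_module tscale UNIV rho by (rule affine_module_rho)
  show ?thesis
    by (intro affine_module.intro affine_module_axioms.intro ts.vector_space_axioms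
        subspace_charge_space rho_charge_space R.action_add R.action_scale R.add_action R.scale_action
        R.action_bracket UNIV_I)
qed

lemma H0_kernel_eq: "H0_kernel scale J = charge_space 0"
  by (simp add: H0_kernel_def charge_op_def)

lemma charge_space_nonzero: "charge_space s \<noteq> {0}"
proof
  assume *: "charge_space s = {0}"
  have "ten vac (bvec (- s, 0)) \<in> charge_space s"
    unfolding charge_space_iff
    by (auto simp: lookup_tensor lookup_single when_def eigenspace_def charge_vac linear_rule_zero[OF charge_linear])
  hence "Poly_Mapping.lookup (ten vac (bvec (- s, 0))) (- s, 0) = 0" unfolding * by simp
  thus False using vac_nonzero by (simp add: lookup_tensor)
qed

lemma charge_space_irreducible:
  assumes "lam \<notin> \<int>" "mu \<notin> \<int>"
  shows "affine_irreducible tscale (charge_space s) rho"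
  unfolding affine_irreducible_def
proof (intro conjI allI impI affine_module_charge_space charge_space_nonzero)
  fix U assume "U \<subseteq> charge_space s" "affine_module tscale U rho"
  from charge_space_minimal[OF this(2,1) assms] show "U = {0} \<or> U = charge_space s" by blast
qed

text \<open>The span of the eigenvectors is a Clifford submodule, and it contains the vacuum.\<close>

lemma J_diagonalizable: "x \<in> span (\<Union>i. eigenspace J i)"
proof -
  let ?V = "span (\<Union>i. eigenspace J i)"
  have psi: "psi_p j y \<in> ?V" "psi_m j y \<in> ?V" if y: "y \<in> (\<Union>i. eigenspace J i)" for j y
  proof -
    obtain i where "J y = scale (of_int i) y" using y by (auto simp: eigenspace_def)
    hence "J (psi_p j y) = scale (of_int (i + 1)) (psi_p j y)" "J (psi_m j y) = scale (of_int (i - 1)) (psi_m j y)"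
      using charge_p[OF half_odd_shift, of j y] charge_m[OF half_odd_shift, of j y]
      by (simp_all add: linear_rule_scale[OF linear_psi_p] linear_rule_scale[OF linear_psi_m]
          scale_left_distrib scale_left_diff_distrib algebra_simps)
    hence "psi_p j y \<in> eigenspace J (i + 1)" "psi_m j y \<in> eigenspace J (i - 1)"
      by (simp_all only: eigenspace_def mem_Collect_eq)
    thus "psi_p j y \<in> ?V" "psi_m j y \<in> ?V" by (auto intro!: span_base)
  qed
  have "clifford_submodule ?V"
  proof (rule clifford_submoduleI)
    fix j y assume y: "y \<in> ?V"
    show "psi_p j y \<in> ?V" by (rule linear_span_into[OF linear_psi_p subspace_span psi(1) y])
    show "psi_m j y \<in> ?V" by (rule linear_span_into[OF linear_psi_m subspace_span psi(2) y])
  qed (rule subspace_span)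
  moreover have "vac \<in> ?V"
  proof (rule span_base)
    have "vac \<in> eigenspace J 0" by (simp add: eigenspace_def charge_vac)
    thus "vac \<in> (\<Union>i. eigenspace J i)" by blast
  qed
  ultimately show ?thesis using generated by blast
qed

interpretation tens: complex_vector_space "tscale" ..

lemma charge_space_eigenspace: "charge_space s = tens.eigenspace charge_op s"
  by (simp add: tens.eigenspace_def)

text \<open>If \<open>x\<close> has charge \<open>i\<close> and \<open>b\<close> lies in the sector \<open>r\<close>, then \<open>x \<otimes> b\<close> has charge \<open>i - r\<close>.\<close>

lemma charge_decomposition: "\<exists>g. (\<forall>s. Poly_Mapping.lookup g s \<in> charge_space s) \<and> v = family_sum g"
proof (rule tens.span_Union_family_sum[OF subspace_charge_space])
  have "ten x (bvec b) \<in> ts.span (\<Union>s. charge_space s)" for x b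
  proof -
    obtain r a where b: "b = (r, a)" by force
    obtain g where g: "\<And>i. Poly_Mapping.lookup g i \<in> eigenspace J i" "x = family_sum g"
      using span_Union_family_sum[OF subspace_eigenspace[OF charge_linear] J_diagonalizable] by blast
    have "ten (Poly_Mapping.lookup g i) (bvec b) \<in> charge_space (i - r)" for i
      unfolding charge_space_iff b
      using g(1)[of i] subspace_0[OF subspace_eigenspace[OF charge_linear]]
      by (auto simp: lookup_tensor lookup_single when_def)
    hence "ten (Poly_Mapping.lookup g i) (bvec b) \<in> ts.span (\<Union>s. charge_space s)" for i
      by (blast intro: ts.span_base)
    thus ?thesis by (simp add: g(2) family_sum_def tensor_sum_left ts.span_sum)
  qed
  hence "(\<Sum>b\<in>Poly_Mapping.keys v. ten (Poly_Mapping.lookup v b) (bvec b)) \<in> ts.span (\<Union>s. charge_space s)"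
    by (rule ts.span_sum)
  thus "v \<in> ts.span (\<Union>s. charge_space s)" by (simp only: tensor_expand[symmetric])
qed

lemma charge_decomposition_unique:
  assumes "\<And>s. Poly_Mapping.lookup g s \<in> charge_space s" "\<And>s. Poly_Mapping.lookup h s \<in> charge_space s"
    and "family_sum g = family_sum h"
  shows "g = h"
  using assms unfolding charge_space_eigenspace by (rule tens.eigen_family_sum_unique[OF tlinear_charge_op])

lemma inj_charge_space: "inj charge_space"
proof (rule injI)
  fix s t assume st: "charge_space s = charge_space t"
  obtain v where v: "v \<in> charge_space s" "v \<noteq> 0"
    using charge_space_nonzero[of s] ts.subspace_0[OF subspace_charge_space[of s]] by blast
  have "v \<in> charge_space t" using v(1) unfolding st .
  with v(1) have "tscale (of_int s) v = tscale (of_int t) v" by simp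
  thus "s = t" using v(2) by simp
qed

lemma completely_reducible:
  assumes "lam \<notin> \<int>" "mu \<notin> \<int>"
  shows "affine_completely_reducible tscale UNIV rho"
  unfolding affine_completely_reducible_def family_sum_def[symmetric]
proof (intro conjI exI[of _ "range charge_space"] ballI affine_module_rho subset_UNIV)
  fix U assume "U \<in> range charge_space"
  thus "affine_irreducible tscale U rho" using charge_space_irreducible[OF assms] by blast
next
  fix w :: "'f tensor_space"
  obtain g where g: "\<And>s. Poly_Mapping.lookup g s \<in> charge_space s" "w = family_sum g"
    using charge_decomposition by blast
  define G where "G = (\<Sum>s\<in>Poly_Mapping.keys g. Poly_Mapping.single (charge_space s) (Poly_Mapping.lookup g s))"
  have G1: "Poly_Mapping.lookup G (charge_space t) = Poly_Mapping.lookup g t" for t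
  proof -
    have "Poly_Mapping.lookup G (charge_space t) =
       (\<Sum>s\<in>Poly_Mapping.keys g. if s = t then Poly_Mapping.lookup g t else 0)"
      unfolding G_def lookup_sum lookup_single
      by (intro sum.cong refl) (auto simp: when_def dest: injD[OF inj_charge_space])
    thus ?thesis by (auto simp: sum.delta in_keys_iff)
  qed
  have G2: "Poly_Mapping.lookup G U = 0" if "U \<notin> range charge_space" for U
    unfolding G_def lookup_sum lookup_single using that by (intro sum.neutral) (auto simp: when_def)
  show "\<exists>!g. Poly_Mapping.keys g \<subseteq> range charge_space \<and>
     (\<forall>U\<in>range charge_space. Poly_Mapping.lookup g U \<in> U) \<and> w = family_sum g"
  proof (rule ex1I[of _ G])
    have "family_sum G = w" by (simp add: G_def family_sum_sum family_sum_single g(2)) (simp add: family_sum_def)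
    moreover have "\<forall>U\<in>range charge_space. Poly_Mapping.lookup G U \<in> U"
    proof
      fix U assume "U \<in> range charge_space"
      then obtain s where "U = charge_space s" by blast
      thus "Poly_Mapping.lookup G U \<in> U" using g(1)[of s] by (simp only: G1)
    qed
    moreover have "Poly_Mapping.keys G \<subseteq> range charge_space" using G2 by (auto simp only: in_keys_iff)
    ultimately show "Poly_Mapping.keys G \<subseteq> range charge_space \<and>
     (\<forall>U\<in>range charge_space. Poly_Mapping.lookup G U \<in> U) \<and> w = family_sum G" by simp
  next
    fix H assume H: "Poly_Mapping.keys H \<subseteq> range charge_space \<and>
     (\<forall>U\<in>range charge_space. Poly_Mapping.lookup H U \<in> U) \<and> w = family_sum H"
    \<comment> \<open>\<open>H\<close> reindexed by the integers, so that independence of eigenvectors applies\<close>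
    define h where "h = Poly_Mapping.map_key charge_space H"
    have h: "Poly_Mapping.lookup h s = Poly_Mapping.lookup H (charge_space s)" for s
      by (simp add: h_def map_key.rep_eq[OF inj_charge_space])
    have kh: "Poly_Mapping.keys H = charge_space ` Poly_Mapping.keys h"
      using H by (auto simp: in_keys_iff h)
    have "family_sum H = family_sum h"
      unfolding family_sum_def kh
      by (subst sum.reindex) (auto simp: h intro: inj_on_subset[OF inj_charge_space])
    hence sums: "family_sum h = family_sum g" using H g(2) by (simp only:)
    have "\<forall>U\<in>range charge_space. Poly_Mapping.lookup H U \<in> U" using H by (elim conjE)
    hence "Poly_Mapping.lookup h s \<in> charge_space s" for s
      unfolding h by (rule bspec) (rule rangeI)
    hence "h = g" by (rule charge_decomposition_unique[OF _ g(1) sums])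
    show "H = G"
    proof (rule poly_mapping_eqI)
      fix U
      show "Poly_Mapping.lookup H U = Poly_Mapping.lookup G U"
      proof (cases "U \<in> range charge_space")
        case True
        then obtain s where "U = charge_space s" by blast
        thus ?thesis using h[of s] \<open>h = g\<close> by (simp only: G1)
      next
        case False
        hence "U \<notin> Poly_Mapping.keys H" using H by blast
        thus ?thesis using G2[OF False] by (simp add: in_keys_iff)
      qed
    qed
  qed
qed

text \<open>Multiplication by \<open>e\<^bsup>t\<beta>\<^esup>\<close> on the tensor product.\<close>

abbreviation flow_shift :: "int \<Rightarrow> 'f tensor_space \<Rightarrow> 'f tensor_space" where
  "flow_shift t \<equiv> tmap id (shift t)"

lemma tlinear_flow_shift: "tlinear (flow_shift t)"
  by (rule tlinear_tensor_op[OF linear_id_scale])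

lemmas flow_shift_rules = linear_rule_zero[OF tlinear_flow_shift] linear_rule_add[OF tlinear_flow_shift]
  linear_rule_scale[OF tlinear_flow_shift] linear_rule_diff[OF tlinear_flow_shift]
  linear_rule_sum[OF tlinear_flow_shift]

lemma flow_shift_minus: "flow_shift t (- v) = - flow_shift t v"
  using flow_shift_rules(4)[of t 0 v] by (simp add: flow_shift_rules)

lemma flow_shift_tensor: "flow_shift t (ten x y) = ten x (shift t y)"
  by (simp add: tensor_op_tensor[OF linear_id_scale clinear_shift])

lemma flow_shift_inverse: "flow_shift t (flow_shift (- t) v) = v"
proof -
  have "flow_shift t (flow_shift (- t) v) = tmap id (\<lambda>y. y) v"
    by (simp add: tensor_op_comp[OF clinear_shift clinear_shift] shift_shift shift_0)
  also have "\<dots> = v"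
    by (simp add: tensor_op_def tensor_expand[symmetric])
  finally show ?thesis .
qed

lemma charge_op_flow_shift: "charge_op (flow_shift t v) = flow_shift t (charge_op v) - tscale (of_int t) (flow_shift t v)"
proof (rule tlinear_eqI[where A = "\<lambda>v. charge_op (flow_shift t v)"
      and B = "\<lambda>v. flow_shift t (charge_op v) - tscale (of_int t) (flow_shift t v)"])
  show "tlinear (\<lambda>v. charge_op (flow_shift t v))"
    by (rule tlinear_comp[OF tlinear_charge_op tlinear_flow_shift])
  show "tlinear (\<lambda>v. flow_shift t (charge_op v) - tscale (of_int t) (flow_shift t v))"
    by (rule tlinear_diff[OF tlinear_comp[OF tlinear_flow_shift tlinear_charge_op] tlinear_scale[OF tlinear_flow_shift]])
qed (simp add: flow_shift_tensor charge_op_tensor flow_shift_rules beta_shift tensor_rules)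

lemma flow_shift_charge_space:
  assumes "v \<in> charge_space s"
  shows "flow_shift t v \<in> charge_space (s - t)"
  using assms by (simp add: charge_op_flow_shift flow_shift_rules ts.scale_left_diff_distrib)

lemma current_flow_shift:
  assumes \<Psi>: "vertex_field scale \<Psi>"
  shows "current scale \<Psi> \<epsilon> a n (flow_shift t v) = flow_shift t (current scale \<Psi> \<epsilon> a (n - \<epsilon> * t) v)"
proof (rule tlinear_eqI[where A = "\<lambda>v. current scale \<Psi> \<epsilon> a n (flow_shift t v)"
      and B = "\<lambda>v. flow_shift t (current scale \<Psi> \<epsilon> a (n - \<epsilon> * t) v)"])
  show "tlinear (\<lambda>v. current scale \<Psi> \<epsilon> a n (flow_shift t v))"
    by (rule tlinear_comp[OF tlinear_current[OF \<Psi>] tlinear_flow_shift])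
  show "tlinear (\<lambda>v. flow_shift t (current scale \<Psi> \<epsilon> a (n - \<epsilon> * t) v))"
    by (rule tlinear_comp[OF tlinear_flow_shift tlinear_current[OF \<Psi>]])
  fix x and b :: lattice_basis
  define y :: lattice_space where "y = bvec b"
  obtain L where L: "term_bound \<Psi> \<epsilon> n x (shift t y) L" "term_bound \<Psi> \<epsilon> (n - \<epsilon> * t) x y L"
    using eventually_at_top_obtain[OF eventually_conj[OF term_bound_eventually[OF \<Psi>, of \<epsilon> n x "shift t y"]
       term_bound_eventually[OF \<Psi>, of \<epsilon> "n - \<epsilon> * t" x y]]] by blast
  have e: "n - i - 1 - \<epsilon> * t = n - \<epsilon> * t - i - 1" for i by simp
  show "current scale \<Psi> \<epsilon> a n (flow_shift t (ten x (bvec b))) =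
     flow_shift t (current scale \<Psi> \<epsilon> a (n - \<epsilon> * t) (ten x (bvec b)))"
    unfolding y_def[symmetric] flow_shift_tensor current_tensor[OF \<Psi> L(1)] current_tensor[OF \<Psi> L(2)]
      flow_shift_rules vertex_op_shift e ..
qed

lemma h_flow_shift:
  "h_op n (flow_shift t v) = flow_shift t (h_op n v) + tscale (if n = 0 then 2 * of_int t else 0) (flow_shift t v)"
proof (rule tlinear_eqI[where A = "\<lambda>v. h_op n (flow_shift t v)"
      and B = "\<lambda>v. flow_shift t (h_op n v) + tscale (if n = 0 then 2 * of_int t else 0) (flow_shift t v)"])
  show "tlinear (\<lambda>v. h_op n (flow_shift t v))"
    by (rule tlinear_comp[OF tlinear_ops(3) tlinear_flow_shift])
  show "tlinear (\<lambda>v. flow_shift t (h_op n v) + tscale (if n = 0 then 2 * of_int t else 0) (flow_shift t v))"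
    by (rule tlinear_add[OF tlinear_comp[OF tlinear_flow_shift tlinear_ops(3)] tlinear_scale[OF tlinear_flow_shift]])
qed (simp add: h_op_def flow_shift_tensor h_current_tensor beta_shift tensor_rules
        shift_linear flow_shift_rules ts.scale_right_distrib ts.scale_right_diff_distrib
        del: ts.scale_minus_left cs.scale_minus_left)

text \<open>Conjugating the currents by \<open>e\<^bsup>t\<beta>\<^esup>\<close> shifts their modes as the spectral flow does, and the summand
  \<open>-2\<beta>(0)\<close> of \<open>h(0)\<close> contributes \<open>2t = -tk\<close> for the level \<open>k = -2\<close>.\<close>

lemma flow_shift_spectral_flow:
  "flow_shift t (spectral_flow tscale (- 2) t rho x v) = rho x (flow_shift t v)"
proof -
  have "flow_shift t (spectral_flow_basis tscale (- 2) t rho b v) = gen_op b (flow_shift t v)" for b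
    by (cases "(b, v)" rule: gen_op.cases)
       (simp_all add: rho_single e_op_def f_op_def current_flow_shift[OF vertex_field_p]
          current_flow_shift[OF vertex_field_m] h_flow_shift flow_shift_rules flow_shift_minus mult.commute)
  thus ?thesis
    by (simp add: spectral_flow_def rho_def lin_ext_def flow_shift_rules)
qed

text \<open>The isomorphism from the external direct sum of the spectral flows; it places the \<open>t\<close>-th summand
  into the eigenspace of \<open>H(0)\<close> for \<open>-t\<close>.\<close>

definition assemble :: "(int \<Rightarrow>\<^sub>0 'f tensor_space) \<Rightarrow> 'f tensor_space" where
  "assemble p = (\<Sum>t\<in>Poly_Mapping.keys p. flow_shift t (Poly_Mapping.lookup p t))"

lemma assemble_superset:
  "finite S \<Longrightarrow> Poly_Mapping.keys p \<subseteq> S \<Longrightarrow> assemble p = (\<Sum>t\<in>S. flow_shift t (Poly_Mapping.lookup p t))"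
  unfolding assemble_def by (intro sum.mono_neutral_left) (auto simp: in_keys_iff flow_shift_rules)

lemma assemble_add: "assemble (p + q) = assemble p + assemble q"
  using keys_add[of p q]
  by (simp add: assemble_superset[of "Poly_Mapping.keys p \<union> Poly_Mapping.keys q"] lookup_add flow_shift_rules sum.distrib)

lemma assemble_scale: "assemble (pscale tscale c p) = tscale c (assemble p)"
proof -
  have "Poly_Mapping.keys (pscale tscale c p) \<subseteq> Poly_Mapping.keys p"
    by (auto simp: in_keys_iff lookup_pscale[OF tens.vs])
  thus ?thesis
    by (simp add: assemble_superset[of "Poly_Mapping.keys p"] lookup_pscale[OF tens.vs] flow_shift_rules ts.scale_sum_right)
qed

lemma assemble_single: "assemble (Poly_Mapping.single t v) = flow_shift t v"
  by (simp add: assemble_def flow_shift_rules)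

lemma assemble_sum: "assemble (sum g S) = (\<Sum>i\<in>S. assemble (g i))"
  by (induction S rule: infinite_finite_induct) (simp_all add: assemble_add, simp_all add: assemble_def)

lemma assemble_action:
  "assemble (dsum_action (\<lambda>t. spectral_flow tscale (- 2) t rho) x p) = rho x (assemble p)"
proof -
  let ?q = "dsum_action (\<lambda>t. spectral_flow tscale (- 2) t rho) x p"
  have l: "Poly_Mapping.lookup ?q t = spectral_flow tscale (- 2) t rho x (Poly_Mapping.lookup p t)"
    if "t \<in> Poly_Mapping.keys p" for t using that by (simp add: dsum_action_def lookup_mapp)
  have "Poly_Mapping.keys ?q \<subseteq> Poly_Mapping.keys p"
    by (auto simp: dsum_action_def in_keys_iff lookup_mapp when_def)
  hence "assemble ?q = (\<Sum>t\<in>Poly_Mapping.keys p. flow_shift t (Poly_Mapping.lookup ?q t))"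
    by (intro assemble_superset) auto
  also have "\<dots> = (\<Sum>t\<in>Poly_Mapping.keys p. rho x (flow_shift t (Poly_Mapping.lookup p t)))"
    by (intro sum.cong refl) (simp only: l flow_shift_spectral_flow)
  finally show ?thesis by (simp add: assemble_def linear_rule_sum[OF tlinear_rho])
qed

abbreviation flow_sum :: "(int \<Rightarrow>\<^sub>0 'f tensor_space) set" where
  "flow_sum \<equiv> dsum_carrier (\<lambda>s. charge_space 0)"

lemma assemble_inj: "inj_on assemble flow_sum"
proof (rule inj_onI)
  fix p q assume p: "p \<in> flow_sum" and q: "q \<in> flow_sum" and pq: "assemble p = assemble q"
  show "p = q"
  proof (rule poly_mapping_eqI)
    fix t
    let ?d = "\<lambda>t. Poly_Mapping.lookup p t - Poly_Mapping.lookup q t"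
    let ?S = "insert t (Poly_Mapping.keys p \<union> Poly_Mapping.keys q)"
    have d: "?d t \<in> charge_space 0" for t
      using p q by (intro ts.subspace_diff[OF subspace_charge_space]) (simp_all only: dsum_carrier_def mem_Collect_eq)
    have "(\<Sum>t\<in>?S. flow_shift t (?d t)) = assemble p - assemble q"
      unfolding flow_shift_rules sum_subtractf by (subst (1 2) assemble_superset[of ?S]) auto
    hence "(\<Sum>t\<in>?S. flow_shift t (?d t)) = 0" using pq by simp
    hence sum0: "(\<Sum>i\<in>uminus ` ?S. flow_shift (- i) (?d (- i))) = 0"
      by (subst sum.reindex) (auto simp: inj_on_def)
    have "flow_shift (- (- t)) (?d (- (- t))) = 0"
    proof (rule tens.eigenvectors_independent[OF tlinear_charge_op _ _ sum0])
      fix i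
      have "flow_shift (- i) (?d (- i)) \<in> charge_space (0 - (- i))" by (rule flow_shift_charge_space[OF d])
      thus "flow_shift (- i) (?d (- i)) \<in> tens.eigenspace charge_op i" by (simp add: tens.eigenspace_def)
    qed auto
    hence "flow_shift (- t) (flow_shift (- (- t)) (?d t)) = 0" by (simp add: flow_shift_rules)
    thus "Poly_Mapping.lookup p t = Poly_Mapping.lookup q t" by (simp only: flow_shift_inverse) simp
  qed
qed

lemma assemble_surj: "assemble ` flow_sum = UNIV"
proof (intro equalityI subsetI UNIV_I)
  fix v :: "'f tensor_space"
  obtain g where g: "\<And>s. Poly_Mapping.lookup g s \<in> charge_space s" "v = family_sum g"
    using charge_decomposition by blast
  define p where "p = (\<Sum>s\<in>Poly_Mapping.keys g. Poly_Mapping.single (- s) (flow_shift s (Poly_Mapping.lookup g s)))"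
  have "flow_shift s (Poly_Mapping.lookup g s) \<in> charge_space 0" for s
    using flow_shift_charge_space[OF g(1), of s s] by simp
  note T0 = this
  have "p \<in> flow_sum"
    unfolding dsum_carrier_def
  proof (rule CollectI, rule allI)
    fix i
    have "(flow_shift s (Poly_Mapping.lookup g s) when - s = i) \<in> charge_space 0" for s
      using T0[of s] ts.subspace_0[OF subspace_charge_space[of 0]] by (cases "- s = i") simp_all
    thus "Poly_Mapping.lookup p i \<in> charge_space 0"
      unfolding p_def lookup_sum lookup_single by (intro ts.subspace_sum[OF subspace_charge_space])
  qed
  moreover have "assemble p = v"
    using flow_shift_inverse[of "- s" for s]
    by (simp add: p_def assemble_sum assemble_single g(2) family_sum_def)
  ultimately show "v \<in> assemble ` flow_sum" by blast
qed

lemma spectral_flow_charge_space: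
  assumes "v \<in> charge_space 0"
  shows "spectral_flow tscale (- 2) t rho x v \<in> charge_space 0"
proof -
  have "flow_shift t (spectral_flow tscale (- 2) t rho x v) \<in> charge_space (0 - t)"
    unfolding flow_shift_spectral_flow by (rule rho_charge_space[OF flow_shift_charge_space[OF assms]])
  from flow_shift_charge_space[OF this, of "- t"] show ?thesis
    using flow_shift_inverse[of "- t"] by simp
qed

end

text \<open>An action that corresponds to a module action under a linear bijection is itself a module action.
  So the spectral flows need no separate verification of the module axioms.\<close>

lemma affine_isomorphic_transport:
  fixes s :: "complex \<Rightarrow> 'v::ab_group_add \<Rightarrow> 'v" and s' :: "complex \<Rightarrow> 'w::ab_group_add \<Rightarrow> 'w"
  assumes M: "affine_module s UNIV \<rho>" and vs': "vector_space s'" and D: "module.subspace s' D"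
    and bij: "bij_betw \<psi> D UNIV"
    and add: "\<And>v w. \<psi> (v + w) = \<psi> v + \<psi> w" and scale: "\<And>c v. \<psi> (s' c v) = s c (\<psi> v)"
    and closed: "\<And>x v. v \<in> D \<Longrightarrow> \<rho>' x v \<in> D" and act: "\<And>x v. v \<in> D \<Longrightarrow> \<psi> (\<rho>' x v) = \<rho> x (\<psi> v)"
  shows "affine_isomorphic s UNIV \<rho> s' D \<rho>'"
proof -
  interpret M: affine_module s UNIV \<rho> by fact
  interpret V: vector_space s' by fact
  have eqI: "v = w" if "\<psi> v = \<psi> w" "v \<in> D" "w \<in> D" for v w
    using bij_betw_imp_inj_on[OF bij] that by (rule inj_onD)
  have diff: "\<psi> (v - w) = \<psi> v - \<psi> w" for v w
    using add[of "v - w" w] by (simp add: algebra_simps)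
  note cl = closed V.subspace_add[OF D] V.subspace_scale[OF D] V.subspace_diff[OF D]
  have M': "affine_module s' D \<rho>'"
  proof unfold_locales
    fix v w x y c assume v: "v \<in> D"
    show "\<rho>' x (s' c v) = s' c (\<rho>' x v)"
      by (rule eqI) (use v in \<open>simp_all add: cl act scale M.action_scale\<close>)
    show "\<rho>' (x + y) v = \<rho>' x v + \<rho>' y v"
      by (rule eqI) (use v in \<open>simp_all add: cl act add M.add_action\<close>)
    show "\<rho>' (cscale c x) v = s' c (\<rho>' x v)"
      by (rule eqI) (use v in \<open>simp_all add: cl act scale M.scale_action\<close>)
    show "\<rho>' (affine_bracket x y) v = \<rho>' x (\<rho>' y v) - \<rho>' y (\<rho>' x v)"
      by (rule eqI) (use v in \<open>simp_all add: cl act diff M.action_bracket\<close>)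
    assume w: "w \<in> D"
    show "\<rho>' x (v + w) = \<rho>' x v + \<rho>' x w"
      by (rule eqI) (use v w in \<open>simp_all add: cl act add M.action_add\<close>)
  qed (use D closed in auto)
  define \<phi> where "\<phi> = inv_into D \<psi>"
  have \<phi>: "\<phi> v \<in> D" "\<psi> (\<phi> v) = v" for v
    using bij unfolding \<phi>_def by (auto simp: bij_betw_def intro: inv_into_into f_inv_into_f)
  have "bij_betw \<phi> UNIV D" unfolding \<phi>_def by (rule bij_betw_inv_into[OF bij])
  moreover have "\<phi> (v + w) = \<phi> v + \<phi> w" for v w
    by (rule eqI) (simp_all add: \<phi> add cl)
  moreover have "\<phi> (s c v) = s' c (\<phi> v)" for c v
    by (rule eqI) (simp_all add: \<phi> scale cl)
  moreover have "\<phi> (\<rho> x v) = \<rho>' x (\<phi> v)" for x v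
    by (rule eqI) (simp_all add: \<phi> act cl)
  ultimately show ?thesis using M M' unfolding affine_isomorphic_def by blast
qed

lemma (in twisted_fock_space) sum_of_spectral_flows:
  "affine_isomorphic tscale UNIV rho (pscale tscale) flow_sum (dsum_action (\<lambda>t. spectral_flow tscale (- 2) t rho))"
proof -
  have vs': "vector_space (pscale tscale :: complex \<Rightarrow> (int \<Rightarrow>\<^sub>0 'f tensor_space) \<Rightarrow> _)"
    by (rule vector_space_pscale[OF ts.vector_space_axioms])
  interpret V: vector_space "pscale tscale :: complex \<Rightarrow> (int \<Rightarrow>\<^sub>0 'f tensor_space) \<Rightarrow> _" by (rule vs')
  note sub = subspace_charge_space[of 0]
  have mem: "p \<in> flow_sum \<longleftrightarrow> (\<forall>i. Poly_Mapping.lookup p i \<in> charge_space 0)" for p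
    unfolding dsum_carrier_def by (rule mem_Collect_eq)
  have subspace: "V.subspace flow_sum"
  proof (rule V.subspaceI)
    show "0 \<in> flow_sum" unfolding mem lookup_zero using ts.subspace_0[OF sub] by (intro allI)
  next
    fix p q assume "p \<in> flow_sum" "q \<in> flow_sum"
    thus "p + q \<in> flow_sum" unfolding mem lookup_add by (intro allI ts.subspace_add[OF sub]) (erule spec)+
  next
    fix c p assume "p \<in> flow_sum"
    thus "pscale tscale c p \<in> flow_sum"
      unfolding mem lookup_pscale[OF ts.vector_space_axioms] by (intro allI ts.subspace_scale[OF sub]) (erule spec)
  qed
  have closed: "dsum_action (\<lambda>t. spectral_flow tscale (- 2) t rho) x p \<in> flow_sum" if p: "p \<in> flow_sum" for x p
    unfolding mem
  proof
    fix t
    have "Poly_Mapping.lookup p t \<in> charge_space 0" using p unfolding mem by (rule spec)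
    hence "spectral_flow tscale (- 2) t rho x (Poly_Mapping.lookup p t) \<in> charge_space 0"
      by (rule spectral_flow_charge_space)
    thus "Poly_Mapping.lookup (dsum_action (\<lambda>t. spectral_flow tscale (- 2) t rho) x p) t \<in> charge_space 0"
      using ts.subspace_0[OF sub] unfolding dsum_action_def lookup_mapp
      by (cases "t \<in> Poly_Mapping.keys p") simp_all
  qed
  show ?thesis
    by (rule affine_isomorphic_transport[where \<psi> = assemble])
       (rule affine_module_rho vs' subspace assemble_add assemble_scale closed assemble_action
         bij_betw_imageI[OF assemble_inj assemble_surj] | assumption)+
qed

theorem theorem9p2:
  fixes scale :: "complex \<Rightarrow> 'f::ab_group_add \<Rightarrow> 'f"
    and \<Psi>\<^sub>p \<Psi>\<^sub>m :: "rat \<Rightarrow> 'f \<Rightarrow> 'f" and vac :: 'f and J :: "'f \<Rightarrow> 'f"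
    and lam mu :: complex
  assumes "charged_fock_space scale \<Psi>\<^sub>p \<Psi>\<^sub>m vac J"
    and "lam \<notin> \<int>" and "mu \<notin> \<int>"
  shows "(\<forall>m v. finite {i. current_term scale \<Psi>\<^sub>p 1 lam m v i \<noteq> 0}
              \<and> finite {i. current_term scale \<Psi>\<^sub>m (- 1) mu m v i \<noteq> 0})
    \<and> (\<exists>!\<rho>. is_realization scale \<Psi>\<^sub>p \<Psi>\<^sub>m lam mu \<rho>)
    \<and> (\<forall>\<rho>. is_realization scale \<Psi>\<^sub>p \<Psi>\<^sub>m lam mu \<rho> \<longrightarrow>
          affine_completely_reducible (pscale scale) UNIV \<rho>
        \<and> affine_module (pscale scale) (H0_kernel scale J) \<rho>
        \<and> affine_isomorphic (pscale scale) UNIV \<rho>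
            (pscale (pscale scale))
            (dsum_carrier (\<lambda>s :: int. H0_kernel scale J))
            (dsum_action (\<lambda>s. spectral_flow (pscale scale) (- 2) s \<rho>)))"
proof -
  interpret charged_fock_space scale \<Psi>\<^sub>p \<Psi>\<^sub>m vac J by fact
  interpret twisted_fock_space scale \<Psi>\<^sub>p \<Psi>\<^sub>m vac J lam mu ..
  have "\<exists>!\<rho>. is_realization scale \<Psi>\<^sub>p \<Psi>\<^sub>m lam mu \<rho>"
    by (simp add: is_realization_iff)
  moreover have "affine_completely_reducible (pscale scale) UNIV \<rho>
        \<and> affine_module (pscale scale) (H0_kernel scale J) \<rho>
        \<and> affine_isomorphic (pscale scale) UNIV \<rho> (pscale (pscale scale))
            (dsum_carrier (\<lambda>s :: int. H0_kernel scale J))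
            (dsum_action (\<lambda>s. spectral_flow (pscale scale) (- 2) s \<rho>))"
    if "is_realization scale \<Psi>\<^sub>p \<Psi>\<^sub>m lam mu \<rho>" for \<rho>
  proof -
    have "\<rho> = rho" using that by (simp add: is_realization_iff)
    thus ?thesis
      unfolding H0_kernel_eq
      using completely_reducible[OF assms(2,3)] affine_module_charge_space sum_of_spectral_flows by blast
  qed
  ultimately show ?thesis
    using finite_current_term[OF vertex_field_p] finite_current_term[OF vertex_field_m] by blast
qed

end
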